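(* Let $X=\{1,\dots,k\}^{\mathbb N}$ with the shift $T$, let $\mu$ be the Gibbs state of a Hölder normalized potential $\log p$, let $H>0$ be Hölder, let $\beta\in\mathbb R$, and let $\mathcal U=\mathcal U(\mu)$ with the dynamics $\sigma_t$ determined by $H$. Let $\nu$ be a Borel probability on $X$ and let $\psi_\nu$ be the state on $\mathcal U$ determined by $$\psi_\nu(M_f e_n M_g)=\int f\,\lambda^{-[n]}\,g\,d\nu\qquad(f,g\in C(X),\ n\ge 0),$$ extended by linearity and continuity. Then $\psi_\nu$ is a KMS state for $H$ at inverse temperature $\beta$ if and only if for all $n\in\mathbb N$ and all $f\in C(X)$, $$\int f\,d\nu=\int(\Lambda_n)^{-1}E_\mu(\Lambda_n f\mid\mathcal F_n)\,d\nu .$$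
   Context: $X=\{1,\dots,k\}^{\mathbb N}$, $T$ the left shift, $C(X)$ the complex continuous functions. $p>0$ is Hölder with $\sum_{T(z)=x}p(z)=1$ for all $x$; $\mathcal L_p f(x)=\sum_{T(z)=x}p(z)f(z)$ and $\mu$ is the probability with $\int \mathcal L_p f\,d\mu=\int f\,d\mu$. $H:X\to\mathbb R$ is Hölder and positive. Notation: $\lambda^{[n]}(x)=\prod_{j=0}^{n-1}p(T^jx)^{-1}$, $\lambda^{-[n]}=1/\lambda^{[n]}$, $H^{\beta[n]}(x)=\prod_{j=0}^{n-1}H(T^jx)^\beta$, $\Lambda_n=H^{-\beta[n]}\lambda^{[n]}$; $\mathcal F_n=T^{-n}\mathcal B$ and $E_\mu(\cdot\mid\mathcal F_n)$ is conditional expectation w.r.t. $\mu$ (equal to $(\mathcal L_p^n f)\circ T^n$). Operators on $L^2(\mu)$: $S\eta=\eta\circ T$ (its Hilbert adjoint is $S^*=\mathcal L_p$), $M_f\eta=f\eta$ for $f\in C(X)$, $e_n=S^n(S^* )^n$ (so $e_0=1$). $\mathcal U=\mathcal U(\mu)$ is the C*-subalgebra of bounded operators on $L^2(\mu)$ generated by all $M_fS^n(S^* )^nM_g$, $n\ge0$, $f,g\in C(X)$. The one-parameter automorphism group $\sigma_t$ ($t\in\mathbb R$) of $\mathcal U$ is determined by $\sigma_t(M_f)=M_f$ and $\sigma_t(S)=M_{H^{it}}S$; an element $a$ is analytic if $t\mapsto\sigma_t(a)$ extends to an entire function on $\mathbb C$. A state is a positive linear functional $\psi$ on $\mathcal U$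 with $\psi(1)=1$. A state $\psi$ is a KMS state for $H$ at $\beta$ if $\psi(ab)=\psi(b\,\sigma_{i\beta}(a))$ for all $b\in\mathcal U$ and all analytic $a\in\mathcal U$. *)

theory Defs
  imports "HOL-Probability.Probability"
begin

type_synonym pt = "nat \<Rightarrow> nat"
type_synonym cfun = "pt \<Rightarrow> complex"
type_synonym op = "cfun \<Rightarrow> cfun"

definition Xk :: "nat \<Rightarrow> pt set" where
  "Xk k = {x. \<forall>n. x n \<in> {1..k}}"

definition shift :: "pt \<Rightarrow> pt" where
  "shift x = (\<lambda>n. x (Suc n))"

definition dshift :: "pt \<Rightarrow> pt \<Rightarrow> real" where
  "dshift x y = (if x = y then 0 else (1/2) ^ (LEAST n. x n \<noteq> y n))"

definition holder_on :: "pt set \<Rightarrow> (pt \<Rightarrow> real) \<Rightarrow> bool" where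
  "holder_on A f \<longleftrightarrow> (\<exists>C \<alpha>. \<alpha> > 0 \<and> (\<forall>x\<in>A. \<forall>y\<in>A. \<bar>f x - f y\<bar> \<le> C * dshift x y powr \<alpha>))"

definition L2 :: "pt measure \<Rightarrow> cfun set" where
  "L2 M = {\<eta>. \<eta> \<in> borel_measurable M \<and> integrable M (\<lambda>x. (cmod (\<eta> x))\<^sup>2)}"

definition L2norm :: "pt measure \<Rightarrow> cfun \<Rightarrow> real" where
  "L2norm M \<eta> = sqrt (\<integral>x. (cmod (\<eta> x))\<^sup>2 \<partial>M)"

definition inner2 :: "pt measure \<Rightarrow> cfun \<Rightarrow> cfun \<Rightarrow> complex" where
  "inner2 M \<eta> \<xi> = (\<integral>x. \<eta> x * cnj (\<xi> x) \<partial>M)"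

definition op_add :: "op \<Rightarrow> op \<Rightarrow> op" (infixl "+\<^sub>o" 65) where
  "A +\<^sub>o B = (\<lambda>\<eta> x. A \<eta> x + B \<eta> x)"

definition op_smult :: "complex \<Rightarrow> op \<Rightarrow> op" (infixr "*\<^sub>o" 75) where
  "c *\<^sub>o A = (\<lambda>\<eta> x. c * A \<eta> x)"

definition op_diff :: "op \<Rightarrow> op \<Rightarrow> op" (infixl "-\<^sub>o" 65) where
  "A -\<^sub>o B = (\<lambda>\<eta> x. A \<eta> x - B \<eta> x)"

definition bop :: "pt measure \<Rightarrow> op \<Rightarrow> bool" where
  "bop M A \<longleftrightarrow> (\<forall>\<eta>\<in>L2 M. A \<eta> \<in> L2 M)
     \<and> (\<forall>\<eta>\<in>L2 M. \<forall>\<xi>\<in>L2 M. AE x in M. A (\<lambda>y. \<eta> y + \<xi> y) x = A \<eta> x + A \<xi> x)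
     \<and> (\<forall>\<eta>\<in>L2 M. \<forall>c. AE x in M. A (\<lambda>y. c * \<eta> y) x = c * A \<eta> x)
     \<and> (\<exists>C. \<forall>\<eta>\<in>L2 M. L2norm M (A \<eta>) \<le> C * L2norm M \<eta>)"

definition opeq :: "pt measure \<Rightarrow> op \<Rightarrow> op \<Rightarrow> bool" where
  "opeq M A B \<longleftrightarrow> (\<forall>\<eta>\<in>L2 M. AE x in M. A \<eta> x = B \<eta> x)"

definition opnorm :: "pt measure \<Rightarrow> op \<Rightarrow> real" where
  "opnorm M A = Sup {L2norm M (A \<eta>) | \<eta>. \<eta> \<in> L2 M \<and> L2norm M \<eta> \<le> 1}"

definition is_adjoint :: "pt measure \<Rightarrow> op \<Rightarrow> op \<Rightarrow> bool" where
  "is_adjoint M A B \<longleftrightarrow> (\<forall>\<eta>\<in>L2 M. \<forall>\<xi>\<in>L2 M. inner2 M (A \<eta>) \<xi> = inner2 M \<eta> (B \<xi>))"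

definition positive_op :: "pt measure \<Rightarrow> op \<Rightarrow> bool" where
  "positive_op M A \<longleftrightarrow> (\<forall>\<eta>\<in>L2 M. Im (inner2 M (A \<eta>) \<eta>) = 0 \<and> Re (inner2 M (A \<eta>) \<eta>) \<ge> 0)"

section \<open>The operators M_f, S, S^* = L_p, e_n\<close>

definition Mop :: "cfun \<Rightarrow> op" where
  "Mop f = (\<lambda>\<eta> x. f x * \<eta> x)"

definition Sop :: op where
  "Sop = (\<lambda>\<eta>. \<eta> \<circ> shift)"

text \<open>Ruelle operator L_p; the preimages of x under T are the points a#x = case_nat a x.\<close>
definition Lp :: "nat \<Rightarrow> (pt \<Rightarrow> real) \<Rightarrow> op" where
  "Lp k p = (\<lambda>\<eta> x. \<Sum>a\<in>{1..k}. complex_of_real (p (case_nat a x)) * \<eta> (case_nat a x))"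

definition en :: "nat \<Rightarrow> (pt \<Rightarrow> real) \<Rightarrow> nat \<Rightarrow> op" where
  "en k p n = (Sop ^^ n) \<circ> (Lp k p ^^ n)"

inductive_set Alg0 :: "nat \<Rightarrow> (pt \<Rightarrow> real) \<Rightarrow> op set" for k p where
  gen: "continuous_on (Xk k) f \<Longrightarrow> continuous_on (Xk k) g \<Longrightarrow> Mop f \<circ> en k p n \<circ> Mop g \<in> Alg0 k p"
| add: "A \<in> Alg0 k p \<Longrightarrow> B \<in> Alg0 k p \<Longrightarrow> A +\<^sub>o B \<in> Alg0 k p"
| smult: "A \<in> Alg0 k p \<Longrightarrow> c *\<^sub>o A \<in> Alg0 k p"
| mult: "A \<in> Alg0 k p \<Longrightarrow> B \<in> Alg0 k p \<Longrightarrow> A \<circ> B \<in> Alg0 k p"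

definition Ualg :: "pt measure \<Rightarrow> nat \<Rightarrow> (pt \<Rightarrow> real) \<Rightarrow> op set" where
  "Ualg M k p = {A. bop M A \<and> (\<forall>\<epsilon>>0. \<exists>B\<in>Alg0 k p. opnorm M (A -\<^sub>o B) < \<epsilon>)}"

definition lam_inv :: "(pt \<Rightarrow> real) \<Rightarrow> nat \<Rightarrow> pt \<Rightarrow> real" where
  "lam_inv p n x = (\<Prod>j<n. p ((shift ^^ j) x))"

definition Lambda :: "(pt \<Rightarrow> real) \<Rightarrow> (pt \<Rightarrow> real) \<Rightarrow> real \<Rightarrow> nat \<Rightarrow> pt \<Rightarrow> real" where
  "Lambda p H \<beta> n x = (\<Prod>j<n. H ((shift ^^ j) x) powr (- \<beta>) / p ((shift ^^ j) x))"

definition Hit :: "(pt \<Rightarrow> real) \<Rightarrow> real \<Rightarrow> nat \<Rightarrow> pt \<Rightarrow> complex" where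
  "Hit H t n x = (\<Prod>j<n. exp (\<i> * complex_of_real t * complex_of_real (ln (H ((shift ^^ j) x)))))"

text \<open>sigma is a strongly continuous one-parameter group of *-automorphisms of U with
  sigma_t(M_f) = M_f and sigma_t(S) = M_{H^{it}} S, i.e. on the generators
  sigma_t(M_f e_n M_g) = M_{f H^{it[n]}} e_n M_{H^{-it[n]} g}.\<close>
definition dynamics :: "pt measure \<Rightarrow> nat \<Rightarrow> (pt \<Rightarrow> real) \<Rightarrow> (pt \<Rightarrow> real) \<Rightarrow> (real \<Rightarrow> op \<Rightarrow> op) \<Rightarrow> bool" where
  "dynamics M k p H \<sigma> \<longleftrightarrow>
     (\<forall>t. \<forall>a\<in>Ualg M k p. \<sigma> t a \<in> Ualg M k p)
   \<and> (\<forall>t. \<forall>b\<in>Ualg M k p. \<exists>a\<in>Ualg M k p. opeq M (\<sigma> t a) b)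
   \<and> (\<forall>t. \<forall>a\<in>Ualg M k p. \<forall>b\<in>Ualg M k p. opeq M (\<sigma> t (a +\<^sub>o b)) (\<sigma> t a +\<^sub>o \<sigma> t b))
   \<and> (\<forall>t c. \<forall>a\<in>Ualg M k p. opeq M (\<sigma> t (c *\<^sub>o a)) (c *\<^sub>o \<sigma> t a))
   \<and> (\<forall>t. \<forall>a\<in>Ualg M k p. \<forall>b\<in>Ualg M k p. opeq M (\<sigma> t (a \<circ> b)) (\<sigma> t a \<circ> \<sigma> t b))
   \<and> (\<forall>t. \<forall>a\<in>Ualg M k p. \<forall>b\<in>Ualg M k p. is_adjoint M a b \<longrightarrow> is_adjoint M (\<sigma> t a) (\<sigma> t b))
   \<and> (\<forall>t. \<forall>a\<in>Ualg M k p. opnorm M (\<sigma> t a) = opnorm M a)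
   \<and> (\<forall>a\<in>Ualg M k p. opeq M (\<sigma> 0 a) a)
   \<and> (\<forall>s t. \<forall>a\<in>Ualg M k p. opeq M (\<sigma> (s + t) a) (\<sigma> s (\<sigma> t a)))
   \<and> (\<forall>a\<in>Ualg M k p. ((\<lambda>t. opnorm M (\<sigma> t a -\<^sub>o a)) \<longlongrightarrow> 0) (at 0))
   \<and> (\<forall>t f g n. continuous_on (Xk k) f \<longrightarrow> continuous_on (Xk k) g \<longrightarrow>
        opeq M (\<sigma> t (Mop f \<circ> en k p n \<circ> Mop g))
               (Mop (\<lambda>x. f x * Hit H t n x) \<circ> en k p n \<circ> Mop (\<lambda>x. cnj (Hit H t n x) * g x)))"

definition is_state :: "pt measure \<Rightarrow> nat \<Rightarrow> (pt \<Rightarrow> real) \<Rightarrow> (op \<Rightarrow> complex) \<Rightarrow> bool" where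
  "is_state M k p \<psi> \<longleftrightarrow>
     (\<forall>a\<in>Ualg M k p. \<forall>b\<in>Ualg M k p. \<psi> (a +\<^sub>o b) = \<psi> a + \<psi> b)
   \<and> (\<forall>c. \<forall>a\<in>Ualg M k p. \<psi> (c *\<^sub>o a) = c * \<psi> a)
   \<and> (\<forall>a\<in>Ualg M k p. positive_op M a \<longrightarrow> Im (\<psi> a) = 0 \<and> Re (\<psi> a) \<ge> 0)
   \<and> \<psi> id = 1"

definition entire_ext :: "pt measure \<Rightarrow> nat \<Rightarrow> (pt \<Rightarrow> real) \<Rightarrow> (real \<Rightarrow> op \<Rightarrow> op) \<Rightarrow> op \<Rightarrow> (complex \<Rightarrow> op) \<Rightarrow> bool" where
  "entire_ext M k p \<sigma> a F \<longleftrightarrow>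
     (\<forall>z. F z \<in> Ualg M k p)
   \<and> (\<forall>t. opeq M (F (complex_of_real t)) (\<sigma> t a))
   \<and> (\<forall>z. \<exists>D. bop M D \<and>
        ((\<lambda>w. opnorm M (F w -\<^sub>o F z -\<^sub>o (w - z) *\<^sub>o D) / cmod (w - z)) \<longlongrightarrow> 0) (at z))"

definition analytic_el :: "pt measure \<Rightarrow> nat \<Rightarrow> (pt \<Rightarrow> real) \<Rightarrow> (real \<Rightarrow> op \<Rightarrow> op) \<Rightarrow> op \<Rightarrow> bool" where
  "analytic_el M k p \<sigma> a \<longleftrightarrow> a \<in> Ualg M k p \<and> (\<exists>F. entire_ext M k p \<sigma> a F)"

text \<open>KMS condition: psi(ab) = psi(b sigma_{i beta}(a)) for analytic a, where
  sigma_{i beta}(a) = F(i beta) for the entire extension F (unique by the identity theorem).\<close>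
definition KMS :: "pt measure \<Rightarrow> nat \<Rightarrow> (pt \<Rightarrow> real) \<Rightarrow> (real \<Rightarrow> op \<Rightarrow> op) \<Rightarrow> real \<Rightarrow> (op \<Rightarrow> complex) \<Rightarrow> bool" where
  "KMS M k p \<sigma> \<beta> \<psi> \<longleftrightarrow> is_state M k p \<psi> \<and>
     (\<forall>a F. a \<in> Ualg M k p \<longrightarrow> entire_ext M k p \<sigma> a F \<longrightarrow>
        (\<forall>b\<in>Ualg M k p. \<psi> (a \<circ> b) = \<psi> (b \<circ> F (\<i> * complex_of_real \<beta>))))"

end

(* The KMS identity psi(ab) = psi(b sigma_{i beta}(a)) for a = M_{f lambda^[n]} e_n and b = e_n is the stated
   integral identity, because e_n M_u e_n = M_{E_n u} e_n.  Conversely, writing E_r for the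
   conditional expectation onto T^{-r}B, products of generators are again generators, and for
   generators M_f e_n M_g and M_h e_m M_l with r = min m n the identity, applied twice, turns both
   sides of the KMS condition into one integral that is symmetric in E_r(f l H^{-beta[r]}) and
   E_r(g h).  An arbitrary analytic a is approximated by elements of the span of the generators,
   whose entire extensions are bounded on horizontal strips; by the three lines bound their
   functions z |-> psi(b sigma_{beta z}(a_j)) converge uniformly on 0 <= Im z <= 1, and the limit
   agrees with z |-> psi(b F(beta z)) because it does so on the real axis. *)
theory Submission
  imports Defs "HOL-Complex_Analysis.Complex_Analysis"
begin

section \<open>The three lines bound and limits on a strip\<close>

text \<open>The obstacle is that no norm bound is available for a -> sigma_{i beta}(a), so the KMS
  identity does not pass to a norm limit in a by continuity. Only boundary data pass: on the real
  line because sigma_t is isometric, and on the line Im z = 1 because the KMS identity of the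
  approximants carries it back to the real line. Nothing bounds the given extension F on the strip,
  so growth estimates concern the approximants alone, and F is compared with their limit by gluing
  zero across the real axis. This works for whichever entire extension is given and never goes
  through its uniqueness. The parameter beta z treats every sign of beta, and beta = 0, at once.
  Operators here are maps on functions, not on a.e. classes: linearity and the rules for sigma hold
  only up to \<open>opeq\<close>, and boundedness is what makes functionals blind to the difference.
  Likewise mu is tested only against continuous functions, while the L2 bounds need measurable ones;
  the clopen sets of the shift space bridge this gap.\<close>

lemma three_lines_bounded:
  fixes f :: "complex \<Rightarrow> complex"
  assumes hol: "f holomorphic_on UNIV"
    and bdd: "\<And>z. 0 \<le> Im z \<Longrightarrow> Im z \<le> 1 \<Longrightarrow> cmod (f z) \<le> K"
    and bot: "\<And>z. Im z = 0 \<Longrightarrow> cmod (f z) \<le> B"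
    and top: "\<And>z. Im z = 1 \<Longrightarrow> cmod (f z) \<le> B"
    and z: "0 \<le> Im z" "Im z \<le> 1"
  shows "cmod (f z) \<le> B"
proof -
  have B0: "0 \<le> B" by (rule order_trans[OF norm_ge_zero bot[of 0]]) simp
  have K0: "0 \<le> K" by (rule order_trans[OF norm_ge_zero bdd[of 0]]) simp_all
  have main: "cmod (f z) * exp (- e * (Re z)\<^sup>2) \<le> exp e * B" if e: "e > 0" for e
  proof -
    \<comment> \<open>The slack \<open>d\<close> is there because the estimate on the vertical sides
      of a finite rectangle is small but need not lie below B, for instance when B = 0.\<close>
    have claim: "cmod (f z) * exp (- e * (Re z)\<^sup>2) \<le> exp e * (B + d)" if d: "d > 0" for d
    proof -
      \<comment> \<open>Since Re (w^2) = (Re w)^2 - (Im w)^2, the Gaussian factor decays along the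
        strip and lets the crude bound K fall below \<open>d\<close> on the far sides. It costs at
        most the factor exp e, because (Im w)^2 is at most 1, and that factor disappears as e tends
        to 0.\<close>
      define h where "h = (\<lambda>w. f w * exp (- (of_real e * w\<^sup>2)))"
      have norm_h: "cmod (h w) = cmod (f w) * exp (e * (Im w)\<^sup>2 - e * (Re w)\<^sup>2)" for w
        by (simp add: h_def norm_mult power2_eq_square algebra_simps)
      have "((\<lambda>R. K * exp (e - e * R\<^sup>2)) \<longlongrightarrow> 0) at_top"
        using e by real_asymp
      then have "\<forall>\<^sub>F R in at_top. K * exp (e - e * R\<^sup>2) < d"
        using d by (rule order_tendstoD)
      then obtain R0 where R0: "\<And>R. R \<ge> R0 \<Longrightarrow> K * exp (e - e * R\<^sup>2) < d"
        by (auto simp: eventually_at_top_linorder)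
      define R where "R = max (max R0 (\<bar>Re z\<bar> + 1)) 1"
      have R: "K * exp (e - e * R\<^sup>2) < d" "\<bar>Re z\<bar> < R" "R > 0"
        using R0[of R] by (auto simp: R_def)
      define S where "S = cbox (Complex (-R) 0) (Complex R 1)"
      have S: "w \<in> S \<longleftrightarrow> \<bar>Re w\<bar> \<le> R \<and> 0 \<le> Im w \<and> Im w \<le> 1" for w
        by (auto simp: S_def in_cbox_complex_iff)
      have intS: "interior S = {w. \<bar>Re w\<bar> < R \<and> 0 < Im w \<and> Im w < 1}"
        unfolding S_def interior_cbox by (auto simp: in_box_complex_iff)
      have hol_h: "h holomorphic_on UNIV"
        unfolding h_def by (intro holomorphic_intros hol)
      have "cmod (h z) \<le> exp e * (B + d)"
      proof (rule maximum_modulus_frontier[where S = S and f = h])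
        show "h holomorphic_on interior S" "continuous_on (closure S) h"
          using hol_h holomorphic_on_subset holomorphic_on_imp_continuous_on
          by blast+
        show "bounded S" by (simp add: S_def)
        show "z \<in> S" using R z by (simp add: S)
        fix w assume "w \<in> frontier S"
        then have w: "w \<in> S" "w \<notin> interior S"
          by (simp_all add: frontier_def S_def)
        then have Im: "0 \<le> Im w" "Im w \<le> 1" by (simp_all add: S)
        have Imsq: "(Im w)\<^sup>2 \<le> 1" using Im by (simp add: power_le_one)
        consider "Im w = 0 \<or> Im w = 1" | "\<bar>Re w\<bar> = R"
          using w S intS by fastforce
        then show "cmod (h w) \<le> exp e * (B + d)"
        proof cases
          case 1
          then have "cmod (f w) \<le> B" using bot top by blast
          moreover have "exp (e * (Im w)\<^sup>2 - e * (Re w)\<^sup>2) \<le> exp e"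
          proof -
            have "e * (Im w)\<^sup>2 \<le> e * 1" using Imsq e by (intro mult_left_mono) auto
            moreover have "e * (Re w)\<^sup>2 \<ge> 0" using e by simp
            ultimately show ?thesis by simp
          qed
          ultimately have "cmod (h w) \<le> B * exp e"
            unfolding norm_h by (intro mult_mono) (use B0 in auto)
          then show ?thesis using d
            by (smt (verit, best) exp_gt_zero mult.commute mult_left_mono)
        next
          case 2
          have Re2: "(Re w)\<^sup>2 = R\<^sup>2" using 2 by (metis power2_abs)
          have "e * (Im w)\<^sup>2 \<le> e * 1" using Imsq e by (intro mult_left_mono) auto
          then have "exp (e * (Im w)\<^sup>2 - e * (Re w)\<^sup>2) \<le> exp (e - e * R\<^sup>2)"
            using Re2 by simp
          then have "cmod (h w) \<le> K * exp (e - e * R\<^sup>2)"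
            unfolding norm_h by (intro mult_mono bdd Im) (use K0 in auto)
          also have "\<dots> \<le> B + d" using R B0 by simp
          also have "\<dots> \<le> exp e * (B + d)"
            using B0 d e by (simp add: mult_le_cancel_right1)
          finally show ?thesis .
        qed
      qed
      moreover have "cmod (f z) * exp (- e * (Re z)\<^sup>2) \<le> cmod (h z)"
        unfolding norm_h using e by (intro mult_left_mono) auto
      ultimately show ?thesis by linarith
    qed
    show ?thesis
    proof (rule field_le_epsilon)
      fix d :: real assume "d > 0"
      then have "cmod (f z) * exp (- e * (Re z)\<^sup>2) \<le> exp e * (B + d / exp e)"
        by (intro claim) simp
      then show "cmod (f z) * exp (- e * (Re z)\<^sup>2) \<le> exp e * B + d"
        by (simp add: distrib_left)
    qed
  qed
  have "((\<lambda>e. exp e * B) \<longlongrightarrow> exp 0 * B) (at_right 0)"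
    by (intro tendsto_intros)
  moreover have "((\<lambda>e. cmod (f z) * exp (- e * (Re z)\<^sup>2)) \<longlongrightarrow> cmod (f z) * exp (- 0 * (Re z)\<^sup>2)) (at_right 0)"
    by (intro tendsto_intros)
  ultimately have "cmod (f z) * exp (- 0 * (Re z)\<^sup>2) \<le> exp 0 * B"
    by (rule tendsto_le[rotated]) (auto intro!: eventually_at_rightI[of 0 1] main[simplified])
  then show ?thesis by simp
qed

text \<open>A reflection argument in its simplest form: as d vanishes on the real axis, the zero
  function below the axis glues to it holomorphically, and the identity theorem does the
  rest.\<close>

lemma zero_on_strip_top:
  fixes d :: "complex \<Rightarrow> complex"
  assumes cont: "continuous_on {z. 0 \<le> Im z \<and> Im z \<le> 1} d"
    and hol: "d holomorphic_on {z. 0 < Im z \<and> Im z < 1}"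
    and zero: "\<And>z. Im z = 0 \<Longrightarrow> d z = 0"
  shows "d \<i> = 0"
proof -
  define D where "D = (\<lambda>z. if Im z \<le> 0 then 0 else d z)"
  define S where "S = {z. Im z < 1}"
  have open_S: "open S" by (simp add: S_def open_halfspace_Im_lt)
  have "D holomorphic_on S"
  proof (rule holomorphic_on_paste_across_line[where d = \<i> and k = 0])
    show "D holomorphic_on S \<inter> {z. \<i> \<bullet> z < 0}"
      by (rule holomorphic_transform[of "\<lambda>_. 0"]) (auto simp: D_def inner_complex_def)
    show "D holomorphic_on S \<inter> {z. 0 < \<i> \<bullet> z}"
    proof (rule holomorphic_transform[of d])
      show "d holomorphic_on S \<inter> {z. 0 < \<i> \<bullet> z}"
        by (rule holomorphic_on_subset[OF hol]) (auto simp: S_def inner_complex_def)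
    qed (auto simp: D_def inner_complex_def)
    have "continuous_on ({z. Im z \<le> 0} \<inter> S \<union> {z. 0 \<le> Im z} \<inter> S) D"
      unfolding D_def
    proof (rule continuous_on_cases_local)
      show "closedin (top_of_set ({z. Im z \<le> 0} \<inter> S \<union> {z. 0 \<le> Im z} \<inter> S)) ({z. Im z \<le> 0} \<inter> S)"
        using closed_halfspace_Im_le[of 0]
        by (auto simp: closedin_closed intro!: exI[of _ "{z. Im z \<le> 0}"])
      show "closedin (top_of_set ({z. Im z \<le> 0} \<inter> S \<union> {z. 0 \<le> Im z} \<inter> S)) ({z. 0 \<le> Im z} \<inter> S)"
        using closed_halfspace_Im_ge[of 0]
        by (auto simp: closedin_closed intro!: exI[of _ "{z. 0 \<le> Im z}"])
      show "continuous_on ({z. 0 \<le> Im z} \<inter> S) d"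
        by (rule continuous_on_subset[OF cont]) (auto simp: S_def)
    qed (auto simp: zero)
    moreover have "{z. Im z \<le> 0} \<inter> S \<union> {z. 0 \<le> Im z} \<inter> S = S" by auto
    ultimately show "continuous_on S D" by simp
  qed (use open_S in auto)
  then have D0: "D z = 0" if "z \<in> S" for z
  proof (rule analytic_continuation[where U = "{z. Im z < 0}" and \<xi> = "- \<i>"])
    show "connected S" unfolding S_def
      by (intro convex_connected convex_halfspace_Im_lt)
    show "- \<i> islimpt {z. Im z < 0}"
      by (rule interior_limit_point) (simp add: open_halfspace_Im_lt interior_open)
  qed (use open_S that in \<open>auto simp: S_def D_def\<close>)
  \<comment> \<open>The point i lies on the boundary of S, outside the reach of the identity
    theorem; it is approached along the imaginary axis, using continuity on the closed
    strip.\<close>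
  have lim: "((\<lambda>t. d (of_real t * \<i>)) \<longlongrightarrow> d (of_real 1 * \<i>)) (at 1 within {0..1})"
  proof -
    have "continuous_on {0..1} (\<lambda>t::real. d (of_real t * \<i>))"
      by (rule continuous_on_compose2[OF cont]) (auto intro!: continuous_intros)
    then show ?thesis unfolding continuous_on by (rule bspec) simp
  qed
  moreover have "((\<lambda>t. d (of_real t * \<i>)) \<longlongrightarrow> 0) (at 1 within {0..1})"
  proof (rule tendsto_eventually)
    have "d (of_real t * \<i>) = 0" if "0 \<le> t" "t < 1" for t
      using D0[of "of_real t * \<i>"] zero[of "of_real t * \<i>"] that
      by (auto simp: D_def S_def split: if_splits)
    then show "\<forall>\<^sub>F t in at 1 within {0..1}. d (of_real t * \<i>) = 0"
      by (auto simp: eventually_at_filter)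
  qed
  moreover have "at (1::real) within {0..1} \<noteq> bot"
    by (simp add: at_within_Icc_at_left trivial_limit_at_left_real)
  ultimately show ?thesis
    using tendsto_unique by fastforce
qed

text \<open>The strip form of the density argument: boundary values of the approximants
  pass to the limit by the three lines bound, and the limit is identified with \<open>g\<close>
  by its vanishing difference on the real axis.\<close>
lemma strip_limit:
  fixes g :: "complex \<Rightarrow> complex" and G :: "nat \<Rightarrow> complex \<Rightarrow> complex"
  assumes g: "g holomorphic_on UNIV" and G: "\<And>j. G j holomorphic_on UNIV"
    and bdd: "\<And>j. \<exists>K. \<forall>z. 0 \<le> Im z \<longrightarrow> Im z \<le> 1 \<longrightarrow> cmod (G j z) \<le> K"
    and bot: "\<And>j t. cmod (G j (of_real t) - g (of_real t)) \<le> \<epsilon> j"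
    and top: "\<And>j t. cmod (G j (of_real t + \<i>) - c t) \<le> \<epsilon> j"
    and \<epsilon>: "\<epsilon> \<longlonglongrightarrow> 0"
  shows "g \<i> = c 0"
proof -
  define S where "S = {z::complex. 0 \<le> Im z \<and> Im z \<le> 1}"
  have real: "of_real (Re z) = z" if "Im z = 0" for z
    using that by (simp add: complex_eq_iff)
  have real': "of_real (Re z) + \<i> = z" if "Im z = 1" for z
    using that by (simp add: complex_eq_iff)
  \<comment> \<open>Only the \<open>G j\<close> are known to be bounded on the strip, so the three
    lines bound is applied to their differences and never to \<open>G j z - g z\<close>. On each
    boundary line the common comparison value, g below and c above, drops out.\<close>
  have diff: "cmod (G i z - G j z) \<le> \<epsilon> i + \<epsilon> j" if "z \<in> S" for i j z
  proof -
    obtain K1 K2 where K: "\<And>z. 0 \<le> Im z \<Longrightarrow> Im z \<le> 1 \<Longrightarrow> cmod (G i z) \<le> K1"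
      "\<And>z. 0 \<le> Im z \<Longrightarrow> Im z \<le> 1 \<Longrightarrow> cmod (G j z) \<le> K2"
      using bdd by metis
    show ?thesis
    proof (rule three_lines_bounded[where f = "\<lambda>z. G i z - G j z" and K = "K1 + K2"])
      show "(\<lambda>z. G i z - G j z) holomorphic_on UNIV"
        by (intro holomorphic_intros G)
      show "cmod (G i z - G j z) \<le> K1 + K2" if "0 \<le> Im z" "Im z \<le> 1" for z
        using K[OF that] norm_triangle_ineq4[of "G i z" "G j z"] by linarith
      show "cmod (G i z - G j z) \<le> \<epsilon> i + \<epsilon> j" if "Im z = 0" for z
        using bot[of i "Re z"] bot[of j "Re z"] real[OF that]
          norm_triangle_ineq4[of "G i z - g z" "G j z - g z"] by simp
      show "cmod (G i z - G j z) \<le> \<epsilon> i + \<epsilon> j" if "Im z = 1" for z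
        using top[of i "Re z"] top[of j "Re z"] real'[OF that]
          norm_triangle_ineq4[of "G i z - c (Re z)" "G j z - c (Re z)"] by simp
    qed (use that in \<open>auto simp: S_def\<close>)
  qed
  have "uniformly_Cauchy_on S G"
  proof (rule uniformly_Cauchy_onI)
    fix e :: real assume "e > 0"
    then have "\<forall>\<^sub>F n in sequentially. \<epsilon> n < e / 2"
      using \<epsilon> by (intro order_tendstoD(2)) auto
    then obtain N where *: "\<And>n. n \<ge> N \<Longrightarrow> \<epsilon> n < e / 2"
      by (auto simp: eventually_sequentially)
    have "dist (G m x) (G n x) < e" if "x \<in> S" "m \<ge> N" "n \<ge> N" for x m n
      using diff[OF that(1), of m n] that(2,3)[THEN *] unfolding dist_norm by linarith
    then show "\<exists>M. \<forall>x\<in>S. \<forall>m\<ge>M. \<forall>n\<ge>M. dist (G m x) (G n x) < e" by blast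
  qed
  then obtain L where L: "uniform_limit S G L sequentially"
    using Cauchy_uniformly_convergent uniformly_convergent_on_def by blast
  have pt: "(\<lambda>j. G j z) \<longlonglongrightarrow> L z" if "z \<in> S" for z
    using L that by (rule tendsto_uniform_limitI)
  have L_bot: "L z = g z" if "Im z = 0" for z
  proof (rule LIMSEQ_unique)
    show "(\<lambda>j. G j z) \<longlonglongrightarrow> L z" using that by (intro pt) (simp add: S_def)
    show "(\<lambda>j. G j z) \<longlonglongrightarrow> g z"
      by (rule Lim_null_comparison[THEN LIM_zero_cancel, OF _ \<epsilon>])
         (use bot[of _ "Re z"] real[OF that] in simp)
  qed
  have L_top: "L \<i> = c 0"
  proof (rule LIMSEQ_unique)
    show "(\<lambda>j. G j \<i>) \<longlonglongrightarrow> L \<i>" by (intro pt) (simp add: S_def)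
    show "(\<lambda>j. G j \<i>) \<longlonglongrightarrow> c 0"
      by (rule Lim_null_comparison[THEN LIM_zero_cancel, OF _ \<epsilon>]) (use top[of _ 0] in simp)
  qed
  have cont: "continuous_on A f" if "f holomorphic_on UNIV" for A and f :: "complex \<Rightarrow> complex"
    using that holomorphic_on_subset holomorphic_on_imp_continuous_on by blast
  have open_int: "open {z. 0 < Im z \<and> Im z < 1}"
    by (intro open_Collect_conj open_halfspace_Im_gt open_halfspace_Im_lt)
  have "L holomorphic_on {z. 0 < Im z \<and> Im z < 1}"
  proof (rule holomorphic_uniform_sequence[OF open_int, where f = G])
    fix z :: complex assume "z \<in> {z. 0 < Im z \<and> Im z < 1}"
    then obtain d where d: "0 < d" "cball z d \<subseteq> {z. 0 < Im z \<and> Im z < 1}"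
      using open_int open_contains_cball by blast
    moreover have "cball z d \<subseteq> S" using d by (auto simp: S_def)
    then have "uniform_limit (cball z d) G L sequentially"
      by (rule uniform_limit_on_subset[OF L])
    ultimately show "\<exists>d>0. cball z d \<subseteq> {z. 0 < Im z \<and> Im z < 1} \<and>
        uniform_limit (cball z d) G L sequentially" by blast
  qed (use G holomorphic_on_subset in blast)
  moreover have "continuous_on S L"
    by (rule uniform_limit_theorem[OF _ L]) (auto intro: cont G always_eventually)
  moreover have "g holomorphic_on {z. 0 < Im z \<and> Im z < 1}"
    using g holomorphic_on_subset by blast
  \<comment> \<open>The limit L is known to be holomorphic only in the open strip and continuous up
    to its boundary, which is the form of regularity that \<open>zero_on_strip_top\<close> is made
    for.\<close>
  ultimately have "L \<i> - g \<i> = 0"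
    by (intro zero_on_strip_top[where d = "\<lambda>z. L z - g z"] continuous_on_diff holomorphic_on_diff cont[OF g])
       (simp_all add: S_def L_bot)
  then show ?thesis using L_top by simp
qed

section \<open>Bounded operators on the L2 space\<close>

lemma L2_measurable [measurable_dest]: "\<eta> \<in> L2 M \<Longrightarrow> \<eta> \<in> borel_measurable M"
  by (simp add: L2_def)

lemma L2_integrable: "\<eta> \<in> L2 M \<Longrightarrow> integrable M (\<lambda>x. (cmod (\<eta> x))\<^sup>2)"
  by (simp add: L2_def)

text \<open>Young's inequality with a free weight. The choice s = 1 gives closure of L2 under sums;
  optimising s gives Minkowski's inequality without integrating a product of two functions.\<close>

lemma norm_add_sq_le:
  assumes "(s::real) > 0"
  shows "(cmod (a + b))\<^sup>2 \<le> (1 + s) * (cmod a)\<^sup>2 + (1 + 1 / s) * (cmod b)\<^sup>2"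
proof -
  have "0 \<le> (s * cmod a - cmod b)\<^sup>2 / s" using assms by simp
  also have "\<dots> = s * (cmod a)\<^sup>2 + (cmod b)\<^sup>2 / s - 2 * cmod a * cmod b"
    using assms by (simp add: power2_eq_square field_simps)
  finally have "(cmod a + cmod b)\<^sup>2 \<le> (1 + s) * (cmod a)\<^sup>2 + (1 + 1 / s) * (cmod b)\<^sup>2"
    by (simp add: power2_eq_square algebra_simps)
  moreover have "(cmod (a + b))\<^sup>2 \<le> (cmod a + cmod b)\<^sup>2"
    by (intro power_mono norm_triangle_ineq) simp
  ultimately show ?thesis by linarith
qed

lemma L2_add:
  assumes "\<eta> \<in> L2 M" "\<xi> \<in> L2 M"
  shows "(\<lambda>x. \<eta> x + \<xi> x) \<in> L2 M"
proof -
  note [measurable] = assms[THEN L2_measurable]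
  have "integrable M (\<lambda>x. (cmod (\<eta> x + \<xi> x))\<^sup>2)"
  proof (rule Bochner_Integration.integrable_bound)
    show "integrable M (\<lambda>x. 2 * (cmod (\<eta> x))\<^sup>2 + 2 * (cmod (\<xi> x))\<^sup>2)"
      by (intro Bochner_Integration.integrable_add integrable_mult_right L2_integrable assms)
    show "AE x in M. norm ((cmod (\<eta> x + \<xi> x))\<^sup>2) \<le> norm (2 * (cmod (\<eta> x))\<^sup>2 + 2 * (cmod (\<xi> x))\<^sup>2)"
      using norm_add_sq_le[of 1] by auto
  qed measurable
  then show ?thesis by (simp add: L2_def)
qed

lemma L2_smult: "\<eta> \<in> L2 M \<Longrightarrow> (\<lambda>x. c * \<eta> x) \<in> L2 M"
  by (auto simp: L2_def norm_mult power_mult_distrib)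

lemma L2_zero [simp]: "(\<lambda>x. 0) \<in> L2 M"
  by (simp add: L2_def)

lemma L2norm_zero [simp]: "L2norm M (\<lambda>x. 0) = 0"
  by (simp add: L2norm_def)

lemma L2_diff: "\<eta> \<in> L2 M \<Longrightarrow> \<xi> \<in> L2 M \<Longrightarrow> (\<lambda>x. \<eta> x - \<xi> x) \<in> L2 M"
  using L2_add[OF _ L2_smult[of \<xi> M "-1"], of \<eta>] by simp

lemma L2norm_nonneg [simp]: "0 \<le> L2norm M \<eta>"
  by (simp add: L2norm_def)

lemma L2norm_sq: "(L2norm M \<eta>)\<^sup>2 = (\<integral>x. (cmod (\<eta> x))\<^sup>2 \<partial>M)"
  by (simp add: L2norm_def)

lemma L2norm_smult: "L2norm M (\<lambda>x. c * \<eta> x) = cmod c * L2norm M \<eta>"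
  by (simp add: L2norm_def norm_mult power_mult_distrib real_sqrt_mult)

lemma L2norm_cong_AE:
  assumes "\<eta> \<in> L2 M" "\<xi> \<in> L2 M" "AE x in M. \<eta> x = \<xi> x"
  shows "L2norm M \<eta> = L2norm M \<xi>"
proof -
  note [measurable] = assms(1,2)[THEN L2_measurable]
  show ?thesis unfolding L2norm_def
    by (rule arg_cong[of _ _ sqrt], rule integral_cong_AE) (use assms(3) in auto)
qed

lemma L2norm_eq_0:
  assumes "\<eta> \<in> L2 M"
  shows "L2norm M \<eta> = 0 \<longleftrightarrow> (AE x in M. \<eta> x = 0)"
  unfolding L2norm_def
  using integral_nonneg_eq_0_iff_AE[OF L2_integrable[OF assms]] by simp

lemma L2norm_triangle:
  assumes "\<eta> \<in> L2 M" "\<xi> \<in> L2 M"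
  shows "L2norm M (\<lambda>x. \<eta> x + \<xi> x) \<le> L2norm M \<eta> + L2norm M \<xi>"
proof -
  let ?a = "L2norm M \<eta>" and ?b = "L2norm M \<xi>"
  have step: "(L2norm M (\<lambda>x. \<eta> x + \<xi> x))\<^sup>2 \<le> (1 + s) * ?a\<^sup>2 + (1 + 1 / s) * ?b\<^sup>2" if "s > 0" for s
  proof -
    have "(\<integral>x. (cmod (\<eta> x + \<xi> x))\<^sup>2 \<partial>M) \<le> (\<integral>x. (1 + s) * (cmod (\<eta> x))\<^sup>2 + (1 + 1 / s) * (cmod (\<xi> x))\<^sup>2 \<partial>M)"
      by (rule integral_mono) (use assms L2_add[OF assms] norm_add_sq_le[OF that] in \<open>auto dest!: L2_integrable\<close>)
    then show ?thesis using assms by (simp add: L2norm_sq L2_integrable)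
  qed
  have alg: "(1 + v / u) * u\<^sup>2 + (1 + u / v) * v\<^sup>2 = (u + v)\<^sup>2" if "u > 0" "v > 0" for u v :: real
    using that by (simp add: power2_eq_square field_simps)
  \<comment> \<open>The optimal weight is the quotient of the two norms. Either norm may be zero, so
    both are first enlarged by d.\<close>
  have *: "L2norm M (\<lambda>x. \<eta> x + \<xi> x) \<le> ?a + ?b + 2 * d" if d: "d > 0" for d
  proof -
    have pos: "?a + d > 0" "?b + d > 0" using d by (simp_all add: add_nonneg_pos)
    have "(L2norm M (\<lambda>x. \<eta> x + \<xi> x))\<^sup>2 \<le> (1 + (?b + d) / (?a + d)) * ?a\<^sup>2 + (1 + (?a + d) / (?b + d)) * ?b\<^sup>2"
      using step[of "(?b + d) / (?a + d)"] pos by simp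
    also have "\<dots> \<le> (1 + (?b + d) / (?a + d)) * (?a + d)\<^sup>2 + (1 + (?a + d) / (?b + d)) * (?b + d)\<^sup>2"
      using d pos by (intro add_mono mult_left_mono power_mono) (auto intro!: add_nonneg_nonneg divide_nonneg_pos simp: less_imp_le)
    also have "\<dots> = (?a + ?b + 2 * d)\<^sup>2"
      using alg[OF pos] by (simp add: algebra_simps)
    finally show ?thesis by (rule power2_le_imp_le) (use d in auto)
  qed
  have "L2norm M (\<lambda>x. \<eta> x + \<xi> x) \<le> ?a + ?b + e" if "e > 0" for e
    using *[of "e / 2"] that by simp
  then show ?thesis by (rule field_le_epsilon)
qed

section \<open>Bounded operators: action on a.e. classes, operator norm, sums and products\<close>

lemma bop_L2: "bop M A \<Longrightarrow> \<eta> \<in> L2 M \<Longrightarrow> A \<eta> \<in> L2 M"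
  by (simp add: bop_def)

lemma bop_add_AE: "bop M A \<Longrightarrow> \<eta> \<in> L2 M \<Longrightarrow> \<xi> \<in> L2 M \<Longrightarrow> AE x in M. A (\<lambda>y. \<eta> y + \<xi> y) x = A \<eta> x + A \<xi> x"
  by (simp add: bop_def)

lemma bop_smult_AE: "bop M A \<Longrightarrow> \<eta> \<in> L2 M \<Longrightarrow> AE x in M. A (\<lambda>y. c * \<eta> y) x = c * A \<eta> x"
  by (simp add: bop_def)

lemma bop_zero_norm:
  assumes "bop M A" "\<eta> \<in> L2 M" "L2norm M \<eta> = 0"
  shows "L2norm M (A \<eta>) = 0"
proof -
  obtain C where "L2norm M (A \<eta>) \<le> C * L2norm M \<eta>"
    using assms(1,2) unfolding bop_def by blast
  then show ?thesis using assms(3) L2norm_nonneg[of M "A \<eta>"] by simp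
qed

text \<open>Operators act on representatives. Two representatives of one class differ by a function
  of norm 0, which a bounded operator sends to a function of norm 0, so the action descends to
  classes.\<close>

lemma bop_cong_AE:
  assumes A: "bop M A" and \<eta>: "\<eta> \<in> L2 M" "\<xi> \<in> L2 M" and eq: "AE x in M. \<eta> x = \<xi> x"
  shows "AE x in M. A \<eta> x = A \<xi> x"
proof -
  let ?d = "\<lambda>x. \<eta> x - \<xi> x"
  have d: "?d \<in> L2 M" using \<eta> by (rule L2_diff)
  have "L2norm M ?d = 0" using eq by (subst L2norm_eq_0[OF d]) auto
  then have "AE x in M. A ?d x = 0"
    using bop_zero_norm[OF A d] L2norm_eq_0[OF bop_L2[OF A d]] by simp
  moreover have "AE x in M. A \<eta> x = A \<xi> x + A ?d x"
    using bop_add_AE[OF A \<eta>(2) d] by simp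
  ultimately show ?thesis by eventually_elim simp
qed

lemma bop_bdd_above:
  assumes "bop M A"
  shows "bdd_above {L2norm M (A \<eta>) | \<eta>. \<eta> \<in> L2 M \<and> L2norm M \<eta> \<le> 1}"
proof -
  obtain C where C: "\<And>\<eta>. \<eta> \<in> L2 M \<Longrightarrow> L2norm M (A \<eta>) \<le> C * L2norm M \<eta>"
    using assms unfolding bop_def by blast
  have "L2norm M (A \<eta>) \<le> \<bar>C\<bar>" if "\<eta> \<in> L2 M" "L2norm M \<eta> \<le> 1" for \<eta>
  proof -
    have "C * L2norm M \<eta> \<le> \<bar>C\<bar> * 1" using that by (intro mult_mono) auto
    then show ?thesis using C[OF that(1)] by simp
  qed
  then show ?thesis by (intro bdd_aboveI) auto
qed

lemma opnorm_upper: "bop M A \<Longrightarrow> \<eta> \<in> L2 M \<Longrightarrow> L2norm M \<eta> \<le> 1 \<Longrightarrow> L2norm M (A \<eta>) \<le> opnorm M A"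
  unfolding opnorm_def by (rule cSup_upper[OF _ bop_bdd_above]) auto

lemma opnorm_nonneg: "bop M A \<Longrightarrow> 0 \<le> opnorm M A"
  by (rule order_trans[OF L2norm_nonneg opnorm_upper[of M A "\<lambda>x. 0"]]) simp_all

lemma L2norm_le_opnorm:
  assumes A: "bop M A" and \<eta>: "\<eta> \<in> L2 M"
  shows "L2norm M (A \<eta>) \<le> opnorm M A * L2norm M \<eta>"
proof (cases "L2norm M \<eta> = 0")
  case True
  then show ?thesis using bop_zero_norm[OF A \<eta>] by simp
next
  case False
  define c where "c = complex_of_real (1 / L2norm M \<eta>)"
  have pos: "L2norm M \<eta> > 0" using False L2norm_nonneg[of M \<eta>] by linarith
  then have c: "cmod c = 1 / L2norm M \<eta>" unfolding c_def norm_of_real by simp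
  have "L2norm M (A (\<lambda>y. c * \<eta> y)) \<le> opnorm M A"
    by (rule opnorm_upper[OF A L2_smult[OF \<eta>]]) (use pos c in \<open>simp add: L2norm_smult\<close>)
  moreover have "L2norm M (A (\<lambda>y. c * \<eta> y)) = L2norm M (\<lambda>x. c * A \<eta> x)"
    by (rule L2norm_cong_AE[OF bop_L2[OF A L2_smult[OF \<eta>]] L2_smult[OF bop_L2[OF A \<eta>]] bop_smult_AE[OF A \<eta>]])
  ultimately show ?thesis using pos c by (simp add: L2norm_smult field_simps)
qed

lemma opnorm_le:
  assumes "C \<ge> 0" "\<And>\<eta>. \<eta> \<in> L2 M \<Longrightarrow> L2norm M (A \<eta>) \<le> C * L2norm M \<eta>"
  shows "opnorm M A \<le> C"
  unfolding opnorm_def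
proof (rule cSup_least)
  show "{L2norm M (A \<eta>) | \<eta>. \<eta> \<in> L2 M \<and> L2norm M \<eta> \<le> 1} \<noteq> {}"
    by (auto intro!: exI[of _ "\<lambda>x. 0"])
  fix r assume "r \<in> {L2norm M (A \<eta>) | \<eta>. \<eta> \<in> L2 M \<and> L2norm M \<eta> \<le> 1}"
  then obtain \<eta> where "r = L2norm M (A \<eta>)" "\<eta> \<in> L2 M" "L2norm M \<eta> \<le> 1" by blast
  then show "r \<le> C"
    using assms(2)[of \<eta>] mult_left_mono[of "L2norm M \<eta>" 1 C] assms(1) by simp
qed

lemma op_diff_eq: "A -\<^sub>o B = A +\<^sub>o ((-1) *\<^sub>o B)"
  by (simp add: op_diff_def op_add_def op_smult_def)

lemma bop_add:
  assumes A: "bop M A" and B: "bop M B"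
  shows "bop M (A +\<^sub>o B)" and "opnorm M (A +\<^sub>o B) \<le> opnorm M A + opnorm M B"
proof -
  have bound: "L2norm M ((A +\<^sub>o B) \<eta>) \<le> (opnorm M A + opnorm M B) * L2norm M \<eta>" if "\<eta> \<in> L2 M" for \<eta>
    using L2norm_triangle[OF bop_L2[OF A that] bop_L2[OF B that]]
      L2norm_le_opnorm[OF A that] L2norm_le_opnorm[OF B that]
    by (simp add: op_add_def distrib_right)
  show "bop M (A +\<^sub>o B)"
    unfolding bop_def
  proof (intro conjI ballI allI)
    show "(A +\<^sub>o B) \<eta> \<in> L2 M" if "\<eta> \<in> L2 M" for \<eta>
      unfolding op_add_def by (rule L2_add[OF bop_L2[OF A that] bop_L2[OF B that]])
    show "AE x in M. (A +\<^sub>o B) (\<lambda>y. \<eta> y + \<xi> y) x = (A +\<^sub>o B) \<eta> x + (A +\<^sub>o B) \<xi> x"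
      if "\<eta> \<in> L2 M" "\<xi> \<in> L2 M" for \<eta> \<xi>
      using bop_add_AE[OF A that] bop_add_AE[OF B that] by eventually_elim (simp add: op_add_def)
    show "AE x in M. (A +\<^sub>o B) (\<lambda>y. c * \<eta> y) x = c * (A +\<^sub>o B) \<eta> x" if "\<eta> \<in> L2 M" for \<eta> c
      using bop_smult_AE[OF A that, of c] bop_smult_AE[OF B that, of c]
      by eventually_elim (simp add: op_add_def distrib_left)
  qed (rule exI, rule ballI, rule bound)
  show "opnorm M (A +\<^sub>o B) \<le> opnorm M A + opnorm M B"
    by (rule opnorm_le[OF add_nonneg_nonneg[OF opnorm_nonneg[OF A] opnorm_nonneg[OF B]] bound])
qed

lemma bop_smult:
  assumes A: "bop M A"
  shows "bop M (c *\<^sub>o A)" and "opnorm M (c *\<^sub>o A) \<le> cmod c * opnorm M A"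
proof -
  have bound: "L2norm M ((c *\<^sub>o A) \<eta>) \<le> (cmod c * opnorm M A) * L2norm M \<eta>" if "\<eta> \<in> L2 M" for \<eta>
    using mult_left_mono[OF L2norm_le_opnorm[OF A that], of "cmod c"]
    by (simp add: op_smult_def L2norm_smult mult.assoc)
  show "bop M (c *\<^sub>o A)"
    unfolding bop_def
  proof (intro conjI ballI allI)
    show "(c *\<^sub>o A) \<eta> \<in> L2 M" if "\<eta> \<in> L2 M" for \<eta>
      unfolding op_smult_def by (rule L2_smult[OF bop_L2[OF A that]])
    show "AE x in M. (c *\<^sub>o A) (\<lambda>y. \<eta> y + \<xi> y) x = (c *\<^sub>o A) \<eta> x + (c *\<^sub>o A) \<xi> x"
      if "\<eta> \<in> L2 M" "\<xi> \<in> L2 M" for \<eta> \<xi>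
      using bop_add_AE[OF A that] by eventually_elim (simp add: op_smult_def distrib_left)
    show "AE x in M. (c *\<^sub>o A) (\<lambda>y. d * \<eta> y) x = d * (c *\<^sub>o A) \<eta> x" if "\<eta> \<in> L2 M" for \<eta> d
      using bop_smult_AE[OF A that, of d] by eventually_elim (simp add: op_smult_def)
  qed (rule exI, rule ballI, rule bound)
  show "opnorm M (c *\<^sub>o A) \<le> cmod c * opnorm M A"
    by (rule opnorm_le[OF mult_nonneg_nonneg[OF norm_ge_zero opnorm_nonneg[OF A]] bound])
qed

lemma bop_diff:
  assumes A: "bop M A" and B: "bop M B"
  shows "bop M (A -\<^sub>o B)" and "opnorm M (A -\<^sub>o B) \<le> opnorm M A + opnorm M B"
  using bop_add[OF A bop_smult(1)[OF B, of "-1"]] bop_smult(2)[OF B, of "-1"]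
  unfolding op_diff_eq by simp_all

lemma bop_comp:
  assumes A: "bop M A" and B: "bop M B"
  shows "bop M (A \<circ> B)" and "opnorm M (A \<circ> B) \<le> opnorm M A * opnorm M B"
proof -
  have bound: "L2norm M ((A \<circ> B) \<eta>) \<le> (opnorm M A * opnorm M B) * L2norm M \<eta>" if "\<eta> \<in> L2 M" for \<eta>
    using order_trans[OF L2norm_le_opnorm[OF A bop_L2[OF B that]]
        mult_left_mono[OF L2norm_le_opnorm[OF B that] opnorm_nonneg[OF A]]]
    by (simp add: mult.assoc)
  show "bop M (A \<circ> B)"
    unfolding bop_def
  proof (intro conjI ballI allI)
    show "(A \<circ> B) \<eta> \<in> L2 M" if "\<eta> \<in> L2 M" for \<eta>
      using bop_L2[OF A bop_L2[OF B that]] by simp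
    show "AE x in M. (A \<circ> B) (\<lambda>y. \<eta> y + \<xi> y) x = (A \<circ> B) \<eta> x + (A \<circ> B) \<xi> x"
      if "\<eta> \<in> L2 M" "\<xi> \<in> L2 M" for \<eta> \<xi>
    proof -
      have "AE x in M. A (B (\<lambda>y. \<eta> y + \<xi> y)) x = A (\<lambda>y. B \<eta> y + B \<xi> y) x"
        by (rule bop_cong_AE[OF A bop_L2[OF B L2_add[OF that]] L2_add[OF that[THEN bop_L2[OF B]]] bop_add_AE[OF B that]])
      moreover have "AE x in M. A (\<lambda>y. B \<eta> y + B \<xi> y) x = A (B \<eta>) x + A (B \<xi>) x"
        by (rule bop_add_AE[OF A that[THEN bop_L2[OF B]]])
      ultimately show ?thesis by eventually_elim simp
    qed
    show "AE x in M. (A \<circ> B) (\<lambda>y. c * \<eta> y) x = c * (A \<circ> B) \<eta> x" if "\<eta> \<in> L2 M" for \<eta> c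
    proof -
      have "AE x in M. A (B (\<lambda>y. c * \<eta> y)) x = A (\<lambda>y. c * B \<eta> y) x"
        by (rule bop_cong_AE[OF A bop_L2[OF B L2_smult[OF that]] L2_smult[OF bop_L2[OF B that]] bop_smult_AE[OF B that]])
      moreover have "AE x in M. A (\<lambda>y. c * B \<eta> y) x = c * A (B \<eta>) x"
        by (rule bop_smult_AE[OF A bop_L2[OF B that]])
      ultimately show ?thesis by eventually_elim simp
    qed
  qed (rule exI, rule ballI, rule bound)
  show "opnorm M (A \<circ> B) \<le> opnorm M A * opnorm M B"
    by (rule opnorm_le[OF mult_nonneg_nonneg[OF opnorm_nonneg[OF A] opnorm_nonneg[OF B]] bound])
qed

lemma opnorm_cong:
  assumes "bop M A" "bop M B" "opeq M A B"
  shows "opnorm M A = opnorm M B"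
proof -
  have "L2norm M (A \<eta>) = L2norm M (B \<eta>)" if "\<eta> \<in> L2 M" for \<eta>
    using assms(3) that unfolding opeq_def
    by (intro L2norm_cong_AE bop_L2[OF assms(1)] bop_L2[OF assms(2)]) auto
  then show ?thesis unfolding opnorm_def
    by (intro arg_cong[of _ _ Sup] Collect_cong ex_cong1) auto
qed

lemma opnorm_diff_eq_0:
  assumes "bop M A" "bop M B" "opeq M A B"
  shows "opnorm M (A -\<^sub>o B) = 0"
proof (rule antisym)
  show "0 \<le> opnorm M (A -\<^sub>o B)" using assms by (intro opnorm_nonneg bop_diff)
  show "opnorm M (A -\<^sub>o B) \<le> 0"
  proof (rule opnorm_le)
    fix \<eta> assume \<eta>: "\<eta> \<in> L2 M"
    have "AE x in M. (A -\<^sub>o B) \<eta> x = 0"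
      using assms(3) \<eta> by (auto simp: opeq_def op_diff_def)
    then show "L2norm M ((A -\<^sub>o B) \<eta>) \<le> 0 * L2norm M \<eta>"
      using L2norm_eq_0[OF bop_L2[OF bop_diff(1)[OF assms(1,2)] \<eta>]] by simp
  qed simp
qed

lemma opeq_refl [simp]: "opeq M A A"
  by (simp add: opeq_def)

lemma opeq_sym: "opeq M A B \<Longrightarrow> opeq M B A"
  by (auto simp: opeq_def eq_commute)

lemma opeq_trans:
  assumes "opeq M A B" "opeq M B C"
  shows "opeq M A C"
  unfolding opeq_def
proof
  fix \<eta> assume \<eta>: "\<eta> \<in> L2 M"
  show "AE x in M. A \<eta> x = C \<eta> x"
    using assms(1)[unfolded opeq_def, rule_format, OF \<eta>] assms(2)[unfolded opeq_def, rule_format, OF \<eta>]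
    by eventually_elim simp
qed

lemma opeq_add:
  assumes "opeq M A A'" "opeq M B B'"
  shows "opeq M (A +\<^sub>o B) (A' +\<^sub>o B')"
  unfolding opeq_def
proof
  fix \<eta> assume \<eta>: "\<eta> \<in> L2 M"
  show "AE x in M. (A +\<^sub>o B) \<eta> x = (A' +\<^sub>o B') \<eta> x"
    using assms(1)[unfolded opeq_def, rule_format, OF \<eta>] assms(2)[unfolded opeq_def, rule_format, OF \<eta>]
    by eventually_elim (simp add: op_add_def)
qed

lemma opeq_smult: "opeq M A A' \<Longrightarrow> opeq M (c *\<^sub>o A) (c *\<^sub>o A')"
  by (auto simp: opeq_def op_smult_def)

lemma opeq_diff: "opeq M A A' \<Longrightarrow> opeq M B B' \<Longrightarrow> opeq M (A -\<^sub>o B) (A' -\<^sub>o B')"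
  unfolding op_diff_eq by (intro opeq_add opeq_smult)

text \<open>Distributing the left factor A uses the linearity of A, which is only almost sure; on
  the other side, \<open>comp_diff_left\<close> is an identity of functions.\<close>

lemma opeq_comp_diff_right:
  assumes "bop M A" "bop M B" "bop M C"
  shows "opeq M ((A \<circ> B) -\<^sub>o (A \<circ> C)) (A \<circ> (B -\<^sub>o C))"
  unfolding opeq_def
proof
  fix \<eta> assume \<eta>: "\<eta> \<in> L2 M"
  have "AE x in M. A (\<lambda>y. B \<eta> y + (-1) * C \<eta> y) x = A (B \<eta>) x + A (\<lambda>y. (-1) * C \<eta> y) x"
    by (rule bop_add_AE[OF assms(1) bop_L2[OF assms(2) \<eta>] L2_smult[OF bop_L2[OF assms(3) \<eta>]]])
  moreover have "AE x in M. A (\<lambda>y. (-1) * C \<eta> y) x = (-1) * A (C \<eta>) x"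
    by (rule bop_smult_AE[OF assms(1) bop_L2[OF assms(3) \<eta>]])
  ultimately show "AE x in M. ((A \<circ> B) -\<^sub>o (A \<circ> C)) \<eta> x = (A \<circ> (B -\<^sub>o C)) \<eta> x"
    by eventually_elim (simp add: op_diff_def)
qed

lemma comp_diff_left: "(A -\<^sub>o B) \<circ> C = (A \<circ> C) -\<^sub>o (B \<circ> C)"
  by (simp add: op_diff_def fun_eq_iff)

lemma opnorm_comp_diff_right:
  assumes "bop M A" "bop M B" "bop M C"
  shows "opnorm M ((A \<circ> B) -\<^sub>o (A \<circ> C)) \<le> opnorm M A * opnorm M (B -\<^sub>o C)"
  using opnorm_cong[OF _ _ opeq_comp_diff_right[OF assms]]
    bop_comp[OF assms(1) bop_diff(1)[OF assms(2,3)]] assms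
  by (simp add: bop_diff bop_comp)

lemma opnorm_comp_diff_left:
  assumes "bop M A" "bop M B" "bop M C"
  shows "opnorm M ((A \<circ> C) -\<^sub>o (B \<circ> C)) \<le> opnorm M (A -\<^sub>o B) * opnorm M C"
  using bop_comp(2)[OF bop_diff(1)[OF assms(1,2)] assms(3)] by (simp add: comp_diff_left)

lemma op_diff_diff: "(A -\<^sub>o B) +\<^sub>o (B -\<^sub>o C) = A -\<^sub>o C"
  by (simp add: op_diff_def op_add_def)

lemma opnorm_diff_triangle:
  assumes "bop M A" "bop M B" "bop M C"
  shows "opnorm M (A -\<^sub>o C) \<le> opnorm M (A -\<^sub>o B) + opnorm M (B -\<^sub>o C)"
  using bop_add(2)[OF bop_diff(1)[OF assms(1,2)] bop_diff(1)[OF assms(2,3)]]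
  by (simp add: op_diff_diff)

section \<open>The shift space and the Ruelle operator\<close>

lemma continuous_on_coordinate: "continuous_on S (\<lambda>x::pt. x n)"
  by (rule continuous_on_subset[OF continuous_on_product_coordinates subset_UNIV])

text \<open>The hypothesis speaks of \<open>dshift\<close>, the conclusion of the product topology.
  They meet because agreeing with x in the first N coordinates is a neighbourhood condition and
  forces \<open>dshift x y\<close> to be at most (1/2)^N.\<close>

lemma holder_on_imp_continuous_on:
  assumes "holder_on A f"
  shows "continuous_on A f"
  unfolding continuous_on
proof (intro ballI tendstoI)
  fix x and e :: real assume x: "x \<in> A" and e: "e > 0"
  obtain C \<alpha> where \<alpha>: "\<alpha> > 0" and C: "\<And>y. y \<in> A \<Longrightarrow> \<bar>f x - f y\<bar> \<le> C * dshift x y powr \<alpha>"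
    using assms x unfolding holder_on_def by blast
  have "(\<lambda>n. \<bar>C\<bar> * ((1/2) ^ n) powr \<alpha>) \<longlonglongrightarrow> 0"
    using \<alpha> by real_asymp
  then have "\<forall>\<^sub>F n in sequentially. \<bar>C\<bar> * ((1/2) ^ n) powr \<alpha> < e"
    using e by (rule order_tendstoD)
  then obtain N where N: "\<bar>C\<bar> * ((1/2) ^ N) powr \<alpha> < e"
    by (auto simp: eventually_sequentially)
  have coord: "\<forall>\<^sub>F y in at x within A. y n = x n" for n
  proof -
    have "((\<lambda>y::pt. y n) \<longlongrightarrow> x n) (at x within A)"
      using continuous_on_coordinate[of A n] x by (simp add: continuous_on)
    then have "\<forall>\<^sub>F y in at x within A. y n \<in> {x n}"
      by (rule topological_tendstoD) (simp_all add: discrete_topology_class.open_discrete)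
    then show ?thesis by simp
  qed
  have "\<forall>\<^sub>F y in at x within A. \<forall>n\<in>{..<N}. y n = x n"
    by (rule eventually_ball_finite) (use coord in auto)
  moreover have "\<forall>\<^sub>F y in at x within A. y \<in> A"
    by (simp add: eventually_at_filter)
  ultimately show "\<forall>\<^sub>F y in at x within A. dist (f y) (f x) < e"
  proof eventually_elim
    case (elim y)
    have "dshift x y \<le> (1/2) ^ N"
    proof (cases "x = y")
      case False
      then have "\<exists>n. x n \<noteq> y n" by auto
      then have "x (LEAST n. x n \<noteq> y n) \<noteq> y (LEAST n. x n \<noteq> y n)" by (rule LeastI_ex)
      then have "N \<le> (LEAST n. x n \<noteq> y n)" using elim(1) by (metis lessThan_iff linorder_not_le)
      then show ?thesis using False by (simp add: dshift_def power_decreasing)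
    qed (simp add: dshift_def)
    moreover have "0 \<le> dshift x y" by (simp add: dshift_def)
    ultimately have "dshift x y powr \<alpha> \<le> ((1/2) ^ N) powr \<alpha>" using \<alpha> by (intro powr_mono2) auto
    then have "C * dshift x y powr \<alpha> \<le> \<bar>C\<bar> * ((1/2) ^ N) powr \<alpha>" by (intro mult_mono) auto
    then show ?case using C[OF elim(2)] N by (simp add: dist_real_def abs_minus_commute)
  qed
qed

section \<open>The shift space: compactness and continuity of the shift and its inverse
  branches\<close>

lemma compact_Xk: "compact (Xk k)"
proof -
  have "Xk k = (\<Pi>\<^sub>E i\<in>UNIV. {1..k})" by (auto simp: Xk_def)
  moreover have "compactin (product_topology (\<lambda>_. euclidean) UNIV) (\<Pi>\<^sub>E i\<in>(UNIV::nat set). {1..k})"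
    by (subst compactin_PiE) (auto simp: finite_imp_compact)
  ultimately show ?thesis by (simp add: euclidean_product_topology)
qed

lemma case_nat_in_Xk: "a \<in> {1..k} \<Longrightarrow> x \<in> Xk k \<Longrightarrow> case_nat a x \<in> Xk k"
  by (auto simp: Xk_def split: nat.split)

lemma shift_in_Xk: "x \<in> Xk k \<Longrightarrow> shift x \<in> Xk k"
  by (auto simp: Xk_def shift_def)

lemma shift_pow_in_Xk: "x \<in> Xk k \<Longrightarrow> (shift ^^ n) x \<in> Xk k"
  by (induction n) (auto intro: shift_in_Xk)

lemma shift_case_nat [simp]: "shift (case_nat a x) = x"
  by (simp add: shift_def)

lemma continuous_on_shift: "continuous_on S shift"
  unfolding shift_def
  by (intro continuous_on_coordinatewise_then_product continuous_on_coordinate)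

lemma continuous_on_shift_pow: "continuous_on S (shift ^^ n)"
proof (induction n)
  case (Suc n)
  then show ?case
    using continuous_on_compose[OF Suc.IH continuous_on_shift] by simp
qed (simp add: id_def)

lemma continuous_on_case_nat: "continuous_on S (\<lambda>x::pt. case_nat a x)"
proof (rule continuous_on_coordinatewise_then_product)
  fix i show "continuous_on S (\<lambda>x::pt. case i of 0 \<Rightarrow> a | Suc n \<Rightarrow> x n)"
    by (cases i) (auto intro!: continuous_intros continuous_on_coordinate)
qed

lemma continuous_on_compose_shift_pow:
  "continuous_on (Xk k) f \<Longrightarrow> continuous_on (Xk k) (\<lambda>x. f ((shift ^^ n) x))"
  by (rule continuous_on_compose2[OF _ continuous_on_shift_pow]) (auto intro: shift_pow_in_Xk)

lemma continuous_on_compose_case_nat: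
  "a \<in> {1..k} \<Longrightarrow> continuous_on (Xk k) f \<Longrightarrow> continuous_on (Xk k) (\<lambda>x. f (case_nat a x))"
  by (rule continuous_on_compose2[OF _ continuous_on_case_nat]) (auto intro: case_nat_in_Xk)

lemma continuous_on_Xk_bounded:
  fixes f :: "pt \<Rightarrow> 'a::real_normed_vector"
  assumes "continuous_on (Xk k) f"
  obtains c where "c \<ge> 0" "\<And>x. x \<in> Xk k \<Longrightarrow> norm (f x) \<le> c"
proof -
  have "bounded (f ` Xk k)"
    by (intro compact_imp_bounded compact_continuous_image assms compact_Xk)
  then obtain c where "\<And>x. x \<in> Xk k \<Longrightarrow> norm (f x) \<le> c" by (auto simp: bounded_iff)
  then show ?thesis by (intro that[of "max c 0"]) (auto intro: max.coboundedI1)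
qed

section \<open>Clopen sets determine finite Borel measures\<close>

lemma continuous_on_indicator_clopen:
  assumes "open A" "closed A"
  shows "continuous_on S (\<lambda>x. complex_of_real (indicator A x))"
proof -
  have "continuous_on (A \<union> - A) (\<lambda>x. if x \<in> A then 1 else 0 :: complex)"
    by (rule continuous_on_If) (use assms in \<open>auto simp: closed_Compl\<close>)
  then have "continuous_on UNIV (\<lambda>x. if x \<in> A then 1 else 0 :: complex)" by simp
  moreover have "(\<lambda>x. if x \<in> A then 1 else 0 :: complex) = (\<lambda>x. complex_of_real (indicator A x))"
    by (auto simp: indicator_def)
  ultimately have "continuous_on UNIV (\<lambda>x. complex_of_real (indicator A x))"
    by (simp only:)
  then show ?thesis by (rule continuous_on_subset) simp
qed

text \<open>Each coordinate takes values in a discrete space, so the sets fixed by a condition on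
  one coordinate are clopen, and they already generate the product sigma-algebra.\<close>

lemma sets_borel_pt: "sets (borel :: pt measure) = sigma_sets UNIV {A. open A \<and> closed A}"
proof
  have op: "open {f :: pt. f i \<in> A}" for i A
    using open_vimage[OF discrete_topology_class.open_discrete[of A] continuous_on_coordinate[of UNIV i]]
    unfolding vimage_def .
  have clopen: "open {f :: pt. f i \<in> A} \<and> closed {f :: pt. f i \<in> A}" for i A
  proof
    have "- {f :: pt. f i \<in> A} = {f. f i \<in> - A}" by auto
    then show "closed {f :: pt. f i \<in> A}" unfolding closed_def using op[of i "- A"] by simp
  qed (rule op)
  have "sets (borel :: pt measure) = sets (Pi\<^sub>M UNIV (\<lambda>i. borel))"
    by (simp add: sets_PiM_equal_borel)
  also have "\<dots> = sigma_sets UNIV {{f. f i \<in> A} |i A. A \<in> sets borel}"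
    by (simp add: sets_PiM_single)
  also have "\<dots> \<subseteq> sigma_sets UNIV {A. open A \<and> closed A}"
    by (rule sigma_sets_mono') (auto simp: clopen)
  finally show "sets (borel :: pt measure) \<subseteq> sigma_sets UNIV {A. open A \<and> closed A}" .
  show "sigma_sets UNIV {A. open A \<and> closed A} \<subseteq> sets (borel :: pt measure)"
    using sets.sigma_sets_subset[of "{A. open A \<and> closed A}" "borel :: pt measure"]
    by (auto simp: subset_eq)
qed

text \<open>Clopen sets are stable under intersection and have continuous indicators. Hence measures
  known only through integrals of continuous functions can be compared here without approximating
  indicators.\<close>

lemma measure_eqI_clopen:
  assumes M: "sets M = sets (restrict_space borel (Xk k))" and N: "sets N = sets M"
    and "finite_measure M"
    and eq: "\<And>A. open A \<Longrightarrow> closed A \<Longrightarrow> emeasure M (A \<inter> Xk k) = emeasure N (A \<inter> Xk k)"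
  shows "M = N"
proof -
  interpret finite_measure M by fact
  have space: "space M = Xk k" "space N = Xk k"
    using sets_eq_imp_space_eq[OF M] sets_eq_imp_space_eq[OF N]
    by (simp_all add: space_restrict_space)
  have id: "(\<lambda>x. x) \<in> measurable M borel" "(\<lambda>x. x) \<in> measurable N borel"
    unfolding measurable_cong_sets[OF M refl] measurable_cong_sets[OF trans[OF N M] refl]
    by - (rule measurable_restrict_space1, simp)+
  \<comment> \<open>The generating clopen sets live in the whole sequence space, so both measures
    are pushed forward from \<open>Xk k\<close> before the uniqueness theorem is applied.\<close>
  have "distr M borel (\<lambda>x. x) = distr N borel (\<lambda>x. x)"
  proof (rule measure_eqI_generator_eq[where E = "{A. open A \<and> closed A}" and \<Omega> = UNIV and A = "\<lambda>_. UNIV"])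
    show "Int_stable {A::pt set. open A \<and> closed A}" by (auto simp: Int_stable_def)
    show "emeasure (distr M borel (\<lambda>x. x)) X = emeasure (distr N borel (\<lambda>x. x)) X"
      if "X \<in> {A. open A \<and> closed A}" for X
      using that eq[of X] id by (simp add: emeasure_distr space)
    show "emeasure (distr M borel (\<lambda>x. x)) UNIV \<noteq> \<infinity>"
      using id by (simp add: emeasure_distr)
  qed (simp_all add: sets_borel_pt)
  then have *: "emeasure M (B \<inter> Xk k) = emeasure N (B \<inter> Xk k)" if "B \<in> sets borel" for B
    using emeasure_distr[OF id(1) that] emeasure_distr[OF id(2) that] by (simp add: space)
  show ?thesis
  proof (rule measure_eqI)
    show "sets M = sets N" using N by simp
    fix A assume "A \<in> sets M"
    then obtain B where "B \<in> sets borel" "A = B \<inter> Xk k"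
      unfolding M sets_restrict_space by blast
    then show "emeasure M A = emeasure N A" using * by simp
  qed
qed

text \<open>Hypotheses control functions only on \<open>Xk k\<close>; their values elsewhere never
  enter, since prefixing an admissible letter stays inside \<open>Xk k\<close>.\<close>

lemma Lp_cong:
  assumes "\<And>x. x \<in> Xk k \<Longrightarrow> f x = g x" "x \<in> Xk k"
  shows "Lp k p f x = Lp k p g x"
  unfolding Lp_def by (intro sum.cong refl) (simp add: assms case_nat_in_Xk)

lemma Lp_pow_cong:
  assumes "\<And>x. x \<in> Xk k \<Longrightarrow> f x = g x" "x \<in> Xk k"
  shows "(Lp k p ^^ n) f x = (Lp k p ^^ n) g x"
  using assms(2) by (induction n arbitrary: x) (auto intro: Lp_cong assms(1))

lemma Sop_pow: "(Sop ^^ n) f = f \<circ> (shift ^^ n)"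
  by (induction n) (auto simp: Sop_def fun_eq_iff funpow_swap1)

lemma continuous_on_Lp:
  assumes "continuous_on (Xk k) p" "continuous_on (Xk k) f"
  shows "continuous_on (Xk k) (Lp k p f)"
  unfolding Lp_def
  by (intro continuous_intros continuous_on_compose_case_nat assms) auto

lemma continuous_on_Lp_pow:
  assumes "continuous_on (Xk k) p" "continuous_on (Xk k) f"
  shows "continuous_on (Xk k) ((Lp k p ^^ n) f)"
  by (induction n) (auto intro: continuous_on_Lp assms)

lemma continuous_on_en:
  assumes "continuous_on (Xk k) p" "continuous_on (Xk k) f"
  shows "continuous_on (Xk k) (en k p n f)"
  unfolding en_def Sop_pow comp_def
  by (intro continuous_on_compose_shift_pow continuous_on_Lp_pow assms)

text \<open>Nonnegative integrals can be compared before integrability is known, so a single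
  inequality delivers both membership in L2 and the norm bound.\<close>

lemma L2_nn_mono:
  assumes f [measurable]: "f \<in> borel_measurable M" and \<eta>: "\<eta> \<in> L2 M"
    and le: "(\<integral>\<^sup>+x. ennreal ((cmod (f x))\<^sup>2) \<partial>M) \<le> (\<integral>\<^sup>+x. ennreal ((cmod (\<eta> x))\<^sup>2) \<partial>M)"
  shows "f \<in> L2 M" "L2norm M f \<le> L2norm M \<eta>"
proof -
  have \<eta>_nn: "(\<integral>\<^sup>+x. ennreal ((cmod (\<eta> x))\<^sup>2) \<partial>M) = ennreal (\<integral>x. (cmod (\<eta> x))\<^sup>2 \<partial>M)"
    by (intro nn_integral_eq_integral L2_integrable \<eta>) simp
  have int: "integrable M (\<lambda>x. (cmod (f x))\<^sup>2)"
    using le \<eta>_nn by (intro integrableI_nonneg) (auto simp: less_top[symmetric] top_unique)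
  then show "f \<in> L2 M" by (simp add: L2_def)
  have "(\<integral>\<^sup>+x. ennreal ((cmod (f x))\<^sup>2) \<partial>M) = ennreal (\<integral>x. (cmod (f x))\<^sup>2 \<partial>M)"
    by (intro nn_integral_eq_integral int) simp
  then show "L2norm M f \<le> L2norm M \<eta>"
    using le \<eta>_nn by (simp add: L2norm_def ennreal_le_iff)
qed

section \<open>Invariance of the Gibbs measure and contractivity on L2\<close>

locale gibbs =
  fixes k :: nat and p :: "pt \<Rightarrow> real" and \<mu> :: "pt measure"
  assumes p_pos: "\<And>x. x \<in> Xk k \<Longrightarrow> p x > 0"
    and p_cont: "continuous_on (Xk k) p"
    and p_norm: "\<And>x. x \<in> Xk k \<Longrightarrow> (\<Sum>a\<in>{1..k}. p (case_nat a x)) = 1"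
    and mu_prob: "prob_space \<mu>"
    and mu_sets: "sets \<mu> = sets (restrict_space borel (Xk k))"
    and mu_inv: "\<And>f. continuous_on (Xk k) f \<Longrightarrow> (\<integral>x. Lp k p f x \<partial>\<mu>) = (\<integral>x. f x \<partial>\<mu>)"
begin

lemma p_case_nat_nonneg: "a \<in> {1..k} \<Longrightarrow> x \<in> Xk k \<Longrightarrow> 0 \<le> p (case_nat a x)"
  using p_pos[OF case_nat_in_Xk] by (simp add: less_imp_le)

sublocale prob_space \<mu> by (rule mu_prob)

lemma space_mu [simp]: "space \<mu> = Xk k"
  using sets_eq_imp_space_eq[OF mu_sets] by (simp add: space_restrict_space)

lemma measurable_mu:
  fixes f :: "pt \<Rightarrow> 'a::topological_space"
  assumes "continuous_on (Xk k) f"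
  shows "f \<in> borel_measurable \<mu>"
  using borel_measurable_continuous_on_restrict[OF assms] measurable_cong_sets[OF mu_sets refl] by blast

lemma measurable_mu_mu:
  fixes f :: "pt \<Rightarrow> pt"
  assumes "continuous_on (Xk k) f" "\<And>x. x \<in> Xk k \<Longrightarrow> f x \<in> Xk k"
  shows "f \<in> measurable \<mu> \<mu>"
proof -
  have "f \<in> measurable \<mu> (restrict_space borel (Xk k))"
    by (intro measurable_restrict_space2 measurable_mu) (use assms in auto)
  then show ?thesis using measurable_cong_sets[OF refl mu_sets] by blast
qed

lemma shift_measurable [measurable]: "shift \<in> measurable \<mu> \<mu>"
  by (intro measurable_mu_mu continuous_on_shift shift_in_Xk)

lemma case_nat_measurable: "a \<in> {1..k} \<Longrightarrow> case_nat a \<in> measurable \<mu> \<mu>"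
  by (intro measurable_mu_mu continuous_on_case_nat case_nat_in_Xk)

lemma p_measurable [measurable]: "p \<in> borel_measurable \<mu>"
  by (intro measurable_mu p_cont)

text \<open>Extends the eigenmeasure property from continuous functions to nonnegative measurable
  ones, which is what the estimates for arbitrary L2 functions require.\<close>

lemma nn_integral_Lp:
  assumes \<phi>: "\<phi> \<in> borel_measurable \<mu>"
  shows "(\<integral>\<^sup>+x. (\<Sum>a\<in>{1..k}. ennreal (p (case_nat a x)) * \<phi> (case_nat a x)) \<partial>\<mu>) = (\<integral>\<^sup>+x. \<phi> x \<partial>\<mu>)"
proof -
  let ?P = "count_space {1..k} \<Otimes>\<^sub>M \<mu>"
  define h where "h = (\<lambda>(a, x). case_nat a x :: pt)"
  \<comment> \<open>This is the dual Ruelle operator applied to mu: weight the pairs (letter, point)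
    by p and push them forward under prefixing. The claim becomes equality of two measures, and on
    clopen sets that equality is the hypothesis \<open>mu_inv\<close>.\<close>
  define \<rho> where "\<rho> = distr (density ?P (\<lambda>z. ennreal (p (h z)))) \<mu> h"
  have h: "h \<in> measurable ?P \<mu>"
    unfolding h_def by (rule measurable_pair_measure_countable1) (auto intro: case_nat_measurable)
  have ph [measurable]: "(\<lambda>z. ennreal (p (h z))) \<in> borel_measurable ?P"
    using measurable_compose[OF h p_measurable] by simp
  have int: "(\<integral>\<^sup>+x. \<phi> x \<partial>\<rho>) = (\<integral>\<^sup>+x. (\<Sum>a\<in>{1..k}. ennreal (p (case_nat a x)) * \<phi> (case_nat a x)) \<partial>\<mu>)"
    if \<phi> [measurable]: "\<phi> \<in> borel_measurable \<mu>" for \<phi>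
  proof -
    have [measurable]: "(\<lambda>z. \<phi> (h z)) \<in> borel_measurable ?P"
      using measurable_compose[OF h \<phi>] by simp
    have m: "(\<lambda>x. ennreal (p (case_nat a x)) * \<phi> (case_nat a x)) \<in> borel_measurable \<mu>"
      if "a \<in> {1..k}" for a
      using measurable_compose[OF case_nat_measurable[OF that] \<phi>]
        measurable_compose[OF case_nat_measurable[OF that] p_measurable] by measurable
    have "(\<integral>\<^sup>+x. \<phi> x \<partial>\<rho>) = (\<integral>\<^sup>+z. ennreal (p (h z)) * \<phi> (h z) \<partial>?P)"
      unfolding \<rho>_def using h by (simp add: nn_integral_distr nn_integral_density)
    also have "\<dots> = (\<integral>\<^sup>+a. \<integral>\<^sup>+x. ennreal (p (h (a, x))) * \<phi> (h (a, x)) \<partial>\<mu> \<partial>count_space {1..k})"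
      by (rule nn_integral_fst[symmetric]) measurable
    also have "\<dots> = (\<Sum>a\<in>{1..k}. \<integral>\<^sup>+x. ennreal (p (case_nat a x)) * \<phi> (case_nat a x) \<partial>\<mu>)"
      by (simp add: nn_integral_count_space_finite h_def)
    also have "\<dots> = (\<integral>\<^sup>+x. (\<Sum>a\<in>{1..k}. ennreal (p (case_nat a x)) * \<phi> (case_nat a x)) \<partial>\<mu>)"
      using m by (intro nn_integral_sum[symmetric])
    finally show ?thesis .
  qed
  have "\<mu> = \<rho>"
  proof (rule measure_eqI_clopen[OF mu_sets])
    fix A :: "pt set" assume A: "open A" "closed A"
    let ?f = "\<lambda>x. complex_of_real (indicator A x)"
    let ?s = "\<lambda>x. \<Sum>a\<in>{1..k}. p (case_nat a x) * indicator A (case_nat a x)"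
    have cont: "continuous_on (Xk k) ?f" by (rule continuous_on_indicator_clopen[OF A])
    have "Lp k p ?f x = of_real (?s x)" for x by (simp only: Lp_def of_real_sum of_real_mult)
    then have eq: "(\<integral>x. ?s x \<partial>\<mu>) = (\<integral>x. indicator A x \<partial>\<mu>)"
      using mu_inv[OF cont] by (simp only: integral_complex_of_real of_real_eq_iff)
    have AX: "A \<inter> Xk k \<in> sets \<mu>"
      using A by (auto simp: mu_sets sets_restrict_space)
    have s_cont: "continuous_on (Xk k) ?s"
    proof -
      have "continuous_on (Xk k) (\<lambda>x. Re (Lp k p ?f x))"
        by (intro continuous_intros continuous_on_Lp p_cont cont)
      then show ?thesis by (simp only: Lp_def of_real_sum[symmetric] of_real_mult[symmetric] Re_complex_of_real)
    qed
    have s_nonneg: "0 \<le> ?s x" if "x \<in> Xk k" for x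
      using that by (intro sum_nonneg mult_nonneg_nonneg p_case_nat_nonneg) auto
    obtain c where c: "\<And>x. x \<in> Xk k \<Longrightarrow> norm (?s x) \<le> c"
      using continuous_on_Xk_bounded[OF s_cont] by metis
    have s_int: "integrable \<mu> ?s"
      by (rule integrable_const_bound[of _ c]) (use c measurable_mu[OF s_cont] in auto)
    have "emeasure \<rho> (A \<inter> Xk k) = (\<integral>\<^sup>+x. indicator (A \<inter> Xk k) x \<partial>\<rho>)"
      using AX by (simp add: \<rho>_def)
    also have "\<dots> = (\<integral>\<^sup>+x. (\<Sum>a\<in>{1..k}. ennreal (p (case_nat a x)) * indicator (A \<inter> Xk k) (case_nat a x)) \<partial>\<mu>)"
      using AX by (intro int) simp
    also have "\<dots> = (\<integral>\<^sup>+x. ennreal (?s x) \<partial>\<mu>)"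
    proof (rule nn_integral_cong)
      fix x assume "x \<in> space \<mu>"
      then have x: "case_nat a x \<in> Xk k" if "a \<in> {1..k}" for a
        using that case_nat_in_Xk by simp
      have pos: "0 \<le> p (case_nat a x)" if "a \<in> {1..k}" for a
        using p_pos[OF x[OF that]] by simp
      have "ennreal (?s x) = (\<Sum>a\<in>{1..k}. ennreal (p (case_nat a x) * indicator A (case_nat a x)))"
        using pos by (intro sum_ennreal[symmetric]) auto
      also have "\<dots> = (\<Sum>a\<in>{1..k}. ennreal (p (case_nat a x)) * indicator (A \<inter> Xk k) (case_nat a x))"
        using x by (intro sum.cong refl) (auto simp: indicator_def)
      finally show "(\<Sum>a\<in>{1..k}. ennreal (p (case_nat a x)) * indicator (A \<inter> Xk k) (case_nat a x)) = ennreal (?s x)" by simp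
    qed
    also have "\<dots> = ennreal (\<integral>x. ?s x \<partial>\<mu>)"
      by (intro nn_integral_eq_integral s_int) (use s_nonneg in auto)
    also have "(\<integral>x. ?s x \<partial>\<mu>) = (\<integral>x. indicator (A \<inter> Xk k) x \<partial>\<mu>)"
      unfolding eq by (intro Bochner_Integration.integral_cong) (auto simp: indicator_def)
    also have "ennreal \<dots> = emeasure \<mu> (A \<inter> Xk k)"
      using AX by (simp add: emeasure_eq_measure)
    finally show "emeasure \<mu> (A \<inter> Xk k) = emeasure \<rho> (A \<inter> Xk k)" by simp
  qed (simp_all add: \<rho>_def finite_measure_axioms)
  with int[OF \<phi>] show ?thesis by simp
qed

text \<open>The weights of the preimages of a point add up to 1, so L_p undoes composition with the
  shift; the invariance under L_p therefore makes mu shift invariant.\<close>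

lemma nn_integral_shift:
  assumes \<phi> [measurable]: "\<phi> \<in> borel_measurable \<mu>"
  shows "(\<integral>\<^sup>+x. \<phi> (shift x) \<partial>\<mu>) = (\<integral>\<^sup>+x. \<phi> x \<partial>\<mu>)"
proof -
  have "(\<integral>\<^sup>+x. \<phi> (shift x) \<partial>\<mu>) =
      (\<integral>\<^sup>+x. (\<Sum>a\<in>{1..k}. ennreal (p (case_nat a x)) * \<phi> (shift (case_nat a x))) \<partial>\<mu>)"
    by (rule nn_integral_Lp[symmetric]) measurable
  also have "\<dots> = (\<integral>\<^sup>+x. \<phi> x \<partial>\<mu>)"
  proof (rule nn_integral_cong)
    fix x assume "x \<in> space \<mu>"
    then have "(\<Sum>a\<in>{1..k}. ennreal (p (case_nat a x))) = 1"
      using p_norm[of x] p_pos case_nat_in_Xk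
      using p_case_nat_nonneg by (subst sum_ennreal) auto
    then show "(\<Sum>a\<in>{1..k}. ennreal (p (case_nat a x)) * \<phi> (shift (case_nat a x))) = \<phi> x"
      by (simp add: sum_distrib_right[symmetric])
  qed
  finally show ?thesis .
qed

lemma Sop_L2:
  assumes \<eta>: "\<eta> \<in> L2 \<mu>"
  shows "Sop \<eta> \<in> L2 \<mu>" "L2norm \<mu> (Sop \<eta>) \<le> L2norm \<mu> \<eta>"
proof -
  note [measurable] = L2_measurable[OF \<eta>]
  have "Sop \<eta> \<in> borel_measurable \<mu>" unfolding Sop_def by measurable
  moreover have "(\<integral>\<^sup>+x. ennreal ((cmod (Sop \<eta> x))\<^sup>2) \<partial>\<mu>) \<le> (\<integral>\<^sup>+x. ennreal ((cmod (\<eta> x))\<^sup>2) \<partial>\<mu>)"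
    using nn_integral_shift[of "\<lambda>x. ennreal ((cmod (\<eta> x))\<^sup>2)"] by (simp add: Sop_def)
  ultimately show "Sop \<eta> \<in> L2 \<mu>" "L2norm \<mu> (Sop \<eta>) \<le> L2norm \<mu> \<eta>"
    by - (rule L2_nn_mono[OF _ \<eta>], assumption+)+
qed

text \<open>Cauchy-Schwarz with each weight p split into two square roots; the spare factor is the
  total weight 1. Integrated against mu, it makes L_p a contraction of L2.\<close>

lemma Lp_jensen:
  assumes x: "x \<in> Xk k"
  shows "(cmod (Lp k p \<eta> x))\<^sup>2 \<le> (\<Sum>a\<in>{1..k}. p (case_nat a x) * (cmod (\<eta> (case_nat a x)))\<^sup>2)"
proof -
  have pos: "0 \<le> p (case_nat a x)" if "a \<in> {1..k}" for a
    using that x p_pos case_nat_in_Xk less_imp_le by blast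
  have "cmod (Lp k p \<eta> x) \<le> (\<Sum>a\<in>{1..k}. p (case_nat a x) * cmod (\<eta> (case_nat a x)))"
    unfolding Lp_def using pos by (intro sum_norm_le) (simp add: norm_mult)
  also have "\<dots> = (\<Sum>a\<in>{1..k}. sqrt (p (case_nat a x)) * (sqrt (p (case_nat a x)) * cmod (\<eta> (case_nat a x))))"
    using pos by (intro sum.cong refl) (simp flip: mult.assoc)
  finally have "(cmod (Lp k p \<eta> x))\<^sup>2 \<le> (\<Sum>a\<in>{1..k}. sqrt (p (case_nat a x)) * (sqrt (p (case_nat a x)) * cmod (\<eta> (case_nat a x))))\<^sup>2"
    by (intro power_mono) auto
  also have "\<dots> \<le> (\<Sum>a\<in>{1..k}. (sqrt (p (case_nat a x)))\<^sup>2) * (\<Sum>a\<in>{1..k}. (sqrt (p (case_nat a x)) * cmod (\<eta> (case_nat a x)))\<^sup>2)"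
    by (rule Cauchy_Schwarz_ineq_sum)
  also have "(\<Sum>a\<in>{1..k}. (sqrt (p (case_nat a x)))\<^sup>2) = (\<Sum>a\<in>{1..k}. p (case_nat a x))"
    using pos by (intro sum.cong refl) simp
  also have "\<dots> = 1" by (rule p_norm[OF x])
  also have "(\<Sum>a\<in>{1..k}. (sqrt (p (case_nat a x)) * cmod (\<eta> (case_nat a x)))\<^sup>2)
      = (\<Sum>a\<in>{1..k}. p (case_nat a x) * (cmod (\<eta> (case_nat a x)))\<^sup>2)"
    using pos by (intro sum.cong refl) (simp add: power_mult_distrib)
  finally show ?thesis by simp
qed

lemma Lp_L2:
  assumes \<eta>: "\<eta> \<in> L2 \<mu>"
  shows "Lp k p \<eta> \<in> L2 \<mu>" "L2norm \<mu> (Lp k p \<eta>) \<le> L2norm \<mu> \<eta>"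
proof -
  note [measurable] = L2_measurable[OF \<eta>]
  have "Lp k p \<eta> \<in> borel_measurable \<mu>"
    unfolding Lp_def
    by (intro borel_measurable_sum borel_measurable_times borel_measurable_of_real)
       (auto intro: measurable_compose[OF case_nat_measurable] p_measurable L2_measurable[OF \<eta>])
  moreover have "(\<integral>\<^sup>+x. ennreal ((cmod (Lp k p \<eta> x))\<^sup>2) \<partial>\<mu>) \<le> (\<integral>\<^sup>+x. ennreal ((cmod (\<eta> x))\<^sup>2) \<partial>\<mu>)"
  proof -
    have "(\<integral>\<^sup>+x. ennreal ((cmod (Lp k p \<eta> x))\<^sup>2) \<partial>\<mu>)
        \<le> (\<integral>\<^sup>+x. (\<Sum>a\<in>{1..k}. ennreal (p (case_nat a x)) * ennreal ((cmod (\<eta> (case_nat a x)))\<^sup>2)) \<partial>\<mu>)"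
    proof (rule nn_integral_mono)
      fix x assume "x \<in> space \<mu>"
      then have x: "x \<in> Xk k" by simp
      have pos: "0 \<le> p (case_nat a x)" if "a \<in> {1..k}" for a
        using that x p_pos case_nat_in_Xk less_imp_le by blast
      have "(\<Sum>a\<in>{1..k}. ennreal (p (case_nat a x)) * ennreal ((cmod (\<eta> (case_nat a x)))\<^sup>2))
          = ennreal (\<Sum>a\<in>{1..k}. p (case_nat a x) * (cmod (\<eta> (case_nat a x)))\<^sup>2)"
        using pos by (subst sum_ennreal[symmetric]) (auto intro!: sum.cong simp: ennreal_mult)
      then show "ennreal ((cmod (Lp k p \<eta> x))\<^sup>2) \<le> (\<Sum>a\<in>{1..k}. ennreal (p (case_nat a x)) * ennreal ((cmod (\<eta> (case_nat a x)))\<^sup>2))"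
        using Lp_jensen[OF x, of \<eta>] by (simp add: ennreal_leI)
    qed
    also have "\<dots> = (\<integral>\<^sup>+x. ennreal ((cmod (\<eta> x))\<^sup>2) \<partial>\<mu>)"
      by (rule nn_integral_Lp) measurable
    finally show ?thesis .
  qed
  ultimately show "Lp k p \<eta> \<in> L2 \<mu>" "L2norm \<mu> (Lp k p \<eta>) \<le> L2norm \<mu> \<eta>"
    by - (rule L2_nn_mono[OF _ \<eta>], assumption+)+
qed

lemma pow_L2:
  assumes "\<And>\<eta>. \<eta> \<in> L2 \<mu> \<Longrightarrow> A \<eta> \<in> L2 \<mu>" "\<And>\<eta>. \<eta> \<in> L2 \<mu> \<Longrightarrow> L2norm \<mu> (A \<eta>) \<le> L2norm \<mu> \<eta>"
    and "\<eta> \<in> L2 \<mu>"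
  shows "(A ^^ n) \<eta> \<in> L2 \<mu> \<and> L2norm \<mu> ((A ^^ n) \<eta>) \<le> L2norm \<mu> \<eta>"
proof (induction n)
  case (Suc n)
  then show ?case
    using assms(1)[of "(A ^^ n) \<eta>"] assms(2)[of "(A ^^ n) \<eta>"] by auto
qed (simp add: assms(3))

lemma en_L2:
  assumes "\<eta> \<in> L2 \<mu>"
  shows "en k p n \<eta> \<in> L2 \<mu>" "L2norm \<mu> (en k p n \<eta>) \<le> L2norm \<mu> \<eta>"
proof -
  have 1: "(Lp k p ^^ n) \<eta> \<in> L2 \<mu> \<and> L2norm \<mu> ((Lp k p ^^ n) \<eta>) \<le> L2norm \<mu> \<eta>"
    by (rule pow_L2[OF Lp_L2 assms])
  have 2: "(Sop ^^ n) \<xi> \<in> L2 \<mu> \<and> L2norm \<mu> ((Sop ^^ n) \<xi>) \<le> L2norm \<mu> \<xi>" if "\<xi> \<in> L2 \<mu>" for \<xi>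
    by (rule pow_L2[OF Sop_L2 that])
  show "en k p n \<eta> \<in> L2 \<mu>" "L2norm \<mu> (en k p n \<eta>) \<le> L2norm \<mu> \<eta>"
    using 1 2[OF conjunct1[OF 1]] by (auto simp: en_def)
qed

lemma Mop_L2:
  assumes f: "continuous_on (Xk k) f" and c: "\<And>x. x \<in> Xk k \<Longrightarrow> cmod (f x) \<le> c" and \<eta>: "\<eta> \<in> L2 \<mu>"
  shows "Mop f \<eta> \<in> L2 \<mu>" "L2norm \<mu> (Mop f \<eta>) \<le> c * L2norm \<mu> \<eta>"
proof -
  note [measurable] = L2_measurable[OF \<eta>] measurable_mu[OF f]
  \<comment> \<open>A probability space is not empty, and one point of it already forces the bound c
    to be nonnegative.\<close>
  obtain x where "x \<in> Xk k" using not_empty by auto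
  then have c0: "0 \<le> c" using c[of x] norm_ge_zero[of "f x"] by linarith
  have c\<eta>: "(\<lambda>x. of_real c * \<eta> x) \<in> L2 \<mu>" by (rule L2_smult[OF \<eta>])
  have "Mop f \<eta> \<in> borel_measurable \<mu>" unfolding Mop_def by measurable
  moreover have "(\<integral>\<^sup>+x. ennreal ((cmod (Mop f \<eta> x))\<^sup>2) \<partial>\<mu>) \<le> (\<integral>\<^sup>+x. ennreal ((cmod (of_real c * \<eta> x))\<^sup>2) \<partial>\<mu>)"
    by (rule nn_integral_mono, rule ennreal_leI, rule power_mono)
       (use c c0 in \<open>auto simp: Mop_def norm_mult intro!: mult_right_mono\<close>)
  ultimately have "Mop f \<eta> \<in> L2 \<mu>" "L2norm \<mu> (Mop f \<eta>) \<le> L2norm \<mu> (\<lambda>x. of_real c * \<eta> x)"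
    by - (rule L2_nn_mono[OF _ c\<eta>], assumption+)+
  then show "Mop f \<eta> \<in> L2 \<mu>" "L2norm \<mu> (Mop f \<eta>) \<le> c * L2norm \<mu> \<eta>"
    using c0 by (simp_all add: L2norm_smult)
qed

end

section \<open>The generators and the algebra they span\<close>

definition gen_op :: "nat \<Rightarrow> (pt \<Rightarrow> real) \<Rightarrow> cfun \<Rightarrow> nat \<Rightarrow> cfun \<Rightarrow> op" where
  "gen_op k p f n g = Mop f \<circ> en k p n \<circ> Mop g"

lemma en_apply: "en k p n \<eta> x = (Lp k p ^^ n) \<eta> ((shift ^^ n) x)"
  by (simp add: en_def Sop_pow)

lemma gen_op_apply: "gen_op k p f n g \<eta> x = f x * en k p n (\<lambda>y. g y * \<eta> y) x"
  by (simp add: gen_op_def Mop_def)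

section \<open>Algebra of the conditional expectations and of the generators\<close>

lemma Lp_pow_add: "(Lp k p ^^ n) (\<lambda>x. u x + v x) = (\<lambda>x. (Lp k p ^^ n) u x + (Lp k p ^^ n) v x)"
proof (induction n)
  case (Suc n)
  then show ?case by (simp add: fun_eq_iff) (simp add: Lp_def distrib_left sum.distrib)
qed simp

lemma Lp_pow_smult: "(Lp k p ^^ n) (\<lambda>x. c * u x) = (\<lambda>x. c * (Lp k p ^^ n) u x)"
proof (induction n)
  case (Suc n)
  then show ?case by (simp add: fun_eq_iff) (simp add: Lp_def sum_distrib_left mult_ac)
qed simp

lemma en_add: "en k p n (\<lambda>x. u x + v x) x = en k p n u x + en k p n v x"
  by (simp add: en_apply Lp_pow_add)

lemma en_smult: "en k p n (\<lambda>x. c * u x) x = c * en k p n u x"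
  by (simp add: en_apply Lp_pow_smult)

lemma en_diff: "en k p n (\<lambda>x. u x - v x) x = en k p n u x - en k p n v x"
  using en_add[of k p n u "\<lambda>x. (-1) * v x" x] en_smult[of k p n "-1" v x] by simp

lemma en_cong:
  assumes "\<And>x. x \<in> Xk k \<Longrightarrow> u x = v x" "x \<in> Xk k"
  shows "en k p n u x = en k p n v x"
  unfolding en_apply using assms by (intro Lp_pow_cong shift_pow_in_Xk)

text \<open>All points summed over in the n-fold Ruelle operator at x are mapped to x by the n-th
  power of the shift, so u is a constant factor of the sum. No regularity enters, hence all
  composition rules derived from it are identities of functions rather than a.e. identities.\<close>

lemma Lp_pow_mult_shift:
  "(Lp k p ^^ n) (\<lambda>y. u ((shift ^^ n) y) * \<eta> y) = (\<lambda>x. u x * (Lp k p ^^ n) \<eta> x)"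
proof (induction n arbitrary: u)
  case (Suc n)
  \<comment> \<open>The induction hypothesis is used for u composed with one shift, which leaves a
    single application of \<open>Lp\<close> to commute with u.\<close>
  show ?case
    using Suc.IH[of "\<lambda>x. u (shift x)"]
    by (simp add: fun_eq_iff) (simp add: Lp_def sum_distrib_left mult_ac)
qed simp

lemma en_mult_shift: "en k p n (\<lambda>y. u ((shift ^^ n) y) * \<eta> y) x = u ((shift ^^ n) x) * en k p n \<eta> x"
  by (simp add: en_apply Lp_pow_mult_shift)

text \<open>For m at most n, functions of the n-th shift are functions of the m-th shift, so E_n eta
  is measurable for the finer sigma-algebra F_m and leaves E_m.\<close>

lemma en_mult_en_le:
  assumes "m \<le> n"
  shows "en k p m (\<lambda>y. u y * en k p n \<eta> y) x = en k p m u x * en k p n \<eta> x"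
proof -
  have "en k p n \<eta> = (\<lambda>x. (Lp k p ^^ n) \<eta> ((shift ^^ (n - m)) ((shift ^^ m) x)))"
    using fun_cong[OF funpow_add[of "n - m" m shift]] assms by (intro ext) (simp add: en_apply)
  then show ?thesis
    using en_mult_shift[of k p m "\<lambda>x. (Lp k p ^^ n) \<eta> ((shift ^^ (n - m)) x)" u x]
    by (simp add: mult.commute)
qed

text \<open>The tower property: E_m factors through the n-fold Ruelle operator, and that operator
  turns both products into the same symmetric product of the images of u and \<eta>.\<close>

lemma en_mult_en_ge:
  assumes "n \<le> m"
  shows "en k p m (\<lambda>y. u y * en k p n \<eta> y) = en k p m (\<lambda>y. en k p n u y * \<eta> y)"
proof -
  have "(Lp k p ^^ n) (\<lambda>y. u y * en k p n \<eta> y) = (Lp k p ^^ n) (\<lambda>y. en k p n u y * \<eta> y)"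
    using Lp_pow_mult_shift[of n k p "(Lp k p ^^ n) \<eta>" u]
      Lp_pow_mult_shift[of n k p "(Lp k p ^^ n) u" \<eta>]
    by (simp add: en_apply[abs_def] mult.commute)
  moreover have "(Lp k p ^^ m) \<phi> = (Lp k p ^^ (m - n)) ((Lp k p ^^ n) \<phi>)" for \<phi>
    using assms funpow_add[of "m - n" n "Lp k p"] by simp
  ultimately show ?thesis by (simp add: en_apply[abs_def])
qed

text \<open>In a product of generators the projection with the larger index survives. The two inner
  coefficients are averaged at the smaller index and absorbed into an outer coefficient, here the
  left one and in \<open>gen_op_comp_ge\<close> the right one.\<close>

lemma gen_op_comp_le:
  assumes "m \<le> n"
  shows "gen_op k p f m g \<circ> gen_op k p f' n g' = gen_op k p (\<lambda>x. f x * en k p m (\<lambda>y. g y * f' y) x) n g'"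
  using en_mult_en_le[OF assms]
  by (simp add: fun_eq_iff gen_op_apply[abs_def] mult.assoc[symmetric])

lemma gen_op_comp_ge:
  assumes "n \<le> m"
  shows "gen_op k p f m g \<circ> gen_op k p f' n g' = gen_op k p f m (\<lambda>x. en k p n (\<lambda>y. g y * f' y) x * g' x)"
  using en_mult_en_ge[OF assms]
  by (simp add: fun_eq_iff gen_op_apply[abs_def] mult.assoc[symmetric])

text \<open>Sums alone suffice: scalars go into the left coefficient and products collapse by the
  composition rules. Once this is identified with \<open>Alg0\<close>, inductions over the algebra
  have two cases and no product case.\<close>

inductive_set gen_span :: "nat \<Rightarrow> (pt \<Rightarrow> real) \<Rightarrow> op set" for k p where
  gen: "continuous_on (Xk k) f \<Longrightarrow> continuous_on (Xk k) g \<Longrightarrow> gen_op k p f n g \<in> gen_span k p"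
| add: "A \<in> gen_span k p \<Longrightarrow> B \<in> gen_span k p \<Longrightarrow> A +\<^sub>o B \<in> gen_span k p"

lemma gen_op_in_Alg0: "continuous_on (Xk k) f \<Longrightarrow> continuous_on (Xk k) g \<Longrightarrow> gen_op k p f n g \<in> Alg0 k p"
  unfolding gen_op_def by (rule Alg0.gen)

text \<open>Additivity at every point, unlike the a.e. additivity in \<open>bop\<close>. It is what
  makes closure of the span under composition an equality of operators as functions.\<close>

lemma gen_span_add_apply:
  assumes "A \<in> gen_span k p"
  shows "A (\<lambda>x. u x + v x) = (\<lambda>x. A u x + A v x)"
  using assms
proof (induction)
  case (gen f g n)
  show ?case by (simp add: fun_eq_iff gen_op_apply distrib_left en_add)
qed (simp add: op_add_def fun_eq_iff)

lemma gen_span_smult: "A \<in> gen_span k p \<Longrightarrow> c *\<^sub>o A \<in> gen_span k p"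
proof (induction rule: gen_span.induct)
  case (gen f g n)
  have "c *\<^sub>o gen_op k p f n g = gen_op k p (\<lambda>x. c * f x) n g"
    by (simp add: op_smult_def fun_eq_iff gen_op_apply)
  then show ?case using gen by (auto intro!: gen_span.gen continuous_intros)
next
  case (add A B)
  have "c *\<^sub>o (A +\<^sub>o B) = c *\<^sub>o A +\<^sub>o c *\<^sub>o B"
    by (simp add: op_smult_def op_add_def fun_eq_iff distrib_left)
  then show ?case using add by (auto intro: gen_span.add)
qed

lemma gen_span_comp:
  assumes p: "continuous_on (Xk k) p" and "A \<in> gen_span k p" "B \<in> gen_span k p"
  shows "A \<circ> B \<in> gen_span k p"
  using assms(2,3)
proof (induction A rule: gen_span.induct)
  case (gen f g m)
  note fg = gen(1,2)
  from gen(3) show ?case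
  proof (induction B rule: gen_span.induct)
    case (gen f' g' n)
    show ?case
    proof (cases "m \<le> n")
      case True
      then show ?thesis unfolding gen_op_comp_le[OF True]
        by (intro gen_span.gen continuous_intros continuous_on_en p fg gen)
    next
      case False
      then have "n \<le> m" by simp
      then show ?thesis unfolding gen_op_comp_ge[OF \<open>n \<le> m\<close>]
        by (intro gen_span.gen continuous_intros continuous_on_en p fg gen)
    qed
  next
    case (add B B')
    have "gen_op k p f m g \<circ> (B +\<^sub>o B') = (gen_op k p f m g \<circ> B) +\<^sub>o (gen_op k p f m g \<circ> B')"
      using gen_span_add_apply[OF gen_span.gen[OF fg]] by (simp add: op_add_def fun_eq_iff)
    then show ?case using gen_span.add[OF add.IH] by (simp only:)
  qed
next
  case (add A A')
  have "(A +\<^sub>o A') \<circ> B = (A \<circ> B) +\<^sub>o (A' \<circ> B)" by (simp add: op_add_def fun_eq_iff)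
  then show ?case using gen_span.add[OF add.IH(1)[OF add.prems] add.IH(2)[OF add.prems]] by (simp only:)
qed

lemma Alg0_eq_gen_span:
  assumes p: "continuous_on (Xk k) p"
  shows "Alg0 k p = gen_span k p"
proof (intro equalityI subsetI)
  fix A assume "A \<in> Alg0 k p"
  then show "A \<in> gen_span k p"
  proof induction
    case (gen f g n)
    then show ?case using gen_span.gen unfolding gen_op_def by blast
  qed (rule gen_span.add gen_span_smult gen_span_comp[OF p]; assumption)+
next
  fix A assume "A \<in> gen_span k p"
  then show "A \<in> Alg0 k p"
    by induction (auto intro: gen_op_in_Alg0 Alg0.add)
qed

section \<open>Bounds for the generators and the norm closed algebra they generate\<close>

context gibbs
begin

lemma Lp_pow_one: "x \<in> Xk k \<Longrightarrow> (Lp k p ^^ n) (\<lambda>_. 1) x = 1"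
proof (induction n arbitrary: x)
  case (Suc n)
  have "Lp k p ((Lp k p ^^ n) (\<lambda>_. 1)) x = Lp k p (\<lambda>_. 1) x"
    using Suc by (intro Lp_cong)
  also have "\<dots> = of_real (\<Sum>a\<in>{1..k}. p (case_nat a x))"
    unfolding Lp_def of_real_sum by (simp only: mult_1_right)
  also have "\<dots> = 1" unfolding p_norm[OF Suc.prems] by simp
  finally show ?case by simp
qed simp

lemma en_one: "x \<in> Xk k \<Longrightarrow> en k p n (\<lambda>_. 1) x = 1"
  unfolding en_apply by (intro Lp_pow_one shift_pow_in_Xk)

lemma gen_op_bound:
  assumes f: "continuous_on (Xk k) f" "\<And>x. x \<in> Xk k \<Longrightarrow> cmod (f x) \<le> c"
    and g: "continuous_on (Xk k) g" "\<And>x. x \<in> Xk k \<Longrightarrow> cmod (g x) \<le> d"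
  shows "bop \<mu> (gen_op k p f n g)" and "opnorm \<mu> (gen_op k p f n g) \<le> c * d"
proof -
  obtain x where "x \<in> Xk k" using not_empty by auto
  then have c0: "0 \<le> c" and d0: "0 \<le> d"
    using order_trans[OF norm_ge_zero f(2)] order_trans[OF norm_ge_zero g(2)] by blast+
  have in_L2: "gen_op k p f n g \<eta> \<in> L2 \<mu>" and
    bound: "L2norm \<mu> (gen_op k p f n g \<eta>) \<le> (c * d) * L2norm \<mu> \<eta>" if \<eta>: "\<eta> \<in> L2 \<mu>" for \<eta>
  proof -
    note g' = Mop_L2[OF g \<eta>]
    note e' = en_L2[OF g'(1), of n]
    note f' = Mop_L2[OF f e'(1)]
    show "gen_op k p f n g \<eta> \<in> L2 \<mu>" using f'(1) by (simp add: gen_op_def)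
    have "L2norm \<mu> (gen_op k p f n g \<eta>) \<le> c * (d * L2norm \<mu> \<eta>)"
      using f'(2) mult_left_mono[OF order_trans[OF e'(2) g'(2)] c0] by (simp add: gen_op_def)
    then show "L2norm \<mu> (gen_op k p f n g \<eta>) \<le> (c * d) * L2norm \<mu> \<eta>" by (simp add: mult.assoc)
  qed
  show "opnorm \<mu> (gen_op k p f n g) \<le> c * d"
    using bound c0 d0 by (intro opnorm_le) auto
  show "bop \<mu> (gen_op k p f n g)"
    unfolding bop_def
  proof (intro conjI ballI allI)
    show "gen_op k p f n g \<eta> \<in> L2 \<mu>" if "\<eta> \<in> L2 \<mu>" for \<eta> by (rule in_L2[OF that])
    show "AE x in \<mu>. gen_op k p f n g (\<lambda>y. \<eta> y + \<xi> y) x = gen_op k p f n g \<eta> x + gen_op k p f n g \<xi> x" for \<eta> \<xi>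
      by (simp add: gen_op_apply distrib_left en_add)
    show "AE x in \<mu>. gen_op k p f n g (\<lambda>y. e * \<eta> y) x = e * gen_op k p f n g \<eta> x" for \<eta> e
      using en_smult[of k p n e "\<lambda>y. g y * \<eta> y"] by (simp add: gen_op_apply mult_ac)
  qed (rule exI, rule ballI, rule bound)
qed

lemma gen_op_bop:
  assumes "continuous_on (Xk k) f" "continuous_on (Xk k) g"
  shows "bop \<mu> (gen_op k p f n g)"
proof -
  obtain c d where "\<And>x. x \<in> Xk k \<Longrightarrow> cmod (f x) \<le> c" "\<And>x. x \<in> Xk k \<Longrightarrow> cmod (g x) \<le> d"
    using continuous_on_Xk_bounded[OF assms(1)] continuous_on_Xk_bounded[OF assms(2)] by metis
  then show ?thesis using gen_op_bound(1) assms by blast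
qed

lemma Alg0_induct [consumes 1, case_names gen add]:
  assumes "A \<in> Alg0 k p"
    and "\<And>f g n. continuous_on (Xk k) f \<Longrightarrow> continuous_on (Xk k) g \<Longrightarrow> P (gen_op k p f n g)"
    and "\<And>A B. A \<in> Alg0 k p \<Longrightarrow> B \<in> Alg0 k p \<Longrightarrow> P A \<Longrightarrow> P B \<Longrightarrow> P (A +\<^sub>o B)"
  shows "P A"
  using assms(1) unfolding Alg0_eq_gen_span[OF p_cont]
  by induction (use assms(2,3) in \<open>auto simp: Alg0_eq_gen_span[OF p_cont]\<close>)

lemma Alg0_bop: "A \<in> Alg0 k p \<Longrightarrow> bop \<mu> A"
  by (induction rule: Alg0_induct) (auto intro: gen_op_bop bop_add)

abbreviation "U \<equiv> Ualg \<mu> k p"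

lemma U_bop: "A \<in> U \<Longrightarrow> bop \<mu> A"
  by (simp add: Ualg_def)

lemma U_approx:
  assumes "A \<in> U" "\<epsilon> > 0"
  obtains B where "B \<in> Alg0 k p" "opnorm \<mu> (A -\<^sub>o B) < \<epsilon>"
  using assms unfolding Ualg_def by blast

lemma Alg0_U: "A \<in> Alg0 k p \<Longrightarrow> A \<in> U"
  using opnorm_diff_eq_0[OF Alg0_bop Alg0_bop opeq_refl] Alg0_bop unfolding Ualg_def by force

lemma gen_op_U: "continuous_on (Xk k) f \<Longrightarrow> continuous_on (Xk k) g \<Longrightarrow> gen_op k p f n g \<in> U"
  by (intro Alg0_U gen_op_in_Alg0)

text \<open>Approximants may come from U itself. The closure properties of U, and later the
  membership of derivatives of entire extensions, all go through this one statement.\<close>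

lemma U_closed:
  assumes D: "bop \<mu> D" and approx: "\<And>\<epsilon>. \<epsilon> > 0 \<Longrightarrow> \<exists>A\<in>U. opnorm \<mu> (D -\<^sub>o A) < \<epsilon>"
  shows "D \<in> U"
proof -
  have "\<exists>B\<in>Alg0 k p. opnorm \<mu> (D -\<^sub>o B) < \<epsilon>" if e: "\<epsilon> > 0" for \<epsilon>
  proof -
    obtain A where A: "A \<in> U" "opnorm \<mu> (D -\<^sub>o A) < \<epsilon> / 2" using approx[OF half_gt_zero[OF e]] by blast
    obtain B where B: "B \<in> Alg0 k p" "opnorm \<mu> (A -\<^sub>o B) < \<epsilon> / 2"
      using U_approx[OF A(1) half_gt_zero[OF e]] by metis
    then have "opnorm \<mu> (D -\<^sub>o B) < \<epsilon>"
      using opnorm_diff_triangle[OF D U_bop[OF A(1)] Alg0_bop[OF B(1)]] A(2) by linarith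
    then show ?thesis using B(1) by blast
  qed
  then show ?thesis using D by (simp add: Ualg_def)
qed

lemma U_add:
  assumes A: "A \<in> U" and B: "B \<in> U"
  shows "A +\<^sub>o B \<in> U"
proof (rule U_closed)
  show "bop \<mu> (A +\<^sub>o B)" using A B by (intro bop_add U_bop)
  fix \<epsilon> :: real assume "\<epsilon> > 0"
  then have e: "\<epsilon> / 2 > 0" by simp
  obtain A' B' where A': "A' \<in> Alg0 k p" "opnorm \<mu> (A -\<^sub>o A') < \<epsilon> / 2"
    and B': "B' \<in> Alg0 k p" "opnorm \<mu> (B -\<^sub>o B') < \<epsilon> / 2"
    using U_approx[OF A e] U_approx[OF B e] by metis
  have "(A +\<^sub>o B) -\<^sub>o (A' +\<^sub>o B') = (A -\<^sub>o A') +\<^sub>o (B -\<^sub>o B')"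
    by (simp add: op_add_def op_diff_def fun_eq_iff)
  then have "opnorm \<mu> ((A +\<^sub>o B) -\<^sub>o (A' +\<^sub>o B')) < \<epsilon>"
    using bop_add(2)[OF bop_diff(1)[OF U_bop[OF A] Alg0_bop[OF A'(1)]] bop_diff(1)[OF U_bop[OF B] Alg0_bop[OF B'(1)]]]
      A'(2) B'(2) by simp
  then show "\<exists>C\<in>U. opnorm \<mu> (A +\<^sub>o B -\<^sub>o C) < \<epsilon>"
    using A'(1) B'(1) Alg0.add Alg0_U by blast
qed

lemma U_smult:
  assumes A: "A \<in> U"
  shows "c *\<^sub>o A \<in> U"
proof (rule U_closed)
  show "bop \<mu> (c *\<^sub>o A)" using A by (intro bop_smult U_bop)
  fix \<epsilon> :: real assume \<epsilon>: "\<epsilon> > 0"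
  then have e: "\<epsilon> / (cmod c + 1) > 0" by (simp add: add_nonneg_pos)
  obtain A' where A': "A' \<in> Alg0 k p" "opnorm \<mu> (A -\<^sub>o A') < \<epsilon> / (cmod c + 1)"
    using U_approx[OF A e] by metis
  have d: "bop \<mu> (A -\<^sub>o A')" using A A' by (intro bop_diff U_bop Alg0_bop)
  have "c *\<^sub>o A -\<^sub>o c *\<^sub>o A' = c *\<^sub>o (A -\<^sub>o A')"
    by (simp add: op_smult_def op_diff_def right_diff_distrib)
  then have "opnorm \<mu> (c *\<^sub>o A -\<^sub>o c *\<^sub>o A') \<le> cmod c * opnorm \<mu> (A -\<^sub>o A')"
    using bop_smult(2)[OF d] by simp
  also have "\<dots> \<le> (cmod c + 1) * opnorm \<mu> (A -\<^sub>o A')"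
    by (intro mult_right_mono opnorm_nonneg d) simp
  also have "\<dots> < \<epsilon>"
    using A'(2) by (simp add: pos_less_divide_eq add_nonneg_pos mult.commute)
  finally show "\<exists>C\<in>U. opnorm \<mu> (c *\<^sub>o A -\<^sub>o C) < \<epsilon>"
    using A'(1) Alg0.smult Alg0_U by blast
qed

lemma U_diff: "A \<in> U \<Longrightarrow> B \<in> U \<Longrightarrow> A -\<^sub>o B \<in> U"
  unfolding op_diff_eq by (intro U_add U_smult)

lemma U_comp:
  assumes A: "A \<in> U" and B: "B \<in> U"
  shows "A \<circ> B \<in> U"
proof (rule U_closed)
  note bA = U_bop[OF A] and bB = U_bop[OF B]
  show "bop \<mu> (A \<circ> B)" by (rule bop_comp(1)[OF bA bB])
  fix \<epsilon> :: real assume \<epsilon>: "\<epsilon> > 0"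
  \<comment> \<open>The tolerance for A' below depends on the norm of B', so B' must be chosen
    first. Adding 1 to the norms avoids division by zero.\<close>
  have "\<epsilon> / (2 * (opnorm \<mu> A + 1)) > 0"
    using \<epsilon> opnorm_nonneg[OF bA] by simp
  then obtain B' where B': "B' \<in> Alg0 k p" "opnorm \<mu> (B -\<^sub>o B') < \<epsilon> / (2 * (opnorm \<mu> A + 1))"
    using U_approx[OF B] by metis
  note bB' = Alg0_bop[OF B'(1)]
  have "\<epsilon> / (2 * (opnorm \<mu> B' + 1)) > 0"
    using \<epsilon> opnorm_nonneg[OF bB'] by simp
  then obtain A' where A': "A' \<in> Alg0 k p" "opnorm \<mu> (A -\<^sub>o A') < \<epsilon> / (2 * (opnorm \<mu> B' + 1))"
    using U_approx[OF A] by metis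
  note bA' = Alg0_bop[OF A'(1)]
  have "opnorm \<mu> ((A \<circ> B) -\<^sub>o (A \<circ> B')) \<le> opnorm \<mu> A * opnorm \<mu> (B -\<^sub>o B')"
    by (rule opnorm_comp_diff_right[OF bA bB bB'])
  also have "\<dots> \<le> (opnorm \<mu> A + 1) * opnorm \<mu> (B -\<^sub>o B')"
    by (intro mult_right_mono opnorm_nonneg bop_diff(1) bB bB') simp
  also have "\<dots> < \<epsilon> / 2"
    using B'(2) opnorm_nonneg[OF bA] by (simp add: field_simps)
  finally have 1: "opnorm \<mu> ((A \<circ> B) -\<^sub>o (A \<circ> B')) < \<epsilon> / 2" .
  have "opnorm \<mu> ((A \<circ> B') -\<^sub>o (A' \<circ> B')) \<le> opnorm \<mu> (A -\<^sub>o A') * opnorm \<mu> B'"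
    by (rule opnorm_comp_diff_left[OF bA bA' bB'])
  also have "\<dots> \<le> opnorm \<mu> (A -\<^sub>o A') * (opnorm \<mu> B' + 1)"
    by (intro mult_left_mono opnorm_nonneg bop_diff(1) bA bA') simp
  also have "\<dots> < \<epsilon> / 2"
    using A'(2) opnorm_nonneg[OF bB'] by (simp add: field_simps)
  finally have 2: "opnorm \<mu> ((A \<circ> B') -\<^sub>o (A' \<circ> B')) < \<epsilon> / 2" .
  have "opnorm \<mu> ((A \<circ> B) -\<^sub>o (A' \<circ> B')) < \<epsilon>"
    using opnorm_diff_triangle[OF bop_comp(1)[OF bA bB] bop_comp(1)[OF bA bB'] bop_comp(1)[OF bA' bB']] 1 2
    by linarith
  then show "\<exists>C\<in>U. opnorm \<mu> ((A \<circ> B) -\<^sub>o C) < \<epsilon>"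
    using A'(1) B'(1) Alg0.mult Alg0_U by blast
qed

section \<open>Bounded functionals: compatibility with a.e. equality, multiplication and
  density\<close>

definition bounded_functional :: "(op \<Rightarrow> complex) \<Rightarrow> bool" where
  "bounded_functional \<phi> \<longleftrightarrow> (\<forall>a\<in>U. \<forall>b\<in>U. \<phi> (a +\<^sub>o b) = \<phi> a + \<phi> b)
     \<and> (\<forall>c. \<forall>a\<in>U. \<phi> (c *\<^sub>o a) = c * \<phi> a)
     \<and> (\<exists>C. \<forall>a\<in>U. cmod (\<phi> a) \<le> C * opnorm \<mu> a)"

lemma bf_add: "bounded_functional \<phi> \<Longrightarrow> a \<in> U \<Longrightarrow> b \<in> U \<Longrightarrow> \<phi> (a +\<^sub>o b) = \<phi> a + \<phi> b"
  by (simp add: bounded_functional_def)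

lemma bf_smult: "bounded_functional \<phi> \<Longrightarrow> a \<in> U \<Longrightarrow> \<phi> (c *\<^sub>o a) = c * \<phi> a"
  by (simp add: bounded_functional_def)

lemma bf_diff: "bounded_functional \<phi> \<Longrightarrow> a \<in> U \<Longrightarrow> b \<in> U \<Longrightarrow> \<phi> (a -\<^sub>o b) = \<phi> a - \<phi> b"
  by (simp add: op_diff_eq bf_add bf_smult U_smult)

lemma bf_bound:
  assumes "bounded_functional \<phi>"
  obtains C where "C \<ge> 0" "\<And>a. a \<in> U \<Longrightarrow> cmod (\<phi> a) \<le> C * opnorm \<mu> a"
proof -
  obtain C where C: "\<And>a. a \<in> U \<Longrightarrow> cmod (\<phi> a) \<le> C * opnorm \<mu> a"
    using assms unfolding bounded_functional_def by blast
  have "cmod (\<phi> a) \<le> \<bar>C\<bar> * opnorm \<mu> a" if "a \<in> U" for a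
    using C[OF that] mult_right_mono[OF abs_ge_self[of C] opnorm_nonneg[OF U_bop[OF that]]] by linarith
  then show ?thesis using that[of "\<bar>C\<bar>"] by simp
qed

text \<open>The difference of a.e. equal operators has norm 0, so a bounded functional cannot see
  it. This gives access to \<open>sigma\<close> and to entire extensions, which are specified only
  up to \<open>opeq\<close>.\<close>

lemma bf_cong:
  assumes "bounded_functional \<phi>" "a \<in> U" "b \<in> U" "opeq \<mu> a b"
  shows "\<phi> a = \<phi> b"
proof -
  obtain C where "\<And>a. a \<in> U \<Longrightarrow> cmod (\<phi> a) \<le> C * opnorm \<mu> a" using bf_bound[OF assms(1)] by metis
  then have "cmod (\<phi> (a -\<^sub>o b)) \<le> C * opnorm \<mu> (a -\<^sub>o b)" using assms U_diff by blast
  then show ?thesis using opnorm_diff_eq_0[OF _ _ assms(4)] assms U_bop by (simp add: bf_diff)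
qed

lemma bf_comp_right:
  assumes \<phi>: "bounded_functional \<phi>" and b: "b \<in> U"
  shows "bounded_functional (\<lambda>a. \<phi> (a \<circ> b))"
proof -
  obtain C where C: "C \<ge> 0" "\<And>a. a \<in> U \<Longrightarrow> cmod (\<phi> a) \<le> C * opnorm \<mu> a" using bf_bound[OF \<phi>] by metis
  have "cmod (\<phi> (a \<circ> b)) \<le> (C * opnorm \<mu> b) * opnorm \<mu> a" if "a \<in> U" for a
    using C(2)[OF U_comp[OF that b]] mult_left_mono[OF bop_comp(2)[OF U_bop[OF that] U_bop[OF b]] C(1)]
    by (simp add: mult_ac)
  then have 1: "\<exists>C. \<forall>a\<in>U. cmod (\<phi> (a \<circ> b)) \<le> C * opnorm \<mu> a" by blast
  have 2: "\<phi> ((x +\<^sub>o y) \<circ> b) = \<phi> (x \<circ> b) + \<phi> (y \<circ> b)" if "x \<in> U" "y \<in> U" for x y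
  proof -
    have "(x +\<^sub>o y) \<circ> b = (x \<circ> b) +\<^sub>o (y \<circ> b)" by (simp add: op_add_def fun_eq_iff)
    then show ?thesis using bf_add[OF \<phi> U_comp[OF that(1) b] U_comp[OF that(2) b]] by (simp only:)
  qed
  have 3: "\<phi> ((c *\<^sub>o x) \<circ> b) = c * \<phi> (x \<circ> b)" if "x \<in> U" for c x
  proof -
    have "(c *\<^sub>o x) \<circ> b = c *\<^sub>o (x \<circ> b)" by (simp add: op_smult_def fun_eq_iff)
    then show ?thesis using bf_smult[OF \<phi> U_comp[OF that b]] by (simp only:)
  qed
  show ?thesis unfolding bounded_functional_def by (intro conjI ballI allI 1 2 3)
qed

text \<open>With b as the outer factor, linearity in a is only almost sure, hence the detour through
  \<open>bf_cong\<close>; with b as the inner factor it holds at every point.\<close>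

lemma bf_comp_left:
  assumes \<phi>: "bounded_functional \<phi>" and b: "b \<in> U"
  shows "bounded_functional (\<lambda>a. \<phi> (b \<circ> a))"
  unfolding bounded_functional_def
proof (intro conjI ballI allI)
  obtain C where C: "C \<ge> 0" "\<And>a. a \<in> U \<Longrightarrow> cmod (\<phi> a) \<le> C * opnorm \<mu> a" using bf_bound[OF \<phi>] by metis
  have "cmod (\<phi> (b \<circ> a)) \<le> (C * opnorm \<mu> b) * opnorm \<mu> a" if "a \<in> U" for a
    using C(2)[OF U_comp[OF b that]] mult_left_mono[OF bop_comp(2)[OF U_bop[OF b] U_bop[OF that]] C(1)]
    by (simp add: mult_ac)
  then show "\<exists>C. \<forall>a\<in>U. cmod (\<phi> (b \<circ> a)) \<le> C * opnorm \<mu> a" by blast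
  fix x assume x: "x \<in> U"
  show "\<phi> (b \<circ> (x +\<^sub>o y)) = \<phi> (b \<circ> x) + \<phi> (b \<circ> y)" if y: "y \<in> U" for y
  proof -
    have "opeq \<mu> (b \<circ> (x +\<^sub>o y)) ((b \<circ> x) +\<^sub>o (b \<circ> y))"
      unfolding opeq_def
    proof
      fix \<eta> assume \<eta>: "\<eta> \<in> L2 \<mu>"
      show "AE z in \<mu>. (b \<circ> (x +\<^sub>o y)) \<eta> z = ((b \<circ> x) +\<^sub>o (b \<circ> y)) \<eta> z"
        using bop_add_AE[OF U_bop[OF b] bop_L2[OF U_bop[OF x] \<eta>] bop_L2[OF U_bop[OF y] \<eta>]]
        by (simp add: op_add_def)
    qed
    then have "\<phi> (b \<circ> (x +\<^sub>o y)) = \<phi> ((b \<circ> x) +\<^sub>o (b \<circ> y))"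
      by (intro bf_cong[OF \<phi>] U_add U_comp b x y)
    then show ?thesis by (simp add: bf_add[OF \<phi>] U_comp b x y)
  qed
  show "\<phi> (b \<circ> (c *\<^sub>o x)) = c * \<phi> (b \<circ> x)" for c
  proof -
    have "opeq \<mu> (b \<circ> (c *\<^sub>o x)) (c *\<^sub>o (b \<circ> x))"
      unfolding opeq_def
    proof
      fix \<eta> assume \<eta>: "\<eta> \<in> L2 \<mu>"
      show "AE z in \<mu>. (b \<circ> (c *\<^sub>o x)) \<eta> z = (c *\<^sub>o (b \<circ> x)) \<eta> z"
        using bop_smult_AE[OF U_bop[OF b] bop_L2[OF U_bop[OF x] \<eta>]]
        by (simp add: op_smult_def)
    qed
    then have "\<phi> (b \<circ> (c *\<^sub>o x)) = \<phi> (c *\<^sub>o (b \<circ> x))"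
      by (intro bf_cong[OF \<phi>] U_smult U_comp b x)
    then show ?thesis by (simp add: bf_smult[OF \<phi>] U_comp b x)
  qed
qed

lemma bf_eq_on_Alg0:
  assumes \<phi>: "bounded_functional \<phi>" and \<psi>: "bounded_functional \<psi>"
    and eq: "\<And>a. a \<in> Alg0 k p \<Longrightarrow> \<phi> a = \<psi> a" and a: "a \<in> U"
  shows "\<phi> a = \<psi> a"
proof -
  obtain C where C: "C \<ge> 0" "\<And>a. a \<in> U \<Longrightarrow> cmod (\<phi> a) \<le> C * opnorm \<mu> a" using bf_bound[OF \<phi>] by metis
  obtain D where D: "D \<ge> 0" "\<And>a. a \<in> U \<Longrightarrow> cmod (\<psi> a) \<le> D * opnorm \<mu> a" using bf_bound[OF \<psi>] by metis
  have "cmod (\<phi> a - \<psi> a) \<le> 0 + \<epsilon>" if "\<epsilon> > 0" for \<epsilon>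
  proof -
    have "\<epsilon> / (C + D + 1) > 0" using C D that by simp
    then obtain b where b: "b \<in> Alg0 k p" "opnorm \<mu> (a -\<^sub>o b) < \<epsilon> / (C + D + 1)"
      using U_approx[OF a] by metis
    have d: "a -\<^sub>o b \<in> U" by (intro U_diff a Alg0_U b)
    have "\<phi> a - \<psi> a = \<phi> (a -\<^sub>o b) - \<psi> (a -\<^sub>o b)"
      using eq[OF b(1)] a Alg0_U[OF b(1)] by (simp add: bf_diff[OF \<phi>] bf_diff[OF \<psi>])
    then have "cmod (\<phi> a - \<psi> a) \<le> (C + D) * opnorm \<mu> (a -\<^sub>o b)"
      using norm_triangle_ineq4[of "\<phi> (a -\<^sub>o b)" "\<psi> (a -\<^sub>o b)"] C(2)[OF d] D(2)[OF d]
      by (simp add: distrib_right)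
    also have "\<dots> \<le> (C + D + 1) * opnorm \<mu> (a -\<^sub>o b)"
      by (intro mult_right_mono opnorm_nonneg U_bop d) simp
    also have "\<dots> \<le> \<epsilon>" using b(2) C D by (simp add: field_simps)
    finally show ?thesis by simp
  qed
  then have "cmod (\<phi> a - \<psi> a) \<le> 0" by (rule field_le_epsilon)
  then show ?thesis by simp
qed

end

section \<open>Entire extensions of the generators\<close>

lemma norm_exp_i_le:
  assumes "\<bar>y\<bar> \<le> K"
  shows "cmod (exp (\<i> * z * complex_of_real y)) \<le> exp (\<bar>Im z\<bar> * K)"
    and "cmod (exp (- (\<i> * z * complex_of_real y))) \<le> exp (\<bar>Im z\<bar> * K)"
proof -
  have "\<bar>Im z * y\<bar> \<le> \<bar>Im z\<bar> * K" unfolding abs_mult using assms by (intro mult_left_mono) auto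
  then show "cmod (exp (\<i> * z * complex_of_real y)) \<le> exp (\<bar>Im z\<bar> * K)"
    and "cmod (exp (- (\<i> * z * complex_of_real y))) \<le> exp (\<bar>Im z\<bar> * K)" by auto
qed

text \<open>The estimates are uniform in y, because differentiability in operator norm needs the
  remainders of the coefficients bounded uniformly over the space. The parameter s will be i for the
  left coefficient and -i for the right one.\<close>

lemma exp_first_order:
  assumes s: "cmod s \<le> 1" and d: "cmod d \<le> 1" and y: "\<bar>y\<bar> \<le> K"
  shows "cmod (exp (s * d * complex_of_real y) - 1) \<le> exp K * K * cmod d"
    and "cmod (exp (s * d * complex_of_real y) - 1 - s * d * complex_of_real y) \<le> exp K * K\<^sup>2 * (cmod d)\<^sup>2"
proof -
  let ?\<zeta> = "s * d * complex_of_real y"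
  have K: "0 \<le> K" using y by linarith
  have "cmod s * cmod d * \<bar>y\<bar> \<le> 1 * cmod d * K" using s d y by (intro mult_mono) auto
  then have 1: "cmod ?\<zeta> \<le> K * cmod d" by (simp add: norm_mult mult.commute)
  also have "\<dots> \<le> K" using d K by (simp add: mult_left_le)
  finally have "\<bar>Re ?\<zeta>\<bar> \<le> K" using abs_Re_le_cmod order_trans by blast
  then have e: "exp \<bar>Re ?\<zeta>\<bar> \<le> exp K" by simp
  have "cmod (exp ?\<zeta> - 1) \<le> exp \<bar>Re ?\<zeta>\<bar> * cmod ?\<zeta>"
    using Taylor_exp[of ?\<zeta> 0] by simp
  also have "\<dots> \<le> exp K * (K * cmod d)" by (intro mult_mono 1 e) auto
  finally show "cmod (exp ?\<zeta> - 1) \<le> exp K * K * cmod d" by (simp add: mult.assoc)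
  have "cmod (exp ?\<zeta> - 1 - ?\<zeta>) \<le> exp \<bar>Re ?\<zeta>\<bar> * (cmod ?\<zeta>)\<^sup>2"
    using Taylor_exp[of ?\<zeta> 1] by (simp add: power2_eq_square diff_diff_eq)
  also have "\<dots> \<le> exp K * (K * cmod d)\<^sup>2" by (intro mult_mono power_mono 1 e) auto
  finally show "cmod (exp ?\<zeta> - 1 - ?\<zeta>) \<le> exp K * K\<^sup>2 * (cmod d)\<^sup>2"
    by (simp add: power_mult_distrib mult.assoc)
qed

text \<open>For h the Birkhoff sum of ln H this is the candidate for sigma_z of a generator. The
  right coefficient is written with exp (-i z h) and not as a conjugate of the left one: the two
  agree for real z, but only the former is holomorphic in z.\<close>

definition flow :: "nat \<Rightarrow> (pt \<Rightarrow> real) \<Rightarrow> (pt \<Rightarrow> real) \<Rightarrow> cfun \<Rightarrow> nat \<Rightarrow> cfun \<Rightarrow> complex \<Rightarrow> op" where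
  "flow k p h f n g z = gen_op k p (\<lambda>x. f x * exp (\<i> * z * complex_of_real (h x))) n
     (\<lambda>x. exp (- (\<i> * z * complex_of_real (h x))) * g x)"

text \<open>A translation of the parameter is absorbed into the coefficients. This reduces the KMS
  identity along the whole real line to the parameter 0, at the price of changing the
  generator.\<close>

lemma flow_add: "flow k p h f n g (z + w) =
  flow k p h (\<lambda>x. f x * exp (\<i> * z * complex_of_real (h x))) n (\<lambda>x. exp (- (\<i> * z * complex_of_real (h x))) * g x) w"
proof -
  have 1: "f x * exp (\<i> * (z + w) * complex_of_real (h x)) =
      f x * exp (\<i> * z * complex_of_real (h x)) * exp (\<i> * w * complex_of_real (h x))" for x
    by (simp add: distrib_left distrib_right exp_add mult.assoc)
  have 2: "exp (- (\<i> * (z + w) * complex_of_real (h x))) * g x =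
      exp (- (\<i> * w * complex_of_real (h x))) * (exp (- (\<i> * z * complex_of_real (h x))) * g x)" for x
  proof -
    have "- (\<i> * (z + w) * complex_of_real (h x)) = - (\<i> * w * complex_of_real (h x)) + - (\<i> * z * complex_of_real (h x))"
      by (simp add: algebra_simps)
    then show ?thesis by (simp only: exp_add mult.assoc)
  qed
  show ?thesis unfolding flow_def 1 2 ..
qed

text \<open>The product rule for the bilinear dependence on the two coefficients, with exact
  remainder: two first-order Taylor remainders and one term of second order, d times an increment of
  v.\<close>

lemma gen_op_difference_quotient:
  "gen_op k p u n v -\<^sub>o gen_op k p u0 n v0 -\<^sub>o d *\<^sub>o (gen_op k p u' n v0 +\<^sub>o gen_op k p u0 n v')
   = gen_op k p (\<lambda>x. u x - u0 x - d * u' x) n v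
     +\<^sub>o (gen_op k p u0 n (\<lambda>x. v x - v0 x - d * v' x) +\<^sub>o d *\<^sub>o gen_op k p u' n (\<lambda>x. v x - v0 x))"
  unfolding op_add_def op_diff_def op_smult_def
  by (simp add: fun_eq_iff gen_op_apply left_diff_distrib en_diff en_smult mult.assoc)
     (simp add: algebra_simps)

context gibbs
begin

lemma flow_cont:
  assumes "continuous_on (Xk k) h" "continuous_on (Xk k) f" "continuous_on (Xk k) g"
  shows "continuous_on (Xk k) (\<lambda>x. f x * exp (\<i> * z * complex_of_real (h x)))"
    and "continuous_on (Xk k) (\<lambda>x. exp (- (\<i> * z * complex_of_real (h x))) * g x)"
  by (intro continuous_intros assms)+

lemma flow_U:
  assumes "continuous_on (Xk k) h" "continuous_on (Xk k) f" "continuous_on (Xk k) g"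
  shows "flow k p h f n g z \<in> U"
  unfolding flow_def by (intro gen_op_U flow_cont[OF assms])

lemma flow_opnorm:
  assumes h: "continuous_on (Xk k) h" and f: "continuous_on (Xk k) f" and g: "continuous_on (Xk k) g"
  shows "\<exists>B. \<forall>z. \<bar>Im z\<bar> \<le> R \<longrightarrow> opnorm \<mu> (flow k p h f n g z) \<le> B"
proof -
  obtain K where K: "0 \<le> K" "\<And>x. x \<in> Xk k \<Longrightarrow> norm (h x) \<le> K" using continuous_on_Xk_bounded[OF h] by metis
  obtain c where c: "0 \<le> c" "\<And>x. x \<in> Xk k \<Longrightarrow> cmod (f x) \<le> c" using continuous_on_Xk_bounded[OF f] by metis
  obtain d where d: "0 \<le> d" "\<And>x. x \<in> Xk k \<Longrightarrow> cmod (g x) \<le> d" using continuous_on_Xk_bounded[OF g] by metis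
  have "opnorm \<mu> (flow k p h f n g z) \<le> (c * exp (R * K)) * (exp (R * K) * d)" if z: "\<bar>Im z\<bar> \<le> R" for z
    unfolding flow_def
  proof (rule gen_op_bound(2)[OF flow_cont(1)[OF h f g] _ flow_cont(2)[OF h f g]])
    fix x assume x: "x \<in> Xk k"
    have "exp (\<bar>Im z\<bar> * K) \<le> exp (R * K)" using z K(1) by (simp add: mult_right_mono)
    then have e: "cmod (exp (\<i> * z * complex_of_real (h x))) \<le> exp (R * K)"
      "cmod (exp (- (\<i> * z * complex_of_real (h x)))) \<le> exp (R * K)"
      using norm_exp_i_le[of "h x" K z] K(2)[OF x] by simp_all
    show "cmod (f x * exp (\<i> * z * complex_of_real (h x))) \<le> c * exp (R * K)"
      unfolding norm_mult using c x by (intro mult_mono e) auto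
    show "cmod (exp (- (\<i> * z * complex_of_real (h x))) * g x) \<le> exp (R * K) * d"
      unfolding norm_mult using d x by (intro mult_mono e) auto
  qed
  then show ?thesis by blast
qed

lemma flow_differentiable:
  assumes h: "continuous_on (Xk k) h" and f: "continuous_on (Xk k) f" and g: "continuous_on (Xk k) g"
  shows "\<exists>D. bop \<mu> D \<and> ((\<lambda>w. opnorm \<mu> (flow k p h f n g w -\<^sub>o flow k p h f n g z -\<^sub>o (w - z) *\<^sub>o D)
    / cmod (w - z)) \<longlongrightarrow> 0) (at z)"
proof -
  define E where "E = (\<lambda>w x. exp (\<i> * w * complex_of_real (h x)))"
  define E' where "E' = (\<lambda>w x. exp (- (\<i> * w * complex_of_real (h x))))"
  define u where "u = (\<lambda>w x. f x * E w x)"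
  define v where "v = (\<lambda>w x. E' w x * g x)"
  define u' where "u' = (\<lambda>x. f x * (E z x * (\<i> * of_real (h x))))"
  define v' where "v' = (\<lambda>x. (E' z x * (- \<i> * of_real (h x))) * g x)"
  define D where "D = gen_op k p u' n (v z) +\<^sub>o gen_op k p (u z) n v'"
  have flow: "flow k p h f n g w = gen_op k p (u w) n (v w)" for w
    by (simp add: flow_def u_def v_def E_def E'_def)
  have cont: "continuous_on (Xk k) (u w)" "continuous_on (Xk k) (v w)"
    "continuous_on (Xk k) u'" "continuous_on (Xk k) v'" for w
    unfolding u_def v_def u'_def v'_def E_def E'_def by (intro continuous_intros h f g)+
  have D: "bop \<mu> D" unfolding D_def by (intro bop_add gen_op_bop cont)
  obtain K where K: "0 \<le> K" "\<And>x. x \<in> Xk k \<Longrightarrow> norm (h x) \<le> K" using continuous_on_Xk_bounded[OF h] by metis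
  obtain c where c: "0 \<le> c" "\<And>x. x \<in> Xk k \<Longrightarrow> cmod (f x) \<le> c" using continuous_on_Xk_bounded[OF f] by metis
  obtain d where d: "0 \<le> d" "\<And>x. x \<in> Xk k \<Longrightarrow> cmod (g x) \<le> d" using continuous_on_Xk_bounded[OF g] by metis
  \<comment> \<open>\<open>L\<close> bounds both exponentials at every w with |w - z| at most 1,
    which explains the 1 added to the imaginary part. \<open>M\<close> and \<open>N\<close> are the
    two constants of \<open>exp_first_order\<close>, and the three summands of \<open>B\<close>
    belong to ?T1, ?T2 and ?T3 below.\<close>
  define L where "L = exp ((\<bar>Im z\<bar> + 1) * K)"
  define M where "M = exp K * K\<^sup>2"
  define N where "N = exp K * K"
  have pos: "0 \<le> L" "0 \<le> M" "0 \<le> N" using K by (simp_all add: L_def M_def N_def)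
  define B where "B = (c * (L * M)) * (L * d) + ((c * L) * (L * M * d) + (c * (L * K)) * (L * N * d))"
  have bound: "opnorm \<mu> (flow k p h f n g w -\<^sub>o flow k p h f n g z -\<^sub>o (w - z) *\<^sub>o D) \<le> B * (cmod (w - z))\<^sup>2"
    if w: "cmod (w - z) \<le> 1" for w
  proof -
    let ?\<delta> = "cmod (w - z)"
    have Im: "\<bar>Im w\<bar> \<le> \<bar>Im z\<bar> + 1"
      using abs_Im_le_cmod[of "w - z"] w by simp
    have EL: "cmod (E a x) \<le> L" "cmod (E' a x) \<le> L" if "x \<in> Xk k" "\<bar>Im a\<bar> \<le> \<bar>Im z\<bar> + 1" for a x
    proof -
      have "exp (\<bar>Im a\<bar> * K) \<le> L" unfolding L_def using that(2) K(1) by (simp add: mult_right_mono)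
      moreover have "\<bar>h x\<bar> \<le> K" using K(2)[OF that(1)] by simp
      ultimately show "cmod (E a x) \<le> L" "cmod (E' a x) \<le> L"
        unfolding E_def E'_def using norm_exp_i_le[of "h x" K a] by linarith+
    qed
    have Ew: "E w x = E z x * exp (\<i> * (w - z) * complex_of_real (h x))"
      and E'w: "E' w x = E' z x * exp (- \<i> * (w - z) * complex_of_real (h x))" for x
      unfolding E_def E'_def exp_add[symmetric] by (simp_all add: algebra_simps)
    have r1: "cmod (E w x - E z x - (w - z) * (E z x * (\<i> * of_real (h x)))) \<le> L * M * ?\<delta>\<^sup>2" if x: "x \<in> Xk k" for x
    proof -
      have "E w x - E z x - (w - z) * (E z x * (\<i> * of_real (h x)))
          = E z x * (exp (\<i> * (w - z) * complex_of_real (h x)) - 1 - \<i> * (w - z) * complex_of_real (h x))"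
        unfolding Ew by (simp add: algebra_simps)
      moreover have "cmod \<dots> \<le> L * (M * ?\<delta>\<^sup>2)"
        unfolding norm_mult M_def
        using exp_first_order(2)[of \<i> "w - z" "h x" K] K(2)[OF x] w pos EL(1)[OF x, of z] by (intro mult_mono) auto
      ultimately show ?thesis by (simp add: mult.assoc)
    qed
    have r2: "cmod (E' w x - E' z x - (w - z) * (E' z x * (- \<i> * of_real (h x)))) \<le> L * M * ?\<delta>\<^sup>2" if x: "x \<in> Xk k" for x
    proof -
      have "E' w x - E' z x - (w - z) * (E' z x * (- \<i> * of_real (h x)))
          = E' z x * (exp (- \<i> * (w - z) * complex_of_real (h x)) - 1 - (- \<i>) * (w - z) * complex_of_real (h x))"
        unfolding E'w by (simp add: algebra_simps)
      moreover have "cmod \<dots> \<le> L * (M * ?\<delta>\<^sup>2)"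
        unfolding norm_mult M_def
        using exp_first_order(2)[of "- \<i>" "w - z" "h x" K] K(2)[OF x] w pos EL(2)[OF x, of z] by (intro mult_mono) auto
      ultimately show ?thesis by (simp add: mult.assoc)
    qed
    have r3: "cmod (E' w x - E' z x) \<le> L * N * ?\<delta>" if x: "x \<in> Xk k" for x
    proof -
      have "E' w x - E' z x = E' z x * (exp (- \<i> * (w - z) * complex_of_real (h x)) - 1)"
        unfolding E'w by (simp add: algebra_simps)
      moreover have "cmod \<dots> \<le> L * (N * ?\<delta>)"
        unfolding norm_mult N_def
        using exp_first_order(1)[of "- \<i>" "w - z" "h x" K] K(2)[OF x] w pos EL(2)[OF x, of z] by (intro mult_mono) auto
      ultimately show ?thesis by (simp add: mult.assoc)
    qed
    let ?T1 = "gen_op k p (\<lambda>x. u w x - u z x - (w - z) * u' x) n (v w)"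
    let ?T2 = "gen_op k p (u z) n (\<lambda>x. v w x - v z x - (w - z) * v' x)"
    let ?T3 = "gen_op k p u' n (\<lambda>x. v w x - v z x)"
    have b1: "bop \<mu> ?T1" and b2: "bop \<mu> ?T2" and b3: "bop \<mu> ?T3"
      by (intro gen_op_bop continuous_intros cont)+
    have t1: "opnorm \<mu> ?T1 \<le> (c * (L * M * ?\<delta>\<^sup>2)) * (L * d)"
    proof (rule gen_op_bound(2))
      fix x assume x: "x \<in> Xk k"
      have "u w x - u z x - (w - z) * u' x = f x * (E w x - E z x - (w - z) * (E z x * (\<i> * of_real (h x))))"
        by (simp add: u_def u'_def algebra_simps)
      then show "cmod (u w x - u z x - (w - z) * u' x) \<le> c * (L * M * ?\<delta>\<^sup>2)"
        using mult_mono[OF c(2)[OF x] r1[OF x]] c by (simp add: norm_mult)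
      show "cmod (v w x) \<le> L * d"
        unfolding v_def norm_mult using EL(2)[OF x Im] d x pos by (intro mult_mono) auto
    qed (intro continuous_intros cont)+
    have t2: "opnorm \<mu> ?T2 \<le> (c * L) * ((L * M * ?\<delta>\<^sup>2) * d)"
    proof (rule gen_op_bound(2))
      fix x assume x: "x \<in> Xk k"
      have "v w x - v z x - (w - z) * v' x = (E' w x - E' z x - (w - z) * (E' z x * (- \<i> * of_real (h x)))) * g x"
        by (simp add: v_def v'_def algebra_simps)
      then show "cmod (v w x - v z x - (w - z) * v' x) \<le> (L * M * ?\<delta>\<^sup>2) * d"
        using mult_mono[OF r2[OF x] d(2)[OF x]] pos by (simp add: norm_mult)
      show "cmod (u z x) \<le> c * L"
        unfolding u_def norm_mult using EL(1)[OF x, of z] c x pos by (intro mult_mono) auto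
    qed (intro continuous_intros cont)+
    have t3: "opnorm \<mu> ?T3 \<le> (c * (L * K)) * ((L * N * ?\<delta>) * d)"
    proof (rule gen_op_bound(2))
      fix x assume x: "x \<in> Xk k"
      have "v w x - v z x = (E' w x - E' z x) * g x" by (simp add: v_def algebra_simps)
      then show "cmod (v w x - v z x) \<le> (L * N * ?\<delta>) * d"
        using mult_mono[OF r3[OF x] d(2)[OF x]] pos by (simp add: norm_mult)
      show "cmod (u' x) \<le> c * (L * K)"
        unfolding u'_def norm_mult using EL(1)[OF x, of z] c K x pos by (intro mult_mono) auto
    qed (intro continuous_intros cont)+
    have eq: "flow k p h f n g w -\<^sub>o flow k p h f n g z -\<^sub>o (w - z) *\<^sub>o D = ?T1 +\<^sub>o (?T2 +\<^sub>o (w - z) *\<^sub>o ?T3)"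
      unfolding flow D_def by (rule gen_op_difference_quotient)
    have "opnorm \<mu> (?T1 +\<^sub>o (?T2 +\<^sub>o (w - z) *\<^sub>o ?T3)) \<le> opnorm \<mu> ?T1 + (opnorm \<mu> ?T2 + ?\<delta> * opnorm \<mu> ?T3)"
      using bop_add(2)[OF b1 bop_add(1)[OF b2 bop_smult(1)[OF b3, of "w - z"]]]
        bop_add(2)[OF b2 bop_smult(1)[OF b3, of "w - z"]] bop_smult(2)[OF b3, of "w - z"] by linarith
    then have "opnorm \<mu> (flow k p h f n g w -\<^sub>o flow k p h f n g z -\<^sub>o (w - z) *\<^sub>o D)
        \<le> (c * (L * M * ?\<delta>\<^sup>2)) * (L * d) + ((c * L) * ((L * M * ?\<delta>\<^sup>2) * d) + ?\<delta> * ((c * (L * K)) * ((L * N * ?\<delta>) * d)))"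
      unfolding eq by (rule order_trans[OF _ add_mono[OF t1 add_mono[OF t2 mult_left_mono[OF t3 norm_ge_zero]]]])
    also have "\<dots> = B * ?\<delta>\<^sup>2" by (simp add: B_def power2_eq_square algebra_simps)
    finally show ?thesis .
  qed
  have "((\<lambda>w. opnorm \<mu> (flow k p h f n g w -\<^sub>o flow k p h f n g z -\<^sub>o (w - z) *\<^sub>o D) / cmod (w - z)) \<longlongrightarrow> 0) (at z)"
  proof (rule Lim_null_comparison)
    have "\<forall>\<^sub>F w in at z. w \<noteq> z \<and> dist w z < 1"
      by (auto simp: eventually_at intro!: exI[of _ 1])
    then show "\<forall>\<^sub>F w in at z. norm (opnorm \<mu> (flow k p h f n g w -\<^sub>o flow k p h f n g z -\<^sub>o (w - z) *\<^sub>o D) / cmod (w - z))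
        \<le> B * cmod (w - z)"
    proof eventually_elim
      case (elim w)
      then have w: "cmod (w - z) > 0" "cmod (w - z) \<le> 1" by (auto simp: dist_norm)
      have "bop \<mu> (flow k p h f n g w -\<^sub>o flow k p h f n g z -\<^sub>o (w - z) *\<^sub>o D)"
        unfolding flow by (intro bop_diff bop_smult D gen_op_bop cont)
      then show ?case using bound[OF w(2)] w(1) opnorm_nonneg
        by (simp add: divide_le_eq power2_eq_square mult.assoc)
    qed
    have "((\<lambda>w. B * cmod (w - z)) \<longlongrightarrow> B * cmod (z - z)) (at z)" by (intro tendsto_intros)
    then show "((\<lambda>w. B * cmod (w - z)) \<longlongrightarrow> 0) (at z)" by simp
  qed
  then show ?thesis using D by blast
qed

lemma entire_ext_holomorphic:
  assumes F: "entire_ext \<mu> k p \<sigma> a F" and \<phi>: "bounded_functional \<phi>"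
  shows "(\<lambda>z. \<phi> (F z)) holomorphic_on UNIV"
  unfolding holomorphic_on_def
proof
  fix z :: complex
  have FU: "F z \<in> U" for z using F by (simp add: entire_ext_def)
  obtain D where D: "bop \<mu> D"
    "((\<lambda>w. opnorm \<mu> (F w -\<^sub>o F z -\<^sub>o (w - z) *\<^sub>o D) / cmod (w - z)) \<longlongrightarrow> 0) (at z)"
    using F unfolding entire_ext_def by blast
  have bop: "bop \<mu> (F w -\<^sub>o F z -\<^sub>o (w - z) *\<^sub>o D)" for w
    by (intro bop_diff bop_smult D U_bop FU)
  \<comment> \<open>The derivative is only given as a bounded operator, whereas \<phi> is controlled
    on U. It lies in U as a norm limit of difference quotients.\<close>
  have DU: "D \<in> U"
  proof (rule U_closed[OF D(1)])
    fix \<epsilon> :: real assume "\<epsilon> > 0"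
    then have "\<forall>\<^sub>F w in at z. opnorm \<mu> (F w -\<^sub>o F z -\<^sub>o (w - z) *\<^sub>o D) / cmod (w - z) < \<epsilon>"
      by (rule order_tendstoD(2)[OF D(2)])
    moreover have "\<forall>\<^sub>F w in at z. w \<noteq> z" by (simp add: eventually_at_filter)
    ultimately have "\<exists>w. opnorm \<mu> (F w -\<^sub>o F z -\<^sub>o (w - z) *\<^sub>o D) / cmod (w - z) < \<epsilon> \<and> w \<noteq> z"
      by (intro eventually_happens'[OF trivial_limit_at] eventually_conj)
    then obtain w where w: "opnorm \<mu> (F w -\<^sub>o F z -\<^sub>o (w - z) *\<^sub>o D) / cmod (w - z) < \<epsilon>" "w \<noteq> z" by blast
    let ?A = "(1 / (w - z)) *\<^sub>o (F w -\<^sub>o F z)"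
    have "D -\<^sub>o ?A = (- 1 / (w - z)) *\<^sub>o (F w -\<^sub>o F z -\<^sub>o (w - z) *\<^sub>o D)"
      using w(2) by (simp add: op_diff_def op_smult_def fun_eq_iff field_simps)
    then have "opnorm \<mu> (D -\<^sub>o ?A) \<le> cmod (- 1 / (w - z)) * opnorm \<mu> (F w -\<^sub>o F z -\<^sub>o (w - z) *\<^sub>o D)"
      using bop_smult(2)[OF bop, of "- 1 / (w - z)" w] by simp
    also have "\<dots> < \<epsilon>" using w by (simp add: norm_divide)
    finally show "\<exists>A\<in>U. opnorm \<mu> (D -\<^sub>o A) < \<epsilon>"
      using FU by (intro bexI[of _ ?A] U_smult U_diff)
  qed
  obtain C where C: "C \<ge> 0" "\<And>a. a \<in> U \<Longrightarrow> cmod (\<phi> a) \<le> C * opnorm \<mu> a" using bf_bound[OF \<phi>] by metis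
  have "((\<lambda>w. (\<phi> (F w) - \<phi> (F z)) / (w - z) - \<phi> D) \<longlongrightarrow> 0) (at z)"
  proof (rule Lim_null_comparison)
    have "\<forall>\<^sub>F w in at z. w \<noteq> z" by (simp add: eventually_at_filter)
    then show "\<forall>\<^sub>F w in at z. norm ((\<phi> (F w) - \<phi> (F z)) / (w - z) - \<phi> D)
        \<le> C * (opnorm \<mu> (F w -\<^sub>o F z -\<^sub>o (w - z) *\<^sub>o D) / cmod (w - z))"
    proof eventually_elim
      case (elim w)
      have "(\<phi> (F w) - \<phi> (F z)) / (w - z) - \<phi> D = \<phi> (F w -\<^sub>o F z -\<^sub>o (w - z) *\<^sub>o D) / (w - z)"
        using elim by (simp add: bf_diff[OF \<phi>] bf_smult[OF \<phi>] FU DU U_diff U_smult field_simps)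
      moreover have "cmod (\<phi> (F w -\<^sub>o F z -\<^sub>o (w - z) *\<^sub>o D)) \<le> C * opnorm \<mu> (F w -\<^sub>o F z -\<^sub>o (w - z) *\<^sub>o D)"
        by (intro C U_diff U_smult FU DU)
      ultimately show ?case by (simp add: norm_divide divide_right_mono)
    qed
    show "((\<lambda>w. C * (opnorm \<mu> (F w -\<^sub>o F z -\<^sub>o (w - z) *\<^sub>o D) / cmod (w - z))) \<longlongrightarrow> 0) (at z)"
      using tendsto_mult_left[OF D(2), of C] by simp
  qed
  then have "((\<lambda>z. \<phi> (F z)) has_field_derivative \<phi> D) (at z)"
    unfolding has_field_derivative_iff by (rule LIM_zero_cancel)
  then show "(\<lambda>z. \<phi> (F z)) field_differentiable at z within UNIV"
    by (auto simp: field_differentiable_def)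
qed

end

section \<open>The KMS condition\<close>

text \<open>Birkhoff sums of ln H turn the products H^{z[n]} into exp (z * birk), which makes sense
  for complex exponents and is visibly entire.\<close>

definition birk :: "(pt \<Rightarrow> real) \<Rightarrow> nat \<Rightarrow> pt \<Rightarrow> real" where
  "birk H n x = (\<Sum>j<n. ln (H ((shift ^^ j) x)))"

text \<open>The cocycle rule, here and in \<open>lam_inv_add\<close>, cuts an n-step quantity at
  time m. The part beyond m is a function of the m-th shift and so passes through \<open>en\<close>
  of index m.\<close>

lemma birk_add: "birk H (m + n) x = birk H m x + birk H n ((shift ^^ m) x)"
proof (induction n)
  case (Suc n)
  then show ?case
    using fun_cong[OF funpow_add[of n m shift], of x] by (simp add: birk_def add.commute[of n m])
qed (simp add: birk_def)

lemma lam_inv_add: "lam_inv p (m + n) x = lam_inv p m x * lam_inv p n ((shift ^^ m) x)"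
proof (induction n)
  case (Suc n)
  then show ?case
    using fun_cong[OF funpow_add[of n m shift], of x] by (simp add: lam_inv_def add.commute[of n m])
qed (simp add: lam_inv_def)

lemma Hit_eq: "Hit H t n x = exp (\<i> * complex_of_real t * complex_of_real (birk H n x))"
  by (simp add: Hit_def birk_def exp_sum[symmetric] sum_distrib_left)

lemma cnj_Hit_eq: "cnj (Hit H t n x) = exp (- (\<i> * complex_of_real t * complex_of_real (birk H n x)))"
  by (simp add: Hit_eq exp_cnj)

lemma continuous_on_birk:
  assumes "\<And>x. x \<in> Xk k \<Longrightarrow> H x > 0" "continuous_on (Xk k) H"
  shows "continuous_on (Xk k) (birk H n)"
proof -
  have "H ((shift ^^ j) x) \<noteq> 0" if "x \<in> Xk k" for j x
    using assms(1)[OF shift_pow_in_Xk[OF that]] by (simp add: less_imp_neq[symmetric])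
  then have "continuous_on (Xk k) (\<lambda>x. \<Sum>j<n. ln (H ((shift ^^ j) x)))"
    by (intro continuous_intros continuous_on_compose_shift_pow assms(2)) auto
  then show ?thesis by (simp add: birk_def[abs_def])
qed

lemma continuous_on_lam_inv:
  assumes "continuous_on (Xk k) p"
  shows "continuous_on (Xk k) (lam_inv p n)"
proof -
  have "continuous_on (Xk k) (\<lambda>x. \<Prod>j<n. p ((shift ^^ j) x))"
    by (intro continuous_on_prod continuous_on_compose_shift_pow assms)
  then show ?thesis by (simp add: lam_inv_def[abs_def])
qed

lemma lam_inv_pos: "(\<And>x. x \<in> Xk k \<Longrightarrow> p x > 0) \<Longrightarrow> x \<in> Xk k \<Longrightarrow> lam_inv p n x > 0"
  unfolding lam_inv_def by (intro prod_pos ballI) (auto intro: shift_pow_in_Xk)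

lemma Lambda_eq:
  assumes "\<And>x. x \<in> Xk k \<Longrightarrow> H x > 0" "x \<in> Xk k"
  shows "Lambda p H \<beta> n x = exp (- (\<beta> * birk H n x)) / lam_inv p n x"
proof -
  have "H ((shift ^^ j) x) powr (- \<beta>) = exp (- (\<beta> * ln (H ((shift ^^ j) x))))" for j
    using assms(1)[OF shift_pow_in_Xk[OF assms(2)], of j] by (simp add: powr_def)
  then have "Lambda p H \<beta> n x = (\<Prod>j<n. exp (- (\<beta> * ln (H ((shift ^^ j) x))))) / lam_inv p n x"
    by (simp add: Lambda_def lam_inv_def prod_dividef)
  then show ?thesis
    by (simp add: exp_sum[symmetric] birk_def sum_distrib_left sum_negf)
qed

section \<open>The invariance identity and the KMS condition on generators\<close>

locale kms_setting = gibbs +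
  fixes H :: "pt \<Rightarrow> real" and \<beta> :: real and \<nu> :: "pt measure"
    and \<sigma> :: "real \<Rightarrow> op \<Rightarrow> op" and \<psi> :: "op \<Rightarrow> complex"
  assumes H_pos: "\<And>x. x \<in> Xk k \<Longrightarrow> H x > 0"
    and H_cont: "continuous_on (Xk k) H"
    and sigma: "dynamics \<mu> k p H \<sigma>"
    and nu_sets: "sets \<nu> = sets (restrict_space borel (Xk k))"
    and psi_bf: "bounded_functional \<psi>"
    and psi_gen: "\<And>f g n. continuous_on (Xk k) f \<Longrightarrow> continuous_on (Xk k) g \<Longrightarrow>
        \<psi> (gen_op k p f n g) = (\<integral>x. f x * complex_of_real (lam_inv p n x) * g x \<partial>\<nu>)"
begin

lemma space_nu [simp]: "space \<nu> = Xk k"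
  using sets_eq_imp_space_eq[OF nu_sets] by (simp add: space_restrict_space)

lemma integral_nu_cong:
  fixes f g :: cfun
  shows "(\<And>x. x \<in> Xk k \<Longrightarrow> f x = g x) \<Longrightarrow> (\<integral>x. f x \<partial>\<nu>) = (\<integral>x. g x \<partial>\<nu>)"
  by (intro Bochner_Integration.integral_cong) auto

text \<open>Beware of the sign: \<open>lam n\<close> is lambda^{-[n]}. Hence Lambda_n is
  \<open>Hneg n\<close> divided by \<open>lam n\<close>, and its inverse is \<open>Hpow n\<close>
  times \<open>lam n\<close>.\<close>

abbreviation "lam n x \<equiv> complex_of_real (lam_inv p n x)"
definition Hpow :: "nat \<Rightarrow> cfun" where "Hpow n x = exp (complex_of_real (\<beta> * birk H n x))"
definition Hneg :: "nat \<Rightarrow> cfun" where "Hneg n x = exp (- complex_of_real (\<beta> * birk H n x))"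

lemma Hpow_Hneg: "Hpow n x * Hneg n x = 1"
  by (simp add: Hpow_def Hneg_def exp_minus)

lemma lam_nonzero: "x \<in> Xk k \<Longrightarrow> lam n x \<noteq> 0"
  using lam_inv_pos[where k = k and p = p and n = n and x = x] p_pos by fastforce

lemma birk_cont: "continuous_on (Xk k) (birk H n)"
  by (rule continuous_on_birk[OF H_pos H_cont])

lemma Hpow_cont: "continuous_on (Xk k) (Hpow n)"
  unfolding Hpow_def[abs_def] by (intro continuous_intros birk_cont)

lemma Hneg_cont: "continuous_on (Xk k) (Hneg n)"
  unfolding Hneg_def[abs_def] by (intro continuous_intros birk_cont)

lemma lam_cont: "continuous_on (Xk k) (lam n)"
  by (intro continuous_intros continuous_on_lam_inv p_cont)

lemmas cont_intros = continuous_intros Hpow_cont Hneg_cont lam_cont p_cont continuous_on_en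

definition invariance :: bool where
  "invariance \<longleftrightarrow> (\<forall>n f. continuous_on (Xk k) f \<longrightarrow>
       (\<integral>x. f x \<partial>\<nu>) =
       (\<integral>x. complex_of_real (1 / Lambda p H \<beta> n x)
             * ((Lp k p ^^ n) (\<lambda>y. complex_of_real (Lambda p H \<beta> n y) * f y)) ((shift ^^ n) x) \<partial>\<nu>))"

lemma invariance_rhs:
  "(\<integral>x. complex_of_real (1 / Lambda p H \<beta> n x)
      * ((Lp k p ^^ n) (\<lambda>y. complex_of_real (Lambda p H \<beta> n y) * f y)) ((shift ^^ n) x) \<partial>\<nu>)
   = (\<integral>x. Hpow n x * lam n x * en k p n (\<lambda>y. Hneg n y / lam n y * f y) x \<partial>\<nu>)"
proof (rule integral_nu_cong)
  fix x assume x: "x \<in> Xk k"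
  have Lambda_Hneg: "complex_of_real (Lambda p H \<beta> n y) = Hneg n y / lam n y" if "y \<in> Xk k" for y
    using Lambda_eq[where H = H and k = k and x = y and p = p and \<beta> = \<beta> and n = n, OF H_pos that] by (simp add: Hneg_def flip: exp_of_real)
  have "en k p n (\<lambda>y. complex_of_real (Lambda p H \<beta> n y) * f y) x = en k p n (\<lambda>y. Hneg n y / lam n y * f y) x"
    by (rule en_cong) (use Lambda_Hneg x in auto)
  moreover have "complex_of_real (1 / Lambda p H \<beta> n x) = Hpow n x * lam n x"
  proof -
    have "complex_of_real (1 / Lambda p H \<beta> n x) = lam n x / Hneg n x" using Lambda_Hneg[OF x] by simp
    also have "\<dots> = Hpow n x * lam n x" by (simp add: Hpow_def Hneg_def exp_minus field_simps)
    finally show ?thesis .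
  qed
  ultimately show "complex_of_real (1 / Lambda p H \<beta> n x)
      * ((Lp k p ^^ n) (\<lambda>y. complex_of_real (Lambda p H \<beta> n y) * f y)) ((shift ^^ n) x)
      = Hpow n x * lam n x * en k p n (\<lambda>y. Hneg n y / lam n y * f y) x"
    by (simp add: en_apply)
qed

lemma invariance_apply:
  "invariance \<Longrightarrow> continuous_on (Xk k) f \<Longrightarrow>
    (\<integral>x. f x \<partial>\<nu>) = (\<integral>x. Hpow n x * lam n x * en k p n (\<lambda>y. Hneg n y / lam n y * f y) x \<partial>\<nu>)"
  unfolding invariance_def invariance_rhs by blast

text \<open>Both sides reduce to the symmetric expression with the two conditional expectations
  \<open>en r (u * Hneg r)\<close> and \<open>en r v\<close>.\<close>
lemma invariance_exchange:
  assumes inv: invariance and u: "continuous_on (Xk k) u" and v: "continuous_on (Xk k) v"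
    and q: "continuous_on (Xk k) q"
  shows "(\<integral>x. u x * lam r x * q ((shift ^^ r) x) * en k p r v x \<partial>\<nu>)
    = (\<integral>x. v x * en k p r (\<lambda>y. u y * Hneg r y) x * Hpow r x * lam r x * q ((shift ^^ r) x) \<partial>\<nu>)"
proof -
  note q' = continuous_on_compose_shift_pow[OF q, of r]
  let ?uQ = "\<lambda>y. u y * Hneg r y"
  let ?c = "\<lambda>x. Hpow r x * lam r x * (q ((shift ^^ r) x) * en k p r ?uQ x * en k p r v x)"
  \<comment> \<open>First use of the invariance. The factor \<open>lam r\<close> in the integrand
    cancels the denominator of Lambda_r, while \<open>q\<close> and the average of v depend on the
    r-th shift only and leave the expectation.\<close>
  have "(\<integral>x. u x * lam r x * q ((shift ^^ r) x) * en k p r v x \<partial>\<nu>) = (\<integral>x. Hpow r x * lam r x *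
      en k p r (\<lambda>y. Hneg r y / lam r y * (u y * lam r y * q ((shift ^^ r) y) * en k p r v y)) x \<partial>\<nu>)"
    by (rule invariance_apply[OF inv]) (intro cont_intros u v q')
  also have "\<dots> = (\<integral>x. ?c x \<partial>\<nu>)"
  proof (rule integral_nu_cong)
    fix x assume x: "x \<in> Xk k"
    have "en k p r (\<lambda>y. Hneg r y / lam r y * (u y * lam r y * q ((shift ^^ r) y) * en k p r v y)) x
      = en k p r (\<lambda>y. (\<lambda>z. q z * (Lp k p ^^ r) v z) ((shift ^^ r) y) * ?uQ y) x"
      by (rule en_cong[OF _ x]) (use lam_nonzero in \<open>simp add: en_apply\<close>)
    also have "\<dots> = q ((shift ^^ r) x) * en k p r v x * en k p r ?uQ x"
      by (subst en_mult_shift) (simp add: en_apply)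
    finally show "Hpow r x * lam r x *
      en k p r (\<lambda>y. Hneg r y / lam r y * (u y * lam r y * q ((shift ^^ r) y) * en k p r v y)) x = ?c x"
      by (simp add: mult_ac)
  qed
  \<comment> \<open>Second use, prepared backwards: the symmetric integrand is also what the
    right-hand side produces. There \<open>Hpow\<close> cancels \<open>Hneg\<close>, the average of
    \<open>?uQ\<close> comes out, and v is the factor that gets averaged.\<close>
  also have "\<dots> = (\<integral>x. Hpow r x * lam r x *
      en k p r (\<lambda>y. Hneg r y / lam r y * (v y * en k p r ?uQ y * Hpow r y * lam r y * q ((shift ^^ r) y))) x \<partial>\<nu>)"
  proof (rule integral_nu_cong)
    fix x assume x: "x \<in> Xk k"
    have "en k p r (\<lambda>y. Hneg r y / lam r y * (v y * en k p r ?uQ y * Hpow r y * lam r y * q ((shift ^^ r) y))) x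
      = en k p r (\<lambda>y. (\<lambda>z. q z * (Lp k p ^^ r) ?uQ z) ((shift ^^ r) y) * v y) x"
    proof (rule en_cong[OF _ x])
      fix y assume "y \<in> Xk k"
      then have eq: "Hneg r y / lam r y * (v y * en k p r ?uQ y * Hpow r y * lam r y * q ((shift ^^ r) y))
        = (Hpow r y * Hneg r y) * (v y * en k p r ?uQ y * q ((shift ^^ r) y))"
        using lam_nonzero by (simp add: field_simps)
      show "Hneg r y / lam r y * (v y * en k p r ?uQ y * Hpow r y * lam r y * q ((shift ^^ r) y))
        = (\<lambda>z. q z * (Lp k p ^^ r) ?uQ z) ((shift ^^ r) y) * v y"
        unfolding eq Hpow_Hneg by (simp add: en_apply mult_ac)
    qed
    also have "\<dots> = q ((shift ^^ r) x) * en k p r ?uQ x * en k p r v x"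
      by (subst en_mult_shift) (simp add: en_apply)
    finally show "?c x = Hpow r x * lam r x *
      en k p r (\<lambda>y. Hneg r y / lam r y * (v y * en k p r ?uQ y * Hpow r y * lam r y * q ((shift ^^ r) y))) x"
      by (simp add: mult_ac)
  qed
  also have "\<dots> = (\<integral>x. v x * en k p r ?uQ x * Hpow r x * lam r x * q ((shift ^^ r) x) \<partial>\<nu>)"
    by (rule invariance_apply[OF inv, symmetric]) (intro cont_intros u v q')
  finally show ?thesis .
qed

lemma flow_i\<beta>: "flow k p (birk H n) f n g (\<i> * complex_of_real \<beta>) =
  gen_op k p (\<lambda>x. f x * Hneg n x) n (\<lambda>x. Hpow n x * g x)"
  by (simp add: flow_def Hpow_def Hneg_def mult.assoc[symmetric])

text \<open>The exchange is applied with u = f l, v = g h and with \<open>q\<close> carrying the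
  part of lambda^{-[max m n]} beyond the smaller index. Powers of H beyond that index occur only if
  the first generator has the larger index.\<close>

lemma kms_gen_gen:
  assumes inv: invariance
    and f: "continuous_on (Xk k) f" and g: "continuous_on (Xk k) g"
    and h: "continuous_on (Xk k) h" and l: "continuous_on (Xk k) l"
  shows "\<psi> (gen_op k p f n g \<circ> gen_op k p h m l)
    = \<psi> (gen_op k p h m l \<circ> flow k p (birk H n) f n g (\<i> * complex_of_real \<beta>))"
proof (cases "m \<le> n")
  case True
  let ?q = "lam (n - m)"
  have lam: "lam n x = lam m x * ?q ((shift ^^ m) x)" for x
    using lam_inv_add[of p m "n - m" x] True by simp
  have Hpow_split: "Hpow n x = Hpow m x * Hpow (n - m) ((shift ^^ m) x)" "Hneg n x = Hneg m x * Hneg (n - m) ((shift ^^ m) x)" for x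
    using birk_add[of H m "n - m" x] True
    by (simp_all add: Hpow_def Hneg_def exp_add[symmetric] distrib_left)
  have "\<psi> (gen_op k p f n g \<circ> gen_op k p h m l)
      = (\<integral>x. f x * lam n x * (en k p m (\<lambda>y. g y * h y) x * l x) \<partial>\<nu>)"
    unfolding gen_op_comp_ge[OF True] by (rule psi_gen) (intro cont_intros f g h l)+
  also have "\<dots> = (\<integral>x. (f x * l x) * lam m x * ?q ((shift ^^ m) x) * en k p m (\<lambda>y. g y * h y) x \<partial>\<nu>)"
    unfolding lam by (simp add: mult_ac)
  also have "\<dots> = (\<integral>x. (g x * h x) * en k p m (\<lambda>y. f y * l y * Hneg m y) x * Hpow m x * lam m x * ?q ((shift ^^ m) x) \<partial>\<nu>)"
    by (rule invariance_exchange[OF inv, where r = m and u = "\<lambda>x. f x * l x" and v = "\<lambda>x. g x * h x" and q = ?q])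
       (intro cont_intros f g h l)+
  also have "\<dots> = (\<integral>x. (h x * en k p m (\<lambda>y. l y * (f y * Hneg n y)) x) * lam n x * (Hpow n x * g x) \<partial>\<nu>)"
  proof (rule integral_nu_cong)
    fix x
    \<comment> \<open>The excess factor \<open>Hneg (n - m)\<close> depends on the m-th shift only,
      so it leaves the average and cancels the matching excess of \<open>Hpow n\<close>.\<close>
    have "en k p m (\<lambda>y. l y * (f y * Hneg n y)) x
        = en k p m (\<lambda>y. Hneg (n - m) ((shift ^^ m) y) * (f y * l y * Hneg m y)) x"
      by (simp add: Hpow_split mult_ac)
    also have "\<dots> = Hneg (n - m) ((shift ^^ m) x) * en k p m (\<lambda>y. f y * l y * Hneg m y) x"
      by (rule en_mult_shift)
    finally have "(h x * en k p m (\<lambda>y. l y * (f y * Hneg n y)) x) * lam n x * (Hpow n x * g x)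
      = (Hpow (n - m) ((shift ^^ m) x) * Hneg (n - m) ((shift ^^ m) x)) *
        ((g x * h x) * en k p m (\<lambda>y. f y * l y * Hneg m y) x * Hpow m x * lam m x * ?q ((shift ^^ m) x))"
      unfolding lam Hpow_split by (simp add: mult_ac)
    then show "(g x * h x) * en k p m (\<lambda>y. f y * l y * Hneg m y) x * Hpow m x * lam m x * ?q ((shift ^^ m) x)
      = (h x * en k p m (\<lambda>y. l y * (f y * Hneg n y)) x) * lam n x * (Hpow n x * g x)"
      by (simp only: Hpow_Hneg mult_1_left)
  qed
  also have "\<dots> = \<psi> (gen_op k p h m l \<circ> flow k p (birk H n) f n g (\<i> * complex_of_real \<beta>))"
    unfolding flow_i\<beta> gen_op_comp_le[OF True] by (rule psi_gen[symmetric]) (intro cont_intros f g h l)+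
  finally show ?thesis .
next
  case False
  then have le: "n \<le> m" by simp
  let ?q = "lam (m - n)"
  have lam: "lam m x = lam n x * ?q ((shift ^^ n) x)" for x
    using lam_inv_add[of p n "m - n" x] le by simp
  have "\<psi> (gen_op k p f n g \<circ> gen_op k p h m l)
      = (\<integral>x. (f x * en k p n (\<lambda>y. g y * h y) x) * lam m x * l x \<partial>\<nu>)"
    unfolding gen_op_comp_le[OF le] by (rule psi_gen) (intro cont_intros f g h l)+
  also have "\<dots> = (\<integral>x. (f x * l x) * lam n x * ?q ((shift ^^ n) x) * en k p n (\<lambda>y. g y * h y) x \<partial>\<nu>)"
    unfolding lam by (simp add: mult_ac)
  also have "\<dots> = (\<integral>x. (g x * h x) * en k p n (\<lambda>y. f y * l y * Hneg n y) x * Hpow n x * lam n x * ?q ((shift ^^ n) x) \<partial>\<nu>)"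
    by (rule invariance_exchange[OF inv, where r = n and u = "\<lambda>x. f x * l x" and v = "\<lambda>x. g x * h x" and q = ?q])
       (intro cont_intros f g h l)+
  also have "\<dots> = (\<integral>x. h x * lam m x * (en k p n (\<lambda>y. l y * (f y * Hneg n y)) x * (Hpow n x * g x)) \<partial>\<nu>)"
    unfolding lam by (simp add: mult_ac)
  also have "\<dots> = \<psi> (gen_op k p h m l \<circ> flow k p (birk H n) f n g (\<i> * complex_of_real \<beta>))"
    unfolding flow_i\<beta> gen_op_comp_ge[OF le] by (rule psi_gen[symmetric]) (intro cont_intros f g h l)+
  finally show ?thesis .
qed

text \<open>With the generator fixed, both sides are bounded functionals of b, so b is freed by
  plain density. The first factor cannot be freed in this way, for want of a bound on its image
  under sigma_{i beta}.\<close>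

lemma kms_gen:
  assumes inv: invariance
    and f: "continuous_on (Xk k) f" and g: "continuous_on (Xk k) g" and b: "b \<in> U"
  shows "\<psi> (gen_op k p f n g \<circ> b) = \<psi> (b \<circ> flow k p (birk H n) f n g (\<i> * complex_of_real \<beta>))"
proof -
  note bf1 = bf_comp_left[OF psi_bf gen_op_U[OF f g, of n]]
  note bf2 = bf_comp_right[OF psi_bf flow_U[OF birk_cont f g, of n n "\<i> * complex_of_real \<beta>"]]
  show ?thesis
  proof (rule bf_eq_on_Alg0[OF bf1 bf2 _ b])
    fix a assume "a \<in> Alg0 k p"
    then show "\<psi> (gen_op k p f n g \<circ> a) = \<psi> (a \<circ> flow k p (birk H n) f n g (\<i> * complex_of_real \<beta>))"
    proof (induction rule: Alg0_induct)
      case (gen h l m)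
      then show ?case by (intro kms_gen_gen inv f g)
    next
      case (add A B)
      note U = add.hyps[THEN Alg0_U]
      show ?case unfolding bf_add[OF bf1 U] bf_add[OF bf2 U] add.IH ..
    qed
  qed
qed

section \<open>Entire extensions over the span and passage to analytic elements\<close>

lemma sigma_props:
  shows "\<forall>t. \<forall>a\<in>U. \<sigma> t a \<in> U"
    and "\<forall>t. \<forall>a\<in>U. \<forall>b\<in>U. opeq \<mu> (\<sigma> t (a +\<^sub>o b)) (\<sigma> t a +\<^sub>o \<sigma> t b)"
    and "\<forall>t c. \<forall>a\<in>U. opeq \<mu> (\<sigma> t (c *\<^sub>o a)) (c *\<^sub>o \<sigma> t a)"
    and "\<forall>t. \<forall>a\<in>U. opnorm \<mu> (\<sigma> t a) = opnorm \<mu> a"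
    and "\<forall>a\<in>U. opeq \<mu> (\<sigma> 0 a) a"
    and "\<forall>t f g n. continuous_on (Xk k) f \<longrightarrow> continuous_on (Xk k) g \<longrightarrow>
      opeq \<mu> (\<sigma> t (Mop f \<circ> en k p n \<circ> Mop g))
        (Mop (\<lambda>x. f x * Hit H t n x) \<circ> en k p n \<circ> Mop (\<lambda>x. cnj (Hit H t n x) * g x))"
  using sigma unfolding dynamics_def by - (elim conjE, assumption)+

lemmas sigma_U = sigma_props(1)[rule_format]
  and sigma_add = sigma_props(2)[rule_format]
  and sigma_smult = sigma_props(3)[rule_format]
  and sigma_opnorm = sigma_props(4)[rule_format]
  and sigma_zero = sigma_props(5)[rule_format]
  and sigma_gen = sigma_props(6)[rule_format]

lemma flow_real: "opeq \<mu> (flow k p (birk H n) f n g (complex_of_real t)) (\<sigma> t (gen_op k p f n g))"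
  if "continuous_on (Xk k) f" "continuous_on (Xk k) g"
proof -
  have "opeq \<mu> (\<sigma> t (Mop f \<circ> en k p n \<circ> Mop g))
      (Mop (\<lambda>x. f x * Hit H t n x) \<circ> en k p n \<circ> Mop (\<lambda>x. cnj (Hit H t n x) * g x))"
    by (rule sigma_gen[OF that])
  then have "opeq \<mu> (\<sigma> t (gen_op k p f n g)) (flow k p (birk H n) f n g (complex_of_real t))"
    unfolding flow_def gen_op_def cnj_Hit_eq unfolding Hit_eq .
  then show ?thesis by (rule opeq_sym)
qed

lemma flow_entire:
  assumes "continuous_on (Xk k) f" "continuous_on (Xk k) g"
  shows "entire_ext \<mu> k p \<sigma> (gen_op k p f n g) (flow k p (birk H n) f n g)"
  unfolding entire_ext_def
  by (intro conjI allI flow_U flow_real flow_differentiable birk_cont assms)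

lemma sigma_opnorm_diff:
  assumes a: "a \<in> U" and b: "b \<in> U"
  shows "opnorm \<mu> (\<sigma> t a -\<^sub>o \<sigma> t b) = opnorm \<mu> (a -\<^sub>o b)"
proof -
  have "opeq \<mu> (\<sigma> t (a -\<^sub>o b)) (\<sigma> t a +\<^sub>o \<sigma> t ((-1) *\<^sub>o b))"
    unfolding op_diff_eq by (intro sigma_add U_smult a b)
  moreover have "opeq \<mu> (\<sigma> t a +\<^sub>o \<sigma> t ((-1) *\<^sub>o b)) (\<sigma> t a +\<^sub>o ((-1) *\<^sub>o \<sigma> t b))"
    by (intro opeq_add opeq_refl sigma_smult b)
  ultimately have "opeq \<mu> (\<sigma> t (a -\<^sub>o b)) (\<sigma> t a -\<^sub>o \<sigma> t b)"
    using opeq_trans unfolding op_diff_eq by blast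
  then have "opnorm \<mu> (\<sigma> t (a -\<^sub>o b)) = opnorm \<mu> (\<sigma> t a -\<^sub>o \<sigma> t b)"
    by (intro opnorm_cong U_bop U_diff sigma_U a b)
  then show ?thesis using sigma_opnorm U_diff a b by simp
qed

lemma entire_ext_add:
  assumes "entire_ext \<mu> k p \<sigma> a F" "entire_ext \<mu> k p \<sigma> b G" "a \<in> U" "b \<in> U"
  shows "entire_ext \<mu> k p \<sigma> (a +\<^sub>o b) (\<lambda>z. F z +\<^sub>o G z)"
  unfolding entire_ext_def
proof (intro conjI allI)
  have FU: "F z \<in> U" and GU: "G z \<in> U" for z using assms by (simp_all add: entire_ext_def)
  show "F z +\<^sub>o G z \<in> U" for z by (intro U_add FU GU)
  show "opeq \<mu> (F (complex_of_real t) +\<^sub>o G (complex_of_real t)) (\<sigma> t (a +\<^sub>o b))" for t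
  proof (rule opeq_trans)
    show "opeq \<mu> (F (complex_of_real t) +\<^sub>o G (complex_of_real t)) (\<sigma> t a +\<^sub>o \<sigma> t b)"
      using assms by (intro opeq_add) (simp_all add: entire_ext_def)
    show "opeq \<mu> (\<sigma> t a +\<^sub>o \<sigma> t b) (\<sigma> t (a +\<^sub>o b))"
      by (intro opeq_sym[OF sigma_add] assms)
  qed
  fix z
  obtain D where D: "bop \<mu> D" "((\<lambda>w. opnorm \<mu> (F w -\<^sub>o F z -\<^sub>o (w - z) *\<^sub>o D) / cmod (w - z)) \<longlongrightarrow> 0) (at z)"
    using assms(1) unfolding entire_ext_def by blast
  obtain D' where D': "bop \<mu> D'" "((\<lambda>w. opnorm \<mu> (G w -\<^sub>o G z -\<^sub>o (w - z) *\<^sub>o D') / cmod (w - z)) \<longlongrightarrow> 0) (at z)"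
    using assms(2) unfolding entire_ext_def by blast
  show "\<exists>D. bop \<mu> D \<and> ((\<lambda>w. opnorm \<mu> ((F w +\<^sub>o G w) -\<^sub>o (F z +\<^sub>o G z) -\<^sub>o (w - z) *\<^sub>o D) / cmod (w - z)) \<longlongrightarrow> 0) (at z)"
  proof (intro exI conjI)
    show "bop \<mu> (D +\<^sub>o D')" by (intro bop_add D D')
    show "((\<lambda>w. opnorm \<mu> ((F w +\<^sub>o G w) -\<^sub>o (F z +\<^sub>o G z) -\<^sub>o (w - z) *\<^sub>o (D +\<^sub>o D')) / cmod (w - z)) \<longlongrightarrow> 0) (at z)"
    proof (rule Lim_null_comparison[OF always_eventually, OF allI])
      fix w
      let ?A = "F w -\<^sub>o F z -\<^sub>o (w - z) *\<^sub>o D" and ?B = "G w -\<^sub>o G z -\<^sub>o (w - z) *\<^sub>o D'"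
      have b: "bop \<mu> ?A" "bop \<mu> ?B" by (intro bop_diff bop_smult D D' U_bop FU GU)+
      have "(F w +\<^sub>o G w) -\<^sub>o (F z +\<^sub>o G z) -\<^sub>o (w - z) *\<^sub>o (D +\<^sub>o D') = ?A +\<^sub>o ?B"
        by (simp add: op_add_def op_diff_def op_smult_def fun_eq_iff algebra_simps)
      then have "opnorm \<mu> ((F w +\<^sub>o G w) -\<^sub>o (F z +\<^sub>o G z) -\<^sub>o (w - z) *\<^sub>o (D +\<^sub>o D')) \<le> opnorm \<mu> ?A + opnorm \<mu> ?B"
        and "0 \<le> opnorm \<mu> ((F w +\<^sub>o G w) -\<^sub>o (F z +\<^sub>o G z) -\<^sub>o (w - z) *\<^sub>o (D +\<^sub>o D'))"
        using bop_add(2)[OF b] opnorm_nonneg[OF bop_add(1)[OF b]] by simp_all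
      then show "norm (opnorm \<mu> ((F w +\<^sub>o G w) -\<^sub>o (F z +\<^sub>o G z) -\<^sub>o (w - z) *\<^sub>o (D +\<^sub>o D')) / cmod (w - z))
        \<le> opnorm \<mu> ?A / cmod (w - z) + opnorm \<mu> ?B / cmod (w - z)"
        by (simp add: add_divide_distrib[symmetric] divide_right_mono)
    next
      show "((\<lambda>w. opnorm \<mu> (F w -\<^sub>o F z -\<^sub>o (w - z) *\<^sub>o D) / cmod (w - z)
          + opnorm \<mu> (G w -\<^sub>o G z -\<^sub>o (w - z) *\<^sub>o D') / cmod (w - z)) \<longlongrightarrow> 0) (at z)"
        using tendsto_add[OF D(2) D'(2)] by simp
    qed
  qed
qed

text \<open>The induction carries all that \<open>strip_limit\<close> will ask of an approximant: an
  extension, its boundedness on horizontal strips, and the KMS identity at every real t, since a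
  whole boundary line is needed and not just one point. The extension is existential, so no
  canonical decomposition into generators is required.\<close>

lemma Alg0_kms:
  assumes inv: invariance and a: "a \<in> Alg0 k p"
  shows "\<exists>F. entire_ext \<mu> k p \<sigma> a F
    \<and> (\<forall>R. \<exists>B. \<forall>z. \<bar>Im z\<bar> \<le> R \<longrightarrow> opnorm \<mu> (F z) \<le> B)
    \<and> (\<forall>t. \<forall>b\<in>U. \<psi> (F (complex_of_real t) \<circ> b) = \<psi> (b \<circ> F (complex_of_real t + \<i> * complex_of_real \<beta>)))"
  using a
proof (induction rule: Alg0_induct)
  case (gen f g n)
  show ?case
  proof (intro exI[of _ "flow k p (birk H n) f n g"] conjI allI ballI)
    show "entire_ext \<mu> k p \<sigma> (gen_op k p f n g) (flow k p (birk H n) f n g)"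
      by (rule flow_entire[OF gen])
    show "\<exists>B. \<forall>z. \<bar>Im z\<bar> \<le> R \<longrightarrow> opnorm \<mu> (flow k p (birk H n) f n g z) \<le> B" for R
      by (rule flow_opnorm[OF birk_cont gen])
    fix t b assume b: "b \<in> U"
    have "flow k p (birk H n) f n g (complex_of_real t) =
      gen_op k p (\<lambda>x. f x * exp (\<i> * complex_of_real t * complex_of_real (birk H n x))) n
        (\<lambda>x. exp (- (\<i> * complex_of_real t * complex_of_real (birk H n x))) * g x)"
      by (simp add: flow_def)
    then show "\<psi> (flow k p (birk H n) f n g (complex_of_real t) \<circ> b)
        = \<psi> (b \<circ> flow k p (birk H n) f n g (complex_of_real t + \<i> * complex_of_real \<beta>))"
      unfolding flow_add using kms_gen[OF inv flow_cont[OF birk_cont gen] b] by simp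
  qed
next
  case (add A B)
  obtain F where F: "entire_ext \<mu> k p \<sigma> A F" "\<And>R. \<exists>B. \<forall>z. \<bar>Im z\<bar> \<le> R \<longrightarrow> opnorm \<mu> (F z) \<le> B"
    "\<And>t b. b \<in> U \<Longrightarrow> \<psi> (F (complex_of_real t) \<circ> b) = \<psi> (b \<circ> F (complex_of_real t + \<i> * complex_of_real \<beta>))"
    using add.IH(1) by blast
  obtain G where G: "entire_ext \<mu> k p \<sigma> B G" "\<And>R. \<exists>B. \<forall>z. \<bar>Im z\<bar> \<le> R \<longrightarrow> opnorm \<mu> (G z) \<le> B"
    "\<And>t b. b \<in> U \<Longrightarrow> \<psi> (G (complex_of_real t) \<circ> b) = \<psi> (b \<circ> G (complex_of_real t + \<i> * complex_of_real \<beta>))"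
    using add.IH(2) by blast
  have FU: "F z \<in> U" and GU: "G z \<in> U" for z using F(1) G(1) by (simp_all add: entire_ext_def)
  show ?case
  proof (intro exI[of _ "\<lambda>z. F z +\<^sub>o G z"] conjI allI ballI)
    show "entire_ext \<mu> k p \<sigma> (A +\<^sub>o B) (\<lambda>z. F z +\<^sub>o G z)"
      by (intro entire_ext_add F G Alg0_U add.hyps)
    fix R
    obtain B1 where B1: "\<And>z. \<bar>Im z\<bar> \<le> R \<Longrightarrow> opnorm \<mu> (F z) \<le> B1" using F(2)[of R] by blast
    obtain B2 where B2: "\<And>z. \<bar>Im z\<bar> \<le> R \<Longrightarrow> opnorm \<mu> (G z) \<le> B2" using G(2)[of R] by blast
    have "opnorm \<mu> (F z +\<^sub>o G z) \<le> B1 + B2" if "\<bar>Im z\<bar> \<le> R" for z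
      using bop_add(2)[OF U_bop[OF FU] U_bop[OF GU], of z z] B1[OF that] B2[OF that] by linarith
    then show "\<exists>B. \<forall>z. \<bar>Im z\<bar> \<le> R \<longrightarrow> opnorm \<mu> (F z +\<^sub>o G z) \<le> B" by blast
  next
    fix t b assume b: "b \<in> U"
    show "\<psi> ((F (complex_of_real t) +\<^sub>o G (complex_of_real t)) \<circ> b)
      = \<psi> (b \<circ> (F (complex_of_real t + \<i> * complex_of_real \<beta>) +\<^sub>o G (complex_of_real t + \<i> * complex_of_real \<beta>)))"
      using bf_add[OF bf_comp_right[OF psi_bf b] FU GU] bf_add[OF bf_comp_left[OF psi_bf b] FU GU]
        F(3)[OF b] G(3)[OF b] by simp
  qed
qed

lemma invariance_imp_kms:
  assumes inv: invariance and a: "a \<in> U" and F: "entire_ext \<mu> k p \<sigma> a F" and b: "b \<in> U"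
  shows "\<psi> (a \<circ> b) = \<psi> (b \<circ> F (\<i> * complex_of_real \<beta>))"
proof -
  note bl = bf_comp_left[OF psi_bf b] and br = bf_comp_right[OF psi_bf b]
  obtain C where C: "C \<ge> 0" "\<And>a. a \<in> U \<Longrightarrow> cmod (\<psi> (b \<circ> a)) \<le> C * opnorm \<mu> a" using bf_bound[OF bl] by metis
  obtain C' where C': "C' \<ge> 0" "\<And>a. a \<in> U \<Longrightarrow> cmod (\<psi> (a \<circ> b)) \<le> C' * opnorm \<mu> a" using bf_bound[OF br] by metis
  have FU: "F z \<in> U" for z using F by (simp add: entire_ext_def)
  have "\<exists>A. \<forall>j. A j \<in> Alg0 k p \<and> opnorm \<mu> (A j -\<^sub>o a) < 1 / real (Suc j)"
  proof (rule choice, rule allI)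
    fix j
    obtain B where B: "B \<in> Alg0 k p" "opnorm \<mu> (a -\<^sub>o B) < 1 / real (Suc j)"
      using U_approx[OF a, of "1 / real (Suc j)"] by (metis of_nat_0_less_iff zero_less_Suc zero_less_divide_1_iff)
    have "B -\<^sub>o a = (-1) *\<^sub>o (a -\<^sub>o B)" by (simp add: op_diff_def op_smult_def)
    then have "opnorm \<mu> (B -\<^sub>o a) \<le> opnorm \<mu> (a -\<^sub>o B)"
      using bop_smult(2)[OF U_bop[OF U_diff[OF a Alg0_U[OF B(1)]]], of "-1"] by simp
    then show "\<exists>A. A \<in> Alg0 k p \<and> opnorm \<mu> (A -\<^sub>o a) < 1 / real (Suc j)" using B by force
  qed
  then obtain A where A: "\<And>j. A j \<in> Alg0 k p" "\<And>j. opnorm \<mu> (A j -\<^sub>o a) < 1 / real (Suc j)" by blast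
  have "\<exists>G. \<forall>j. entire_ext \<mu> k p \<sigma> (A j) (G j)
    \<and> (\<forall>R. \<exists>B. \<forall>z. \<bar>Im z\<bar> \<le> R \<longrightarrow> opnorm \<mu> (G j z) \<le> B)
    \<and> (\<forall>t. \<forall>b\<in>U. \<psi> (G j (complex_of_real t) \<circ> b) = \<psi> (b \<circ> G j (complex_of_real t + \<i> * complex_of_real \<beta>)))"
    by (rule choice, rule allI, rule Alg0_kms[OF inv A(1)])
  then obtain G where G: "\<And>j. entire_ext \<mu> k p \<sigma> (A j) (G j)"
    "\<And>j R. \<exists>B. \<forall>z. \<bar>Im z\<bar> \<le> R \<longrightarrow> opnorm \<mu> (G j z) \<le> B"
    "\<And>j t b. b \<in> U \<Longrightarrow> \<psi> (G j (complex_of_real t) \<circ> b) = \<psi> (b \<circ> G j (complex_of_real t + \<i> * complex_of_real \<beta>))"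
    by blast
  have GU: "G j z \<in> U" for j z using G(1) by (simp add: entire_ext_def)
  \<comment> \<open>At real parameters both extensions represent the dynamics, which is isometric,
    so the distance of A j from a bounds theirs uniformly in t.\<close>
  have close: "opnorm \<mu> (G j (complex_of_real t) -\<^sub>o F (complex_of_real t)) \<le> 1 / real (Suc j)" for j t
  proof -
    have "opeq \<mu> (G j (complex_of_real t) -\<^sub>o F (complex_of_real t)) (\<sigma> t (A j) -\<^sub>o \<sigma> t a)"
      using G(1)[of j] F by (intro opeq_diff) (simp_all add: entire_ext_def)
    then have "opnorm \<mu> (G j (complex_of_real t) -\<^sub>o F (complex_of_real t)) = opnorm \<mu> (\<sigma> t (A j) -\<^sub>o \<sigma> t a)"
      by (intro opnorm_cong U_bop U_diff GU FU sigma_U Alg0_U A a)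
    also have "\<dots> = opnorm \<mu> (A j -\<^sub>o a)" by (rule sigma_opnorm_diff[OF Alg0_U[OF A(1)] a])
    finally show ?thesis using A(2)[of j] by simp
  qed
  \<comment> \<open>Rescaling by \<beta> makes z = i correspond to the parameter i beta, so that the
    strip of height 1 serves for positive, zero and negative \<beta> alike.\<close>
  have scale: "(\<lambda>z. \<psi> (b \<circ> E (complex_of_real \<beta> * z))) holomorphic_on UNIV" if "entire_ext \<mu> k p \<sigma> c E" for c E
    using holomorphic_on_compose_gen[of "\<lambda>z. complex_of_real \<beta> * z" UNIV "\<lambda>z. \<psi> (b \<circ> E z)" UNIV]
      entire_ext_holomorphic[OF that bl] by (simp add: comp_def holomorphic_intros)
  \<comment> \<open>C controls multiplication by b on the left, needed on the lower line, and C'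
    multiplication by b on the right, needed on the upper one; their sum serves as the common error
    constant.\<close>
  have "\<psi> (b \<circ> F (complex_of_real \<beta> * \<i>)) = \<psi> (F (complex_of_real (\<beta> * 0)) \<circ> b)"
  proof (rule strip_limit[where g = "\<lambda>z. \<psi> (b \<circ> F (complex_of_real \<beta> * z))"
        and G = "\<lambda>j z. \<psi> (b \<circ> G j (complex_of_real \<beta> * z))" and \<epsilon> = "\<lambda>j. (C + C') * (1 / real (Suc j))"
        and c = "\<lambda>t. \<psi> (F (complex_of_real (\<beta> * t)) \<circ> b)"])
    show "(\<lambda>z. \<psi> (b \<circ> F (complex_of_real \<beta> * z))) holomorphic_on UNIV" by (rule scale[OF F])
    show "(\<lambda>z. \<psi> (b \<circ> G j (complex_of_real \<beta> * z))) holomorphic_on UNIV" for j by (rule scale[OF G(1)])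
    show "\<exists>K. \<forall>z. 0 \<le> Im z \<longrightarrow> Im z \<le> 1 \<longrightarrow> cmod (\<psi> (b \<circ> G j (complex_of_real \<beta> * z))) \<le> K" for j
    proof -
      obtain B where B: "\<And>z. \<bar>Im z\<bar> \<le> \<bar>\<beta>\<bar> \<Longrightarrow> opnorm \<mu> (G j z) \<le> B" using G(2)[of \<open>\<bar>\<beta>\<bar>\<close> j] by blast
      have "cmod (\<psi> (b \<circ> G j (complex_of_real \<beta> * z))) \<le> C * B" if "0 \<le> Im z" "Im z \<le> 1" for z
      proof -
        have "\<bar>Im (complex_of_real \<beta> * z)\<bar> \<le> \<bar>\<beta>\<bar>" using that by (simp add: abs_mult mult_left_le)
        then show ?thesis using C(2)[OF GU, of j "complex_of_real \<beta> * z"] mult_left_mono[OF B C(1)] by fastforce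
      qed
      then show ?thesis by blast
    qed
    have le: "C * (1 / real (Suc j)) \<le> (C + C') * (1 / real (Suc j))"
      "C' * (1 / real (Suc j)) \<le> (C + C') * (1 / real (Suc j))" for j
      using C(1) C'(1) by (intro mult_right_mono; simp)+
    show "cmod (\<psi> (b \<circ> G j (complex_of_real \<beta> * complex_of_real t)) - \<psi> (b \<circ> F (complex_of_real \<beta> * complex_of_real t)))
        \<le> (C + C') * (1 / real (Suc j))" for j t
    proof -
      have "cmod (\<psi> (b \<circ> (G j (complex_of_real (\<beta> * t)) -\<^sub>o F (complex_of_real (\<beta> * t))))) \<le> C * (1 / real (Suc j))"
        by (rule order_trans[OF C(2)[OF U_diff[OF GU FU]] mult_left_mono[OF close C(1)]])
      then show ?thesis using le(1)[of j] bf_diff[OF bl GU FU] by simp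
    qed
    \<comment> \<open>No comparison of \<open>G j\<close> and F is available off the real axis. The
      KMS identity of the approximant moves its upper value to the real parameter \<beta> t, where
      \<open>close\<close> applies.\<close>
    show "cmod (\<psi> (b \<circ> G j (complex_of_real \<beta> * (complex_of_real t + \<i>))) - \<psi> (F (complex_of_real (\<beta> * t)) \<circ> b))
        \<le> (C + C') * (1 / real (Suc j))" for j t
    proof -
      have "\<psi> (b \<circ> G j (complex_of_real \<beta> * (complex_of_real t + \<i>))) = \<psi> (G j (complex_of_real (\<beta> * t)) \<circ> b)"
        using G(3)[OF b, of j "\<beta> * t"] by (simp add: distrib_left mult.commute)
      moreover have "cmod (\<psi> ((G j (complex_of_real (\<beta> * t)) -\<^sub>o F (complex_of_real (\<beta> * t))) \<circ> b)) \<le> C' * (1 / real (Suc j))"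
        by (rule order_trans[OF C'(2)[OF U_diff[OF GU FU]] mult_left_mono[OF close C'(1)]])
      ultimately show ?thesis using le(2)[of j] bf_diff[OF br GU FU] by simp
    qed
    show "(\<lambda>j. (C + C') * (1 / real (Suc j))) \<longlonglongrightarrow> 0"
      by real_asymp
  qed
  moreover have "\<psi> (F (complex_of_real (\<beta> * 0)) \<circ> b) = \<psi> (a \<circ> b)"
  proof (rule bf_cong[OF br FU a])
    have "opeq \<mu> (F (complex_of_real 0)) (\<sigma> 0 a)" using F unfolding entire_ext_def by blast
    then show "opeq \<mu> (F (complex_of_real (\<beta> * 0))) a" using opeq_trans sigma_zero[OF a] by force
  qed
  ultimately show ?thesis by (simp add: mult.commute)
qed

lemma kms_imp_invariance:
  assumes kms: "\<And>a F b. a \<in> U \<Longrightarrow> entire_ext \<mu> k p \<sigma> a F \<Longrightarrow> b \<in> U \<Longrightarrow>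
    \<psi> (a \<circ> b) = \<psi> (b \<circ> F (\<i> * complex_of_real \<beta>))"
  shows invariance
  unfolding invariance_def invariance_rhs
proof (intro allI impI)
  fix n and f :: cfun assume f: "continuous_on (Xk k) f"
  \<comment> \<open>Dividing by \<open>lam n\<close> multiplies f by lambda^[n]. On the side of
    \<open>a \<circ> b\<close> this cancels the weight in the formula for \<psi>; on the other side
    it joins \<open>Hneg n\<close> to form Lambda_n inside the expectation.\<close>
  let ?f = "\<lambda>x. f x / lam n x" and ?one = "\<lambda>_::pt. 1::complex"
  have f': "continuous_on (Xk k) ?f" using lam_nonzero by (intro cont_intros f) auto
  have one: "continuous_on (Xk k) ?one" by (intro continuous_intros)
  have "(\<integral>x. f x \<partial>\<nu>) = (\<integral>x. ?f x * lam n x * (en k p n (\<lambda>y. ?one y * ?one y) x * ?one x) \<partial>\<nu>)"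
    by (rule integral_nu_cong) (use lam_nonzero en_one in simp)
  also have "\<dots> = \<psi> (gen_op k p ?f n ?one \<circ> gen_op k p ?one n ?one)"
    unfolding gen_op_comp_ge[OF order_refl] by (rule psi_gen[symmetric]) (intro cont_intros f' one)+
  also have "\<dots> = \<psi> (gen_op k p ?one n ?one \<circ> flow k p (birk H n) ?f n ?one (\<i> * complex_of_real \<beta>))"
    by (intro kms gen_op_U flow_entire f' one)
  also have "\<dots> = (\<integral>x. ?one x * en k p n (\<lambda>y. ?one y * (?f y * Hneg n y)) x * lam n x * (Hpow n x * ?one x) \<partial>\<nu>)"
    unfolding flow_i\<beta> gen_op_comp_le[OF order_refl] by (rule psi_gen) (intro cont_intros f' one)+
  also have "\<dots> = (\<integral>x. Hpow n x * lam n x * en k p n (\<lambda>y. Hneg n y / lam n y * f y) x \<partial>\<nu>)"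
    by (simp add: mult_ac)
  finally show "(\<integral>x. f x \<partial>\<nu>) = (\<integral>x. Hpow n x * lam n x * en k p n (\<lambda>y. Hneg n y / lam n y * f y) x \<partial>\<nu>)" .
qed

end

theorem theorem2p1:
  fixes k :: nat and p H :: "pt \<Rightarrow> real" and \<beta> :: real
    and \<mu> \<nu> :: "pt measure" and \<sigma> :: "real \<Rightarrow> op \<Rightarrow> op" and \<psi> :: "op \<Rightarrow> complex"
  assumes p_pos: "\<forall>x\<in>Xk k. p x > 0"
    and p_holder: "holder_on (Xk k) p"
    and p_norm: "\<forall>x\<in>Xk k. (\<Sum>a\<in>{1..k}. p (case_nat a x)) = 1"
    and mu_prob: "prob_space \<mu>"
    and mu_sets: "sets \<mu> = sets (restrict_space borel (Xk k))"
    and mu_inv: "\<forall>f. continuous_on (Xk k) f \<longrightarrow> (\<integral>x. Lp k p f x \<partial>\<mu>) = (\<integral>x. f x \<partial>\<mu>)"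
    and H_pos: "\<forall>x\<in>Xk k. H x > 0"
    and H_holder: "holder_on (Xk k) H"
    and sigma: "dynamics \<mu> k p H \<sigma>"
    and nu_prob: "prob_space \<nu>"
    and nu_sets: "sets \<nu> = sets (restrict_space borel (Xk k))"
    and psi_state: "is_state \<mu> k p \<psi>"
    and psi_cont: "\<exists>C. \<forall>a\<in>Ualg \<mu> k p. cmod (\<psi> a) \<le> C * opnorm \<mu> a"
    and psi_def: "\<forall>f g n. continuous_on (Xk k) f \<longrightarrow> continuous_on (Xk k) g \<longrightarrow>
        \<psi> (Mop f \<circ> en k p n \<circ> Mop g) = (\<integral>x. f x * complex_of_real (lam_inv p n x) * g x \<partial>\<nu>)"
  shows "KMS \<mu> k p \<sigma> \<beta> \<psi> \<longleftrightarrow>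
    (\<forall>n f. continuous_on (Xk k) f \<longrightarrow>
       (\<integral>x. f x \<partial>\<nu>) =
       (\<integral>x. complex_of_real (1 / Lambda p H \<beta> n x)
             * ((Lp k p ^^ n) (\<lambda>y. complex_of_real (Lambda p H \<beta> n y) * f y)) ((shift ^^ n) x) \<partial>\<nu>))"
proof -
  have gibbs: "gibbs k p \<mu>"
  proof (rule gibbs.intro)
    show "continuous_on (Xk k) p" by (rule holder_on_imp_continuous_on[OF p_holder])
  qed (use p_pos p_norm mu_prob mu_sets mu_inv in simp_all)
  interpret gibbs k p \<mu> by (rule gibbs)
  have "kms_setting k p \<mu> H \<nu> \<sigma> \<psi>"
  proof (intro kms_setting.intro kms_setting_axioms.intro gibbs)
    show "continuous_on (Xk k) H" by (rule holder_on_imp_continuous_on[OF H_holder])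
    show "bounded_functional \<psi>"
      unfolding bounded_functional_def
      using psi_state[unfolded is_state_def, THEN conjunct1]
        psi_state[unfolded is_state_def, THEN conjunct2, THEN conjunct1] psi_cont by (intro conjI)
    show "\<psi> (gen_op k p f n g) = (\<integral>x. f x * complex_of_real (lam_inv p n x) * g x \<partial>\<nu>)"
      if "continuous_on (Xk k) f" "continuous_on (Xk k) g" for f g n
      unfolding gen_op_def by (rule psi_def[rule_format, OF that])
    show "dynamics \<mu> k p H \<sigma>" by (rule sigma)
  qed (use H_pos nu_sets in simp_all)
  then interpret kms_setting k p \<mu> H \<beta> \<nu> \<sigma> \<psi> .
  have "KMS \<mu> k p \<sigma> \<beta> \<psi> \<longleftrightarrow> invariance"
  proof
    assume "KMS \<mu> k p \<sigma> \<beta> \<psi>"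
    note kms = this[unfolded KMS_def, THEN conjunct2, rule_format]
    show invariance by (rule kms_imp_invariance, rule kms)
  next
    assume invariance
    then show "KMS \<mu> k p \<sigma> \<beta> \<psi>"
      unfolding KMS_def using psi_state by (intro conjI allI impI ballI invariance_imp_kms)
  qed
  then show ?thesis unfolding invariance_def .
qed

end
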